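(* (1) For any two-way monotone, branching tree poset $T$, integer $k\ge h(T)$, and real $\varepsilon>0$, there exists a constant $\delta>0$ such that for all sufficiently large $n$, $\mathrm{ar}_m\!\left(n,\left\lceil(k-1+\varepsilon)\binom{n}{\lfloor n/2\rfloor}\right\rceil,T\right)\ge\delta n^{m_{T,k}}$. (2) For any tree poset $T$ of height $2$ and real $\varepsilon>0$, there exists a constant $\delta>0$ such that for all sufficiently large $n$, $\mathrm{ar}_m\!\left(n,\left\lceil(1+\varepsilon)\binom{n}{\lfloor n/2\rfloor}\right\rceil,T\right)\ge\delta n^{m_{T,2}}$.
   Context: All posets are finite, $[n]=\{1,\dots,n\}$. A family $\mathcal G$ of sets is a weak copy of a poset $(P,\preceq)$ if there is a bijection $\iota:P\to\mathcal G$ such that $p\preceq q$ implies $\iota(p)\subseteq\iota(q)$. For $1<m\le2^n$, $\mathrm{ar}_m(n,m,P)$ is the minimum integer $c$ such that there exist $\mathcal F\subseteq2^{[n]}$ with $|\mathcal F|=m$ and a coloring $\mathcal F\to[c]$ under which every weak copy of $P$ contained in $\mathcal F$ is rainbow (all its sets get distinct colors). The undirected Hasse diagram $H(P)$ is the graph on $P$ whose edges join $p,q$ when one covers the other. A tree poset is a poset $T$ with $H(T)$ a tree. The height $h(T)$ is the largest number of elements in a chain of $T$. The exponent $m_{T,k}$: let $\mathcal M_{n,k}=\bigcup_{i=1}^k\binom{[n]}{\lfloor (n-k)/2\rfloor+i}$ (the $k$ middle layers), and let $G_T(\mathcal M_{n,k})$ be the graph on $\mathcal M_{n,k}$ in which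 two distinct sets are adjacent iff some weak copy of $T$ contained in $\mathcal M_{n,k}$ contains both. Then $m_{T,k}$ is the non-negative integer (which exists) such that $\chi(G_T(\mathcal M_{n,k}))=\Theta(n^{m_{T,k}})$ as $n\to\infty$ with $T,k$ fixed. Monotone and branching trees: a tree poset is upward monotone if it has a smallest element, downward monotone if it has a largest element, and two-way monotone if it contains an element comparable to all elements. An upward monotone tree poset $T$ with smallest element $r$ branches at level $i$ if there are two distinct leaves (maximal elements) $x,y$ with $\min\{d(r,z): z\text{ is on the path between }x\text{ and }y\text{ in }H(T)\}=i$, where $d$ is graph distance in $H(T)$. An upward monotone tree poset $T$ is branching if whenever it branches at a level $i<h(T)-2$ it also branches at level $i+1$. A downward monotone tree poset is branching if its dual is branching. If $T$ is two-way monotone, the elements comparable to all elements form a chain $x_1\prec\dots\prec x_s$; write $D_T[x_1]=\{y: y\preceq x_1\}$ (downward monotone) and $U_T[x_s]=\{y: x_s\preceq y\}$ (upward monotone). $T$ is branching if, out of $D_T[x_1]$ and $U_T[x_s]$, the one of larger height is branching, or, if their heights are equal, at least one of them is branching. *)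

theory Defs
  imports Complex_Main "HOL-Library.Landau_Symbols"
begin

text \<open>
  A finite poset is represented by its reflexive order relation \<open>T\<close>, with \<open>(p, q) \<in> T\<close> meaning
  \<open>p \<preceq> q\<close>; the underlying set is \<open>Field T\<close>. The dual is \<open>T\<inverse>\<close> and the
  subposet induced on \<open>A\<close> is \<open>Restr T A\<close>.
  A simple graph is a vertex set together with a symmetric irreflexive edge relation.
\<close>

section \<open>Graphs\<close>

definition path_in :: "('v \<times> 'v) set \<Rightarrow> 'v list \<Rightarrow> bool" where
  "path_in E p \<longleftrightarrow> p \<noteq> [] \<and> distinct p \<and> successively (\<lambda>x y. (x, y) \<in> E) p"

definition path_between :: "('v \<times> 'v) set \<Rightarrow> 'v \<Rightarrow> 'v \<Rightarrow> 'v list \<Rightarrow> bool" where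
  "path_between E x y p \<longleftrightarrow> path_in E p \<and> hd p = x \<and> last p = y"

definition cycle_in :: "('v \<times> 'v) set \<Rightarrow> 'v list \<Rightarrow> bool" where
  "cycle_in E p \<longleftrightarrow> path_in E p \<and> length p \<ge> 3 \<and> (last p, hd p) \<in> E"

definition tree_graph :: "'v set \<Rightarrow> ('v \<times> 'v) set \<Rightarrow> bool" where
  "tree_graph V E \<longleftrightarrow>
     V \<noteq> {} \<and> (\<forall>x\<in>V. \<forall>y\<in>V. \<exists>p. set p \<subseteq> V \<and> path_between E x y p) \<and>
     \<not> (\<exists>p. set p \<subseteq> V \<and> cycle_in E p)"

definition graph_dist :: "('v \<times> 'v) set \<Rightarrow> 'v \<Rightarrow> 'v \<Rightarrow> nat" where
  "graph_dist E x y = (LEAST n. (x, y) \<in> E ^^ n)"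

definition chromatic_number :: "'v set \<Rightarrow> ('v \<times> 'v) set \<Rightarrow> nat" where
  "chromatic_number V E =
     (LEAST c. \<exists>f. f ` V \<subseteq> {1..c} \<and> (\<forall>x\<in>V. \<forall>y\<in>V. (x, y) \<in> E \<longrightarrow> f x \<noteq> f y))"

section \<open>Posets\<close>

definition covers :: "('a \<times> 'a) set \<Rightarrow> 'a \<Rightarrow> 'a \<Rightarrow> bool" where
  "covers T q p \<longleftrightarrow> (p, q) \<in> T \<and> p \<noteq> q \<and>
     \<not> (\<exists>z. (p, z) \<in> T \<and> (z, q) \<in> T \<and> z \<noteq> p \<and> z \<noteq> q)"

definition hasse :: "('a \<times> 'a) set \<Rightarrow> ('a \<times> 'a) set" where
  "hasse T = {(p, q). covers T p q \<or> covers T q p}"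

definition tree_poset :: "('a \<times> 'a) set \<Rightarrow> bool" where
  "tree_poset T \<longleftrightarrow> finite (Field T) \<and> Partial_order T \<and> tree_graph (Field T) (hasse T)"

definition height :: "('a \<times> 'a) set \<Rightarrow> nat" where
  "height T = Max (card ` Chains T)"

definition smallest :: "('a \<times> 'a) set \<Rightarrow> 'a \<Rightarrow> bool" where
  "smallest T r \<longleftrightarrow> r \<in> Field T \<and> (\<forall>x\<in>Field T. (r, x) \<in> T)"

definition maximal :: "('a \<times> 'a) set \<Rightarrow> 'a \<Rightarrow> bool" where
  "maximal T x \<longleftrightarrow> x \<in> Field T \<and> (\<forall>y. (x, y) \<in> T \<longrightarrow> y = x)"

section \<open>Monotone and branching trees\<close>

text \<open>
  The next two definitions are meant for upward monotone tree posets. There the path between two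
  vertices of the Hasse diagram exists and is unique.
\<close>

definition branches_at :: "('a \<times> 'a) set \<Rightarrow> nat \<Rightarrow> bool" where
  "branches_at T i \<longleftrightarrow>
     (\<exists>r x y p. smallest T r \<and> maximal T x \<and> maximal T y \<and> x \<noteq> y \<and>
        path_between (hasse T) x y p \<and>
        Min ((\<lambda>z. graph_dist (hasse T) r z) ` set p) = i)"

definition upward_branching :: "('a \<times> 'a) set \<Rightarrow> bool" where
  "upward_branching T \<longleftrightarrow>
     (\<forall>i. int i < int (height T) - 2 \<longrightarrow> branches_at T i \<longrightarrow> branches_at T (i + 1))"

definition downward_branching :: "('a \<times> 'a) set \<Rightarrow> bool" where
  "downward_branching T \<longleftrightarrow> upward_branching (T\<inverse>)"

definition comparable_to_all :: "('a \<times> 'a) set \<Rightarrow> 'a set" where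
  "comparable_to_all T = {x \<in> Field T. \<forall>y\<in>Field T. (x, y) \<in> T \<or> (y, x) \<in> T}"

definition two_way_monotone :: "('a \<times> 'a) set \<Rightarrow> bool" where
  "two_way_monotone T \<longleftrightarrow> comparable_to_all T \<noteq> {}"

definition down_set :: "('a \<times> 'a) set \<Rightarrow> 'a \<Rightarrow> ('a \<times> 'a) set" where
  "down_set T x = Restr T {y. (y, x) \<in> T}"

definition up_set :: "('a \<times> 'a) set \<Rightarrow> 'a \<Rightarrow> ('a \<times> 'a) set" where
  "up_set T x = Restr T {y. (x, y) \<in> T}"

text \<open>
  For a two-way monotone \<open>T\<close>, the elements comparable to all others form a finite nonempty chain,
  and \<open>x\<close>, \<open>x'\<close> below are forced to be its bottom and its top.
\<close>

definition two_way_branching :: "('a \<times> 'a) set \<Rightarrow> bool" where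
  "two_way_branching T \<longleftrightarrow>
     (\<exists>x x'. smallest (Restr T (comparable_to_all T)) x \<and>
             smallest ((Restr T (comparable_to_all T))\<inverse>) x' \<and>
        (let D = down_set T x; U = up_set T x' in
           if height D > height U then downward_branching D
           else if height U > height D then upward_branching U
           else downward_branching D \<or> upward_branching U))"

section \<open>Weak copies and rainbow colorings\<close>

definition weak_copy :: "('a \<times> 'a) set \<Rightarrow> 'b set set \<Rightarrow> bool" where
  "weak_copy T \<G> \<longleftrightarrow>
     (\<exists>\<iota>. bij_betw \<iota> (Field T) \<G> \<and> (\<forall>p q. (p, q) \<in> T \<longrightarrow> \<iota> p \<subseteq> \<iota> q))"

definition ar_m :: "nat \<Rightarrow> nat \<Rightarrow> ('a \<times> 'a) set \<Rightarrow> nat" where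
  "ar_m n m T =
     (LEAST c. \<exists>(\<F> :: nat set set) (col :: nat set \<Rightarrow> nat).
        \<F> \<subseteq> Pow {1..n} \<and> card \<F> = m \<and> col ` \<F> \<subseteq> {1..c} \<and>
        (\<forall>\<G>. \<G> \<subseteq> \<F> \<and> weak_copy T \<G> \<longrightarrow> inj_on col \<G>))"

text \<open>The division is on \<open>int\<close>, so that it rounds down also when \<open>n < k\<close>.\<close>

definition middle_layers :: "nat \<Rightarrow> nat \<Rightarrow> nat set set" where
  "middle_layers n k =
     (\<Union>i\<in>{1..k}. {A. A \<subseteq> {1..n} \<and> int (card A) = (int n - int k) div 2 + int i})"

definition copy_graph :: "('a \<times> 'a) set \<Rightarrow> 'b set set \<Rightarrow> ('b set \<times> 'b set) set" where
  "copy_graph T \<F> =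
     {(A, B). A \<noteq> B \<and> (\<exists>\<G>. \<G> \<subseteq> \<F> \<and> weak_copy T \<G> \<and> A \<in> \<G> \<and> B \<in> \<G>)}"

definition m_exponent :: "('a \<times> 'a) set \<Rightarrow> nat \<Rightarrow> nat" where
  "m_exponent T k =
     (THE e. (\<lambda>n. real (chromatic_number (middle_layers n k) (copy_graph T (middle_layers n k))))
               \<in> \<Theta>(\<lambda>n. real n ^ e))"

end

theory Submission
  imports
    Defs
    "HOL-Algebra.Algebraic_Closure_Type"
    "HOL-Library.Z2"
    "HOL-Combinatorics.Multiset_Permutations"
    "HOL-Real_Asymp.Real_Asymp"
begin

text \<open>
  Call a subfamily of \<open>F\<close> a clique if any two of its members lie in a common weak copy of \<open>T\<close> contained
  in \<open>F\<close>. A coloring under which all copies are rainbow is injective on cliques. So both parts follow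
  once every family of about \<open>k - 1 + \<epsilon>\<close> times the size of the middle layer contains a clique of size at
  least \<open>\<delta> * n ^ e\<close>, where \<open>e\<close> is the exponent of the chromatic number (for trees of height two,
  \<open>k = 2\<close>). This property, \<open>clique_bound\<close>, also yields the lower bound for the chromatic number, because
  the \<open>k\<close> middle layers are such a family. The matching upper bound comes from a coloring with \<open>O(n ^ e)\<close>
  colors in which equal-sized sets that differ by exchanging at most \<open>e\<close> elements get different colors
  (\<open>distance_coloring\<close>), as all equal-sized sets of a copy in the \<open>k\<close> middle
  layers are that close. Together they determine the exponent (\<open>m_exponent_eq\<close>).

  To find cliques, consider a random full chain of the cube. It meets \<open>F\<close> in more than \<open>k - 1\<close> sets on
  average, so runs of \<open>k\<close> consecutive members of \<open>F\<close> have positive total weight. Pruning them leaves a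
  system of \<open>k\<close>-chains (\<open>chain_system\<close>) in which every set, in the position where it occurs, can be
  continued upwards and downwards to a constant proportion of all possible sets, in particular to
  linearly many. Hence trees can be embedded greedily: a new vertex has only one neighbour in the part
  already embedded, and there are plenty of candidates (\<open>greedy_embedding\<close>). For two sets to lie in a
  common copy it is therefore enough to join them by a path of sets that fits a path of the Hasse
  diagram (\<open>embed_path\<close>).

  Let \<open>T\<close> be two-way monotone and let \<open>a\<close> be its largest element comparable to all others, with \<open>j\<close>
  elements on a longest chain below it. A set in position \<open>j\<close> of the system is linked to at least
  of the order of \<open>n ^ (k - 1 - j)\<close> sets in the last position. Any two of these are reached by chains
  that part at some set, and the branching property provides a fork of \<open>T\<close> at the right depth, with two leaves that are
  mapped to the two sets (\<open>tops_pair_in_copy\<close>). The other case is dual.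

  Let \<open>T\<close> have height two, with \<open>2 * e\<close> or \<open>2 * e + 1\<close> edges on a longest path. If the two sets of a chain
  always differ in at least \<open>e\<close> elements, the sets linked to a single set form a clique of order \<open>n ^ e\<close>.
  Otherwise all differences may be assumed to have the same small size. Alternating walks of length \<open>e\<close>
  from a fixed set that never touch an element twice reach of the order of \<open>n ^ e\<close> sets
  (\<open>sphere_growth\<close>), and two such walks combine to a path of length at most \<open>2 * e\<close>
  (\<open>sphere_pair_in_copy\<close>).
\<close>

section \<open>Binomial coefficients near the middle and in the tails\<close>

definition central :: "nat \<Rightarrow> real" where
  "central n = real (n choose (n div 2))"

lemma central_pos: "central n > 0"
  by (simp add: central_def)

text \<open>
  One step away from the middle multiplies a binomial coefficient by $(j+1)/(n-j)$, and this
  factor tends to 1 as long as the distance from the middle stays bounded.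
\<close>

lemma near_central_lower:
  assumes "d \<le> k" "n \<ge> 2 * k + 4"
  shows "real (n choose (n div 2 - d)) \<ge> ((real n / 2 - real k - 1) / (real n / 2 + real k + 2)) ^ d * central n"
  using assms(1)
proof (induction d)
  case 0
  show ?case by (simp add: central_def)
next
  case (Suc d)
  define \<rho> where "\<rho> = (real n / 2 - real k - 1) / (real n / 2 + real k + 2)"
  define j where "j = n div 2 - Suc d"
  have j: "n div 2 - d = Suc j" "Suc j \<le> n" using Suc.prems assms(2) by (auto simp: j_def)
  have nn: "real n / 2 - 1 \<le> real (n div 2)" "real (n div 2) \<le> real n / 2" by linarith+
  have "real (Suc j) \<ge> real n / 2 - real k - 1" "real (n - j) \<le> real n / 2 + real k + 2"
    using j Suc.prems assms(2) nn by (auto simp: j_def of_nat_diff)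
  moreover have "real n / 2 - real k - 1 \<ge> 0" using assms(2) by simp
  ultimately have r: "\<rho> \<le> real (Suc j) / real (n - j)"
    unfolding \<rho>_def using j(2) by (intro frac_le) auto
  have "real (Suc j) * real (n choose Suc j) = real (n - j) * real (n choose j)"
    using binomial_absorb_comp[of n j] Suc_times_binomial_add[of j "n - Suc j"] j(2)
    by (metis binomial_absorption binomial_absorb_comp of_nat_mult)
  hence "real (n choose j) = real (Suc j) / real (n - j) * real (n choose Suc j)"
    using j(2) by (simp add: field_simps)
  hence 1: "real (n choose j) \<ge> \<rho> * real (n choose Suc j)"
    using mult_right_mono[OF r, of "real (n choose Suc j)"] by simp
  have "\<rho> \<ge> 0" unfolding \<rho>_def using assms(2) by (intro divide_nonneg_nonneg) auto
  hence "\<rho> * real (n choose Suc j) \<ge> \<rho> * (\<rho> ^ d * central n)"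
    using Suc j by (intro mult_left_mono) (auto simp: \<rho>_def)
  thus ?case using 1 by (simp add: \<rho>_def j_def mult.assoc)
qed

text \<open>
  By symmetry the bound below the middle also holds above it. Hence boundedly many layers around
  the middle are asymptotically equally large.
\<close>

lemma near_central:
  assumes "\<bar>int j - int (n div 2)\<bar> \<le> int k" "n \<ge> 2 * k + 4"
  shows "real (n choose j) \<ge> ((real n / 2 - real k - 1) / (real n / 2 + real k + 2)) ^ k * central n"
proof -
  define \<rho> where "\<rho> = (real n / 2 - real k - 1) / (real n / 2 + real k + 2)"
  have \<rho>: "0 \<le> \<rho>" "\<rho> \<le> 1" unfolding \<rho>_def using assms(2) by (auto intro!: divide_nonneg_nonneg simp: divide_le_eq_1)
  have "\<exists>d\<le>k. n choose j = n choose (n div 2 - d)"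
  proof (cases "j \<le> n div 2")
    case True
    hence "n div 2 - (n div 2 - j) = j" "n div 2 - j \<le> k" using assms by auto
    thus ?thesis by metis
  next
    case False
    hence jn: "j \<le> n" using assms by linarith
    have "n - j \<le> n div 2" "n div 2 - (n - j) \<le> k" using False assms by auto
    hence "n div 2 - (n div 2 - (n - j)) = n - j" by simp
    moreover have "n choose j = n choose (n - j)" using jn by (rule binomial_symmetric)
    ultimately show ?thesis using \<open>n div 2 - (n - j) \<le> k\<close> by metis
  qed
  then obtain d where d: "d \<le> k" "n choose j = n choose (n div 2 - d)" by blast
  have "\<rho> ^ k * central n \<le> \<rho> ^ d * central n"
    using \<rho> d(1) central_pos[of n] by (intro mult_right_mono power_decreasing) auto
  also have "\<dots> \<le> real (n choose (n div 2 - d))"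
    using near_central_lower[OF d(1) assms(2)] by (simp add: \<rho>_def)
  finally show ?thesis using d(2) by (simp add: \<rho>_def)
qed

lemma middle_layers_subset: "middle_layers n k \<subseteq> Pow {1..n}"
  by (auto simp: middle_layers_def)

lemma card_middle_layers:
  fixes \<epsilon> :: real
  assumes "\<epsilon> > 0"
  shows "\<forall>\<^sub>F n in sequentially. real (card (middle_layers n k)) \<ge> (real k - \<epsilon>) * central n"
proof -
  define \<rho> where "\<rho> n = ((real n / 2 - real k - 1) / (real n / 2 + real k + 2)) ^ k" for n :: nat
  have "(\<lambda>n. (real n / 2 - real k - 1) / (real n / 2 + real k + 2)) \<longlonglongrightarrow> 1"
    by real_asymp
  hence "(\<lambda>n. real k * \<rho> n) \<longlonglongrightarrow> real k * 1 ^ k"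
    unfolding \<rho>_def by (intro tendsto_intros)
  hence "\<forall>\<^sub>F n in sequentially. real k * \<rho> n > real k - \<epsilon>"
    using assms by (intro order_tendstoD(1)[of _ "real k * 1 ^ k"]) auto
  moreover have "\<forall>\<^sub>F n in sequentially. n \<ge> 2 * k + 4" by (rule eventually_ge_at_top)
  ultimately show ?thesis
  proof eventually_elim
    case (elim n)
    define b where "b = (n - k) div 2"
    have b: "(int n - int k) div 2 = int b" using elim by (simp add: b_def of_nat_diff zdiv_int)
    have layers: "middle_layers n k = (\<Union>i\<in>{1..k}. {A. A \<subseteq> {1..n} \<and> card A = b + i})"
      unfolding middle_layers_def b by (auto simp flip: of_nat_add)
    have "card (middle_layers n k) = (\<Sum>i\<in>{1..k}. card {A. A \<subseteq> {1..n} \<and> card A = b + i})"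
      unfolding layers by (intro card_UN_disjoint) (auto intro: finite_subset[of _ "Pow {1..n}"])
    also have "\<dots> = (\<Sum>i\<in>{1..k}. n choose (b + i))" by (simp add: n_subsets)
    finally have "real (card (middle_layers n k)) = (\<Sum>i\<in>{1..k}. real (n choose (b + i)))" by simp
    also have "\<dots> \<ge> (\<Sum>i\<in>{1..k}. \<rho> n * central n)"
      unfolding \<rho>_def using elim by (intro sum_mono near_central) (auto simp: b_def)
    finally have "real (card (middle_layers n k)) \<ge> real k * \<rho> n * central n" by simp
    moreover have "real k * \<rho> n * central n \<ge> (real k - \<epsilon>) * central n"
      using elim central_pos[of n] by (intro mult_right_mono) auto
    ultimately show ?case by linarith
  qed
qed

lemma central_small:
  shows "\<forall>\<^sub>F n in sequentially. K * central n \<le> 2 ^ n"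
proof -
  define k where "k = nat \<lceil>K\<rceil> + 1"
  have "K \<le> real k - 1" unfolding k_def by linarith
  have "\<forall>\<^sub>F n in sequentially. real (card (middle_layers n k)) \<ge> (real k - 1) * central n"
    by (rule card_middle_layers) simp
  thus ?thesis
  proof eventually_elim
    case (elim n)
    have "card (middle_layers n k) \<le> card (Pow {1..n})" by (intro card_mono middle_layers_subset) auto
    hence "real (card (middle_layers n k)) \<le> 2 ^ n" by (simp add: card_Pow)
    moreover have "K * central n \<le> (real k - 1) * central n"
      using \<open>K \<le> real k - 1\<close> central_pos[of n] by (intro mult_right_mono) auto
    ultimately show ?case using elim by linarith
  qed
qed

lemma central_lower: "central n * (real n + 1) \<ge> 2 ^ n"
proof -
  have "(2::nat) ^ n = (\<Sum>i\<le>n. n choose i)" by (simp add: choose_row_sum)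
  also have "\<dots> \<le> (\<Sum>i\<le>n. n choose (n div 2))" by (intro sum_mono binomial_maximum)
  finally have "(2::nat) ^ n \<le> (n + 1) * (n choose (n div 2))" by simp
  hence "real (2 ^ n) \<le> real ((n + 1) * (n choose (n div 2)))" by (rule of_nat_mono)
  thus ?thesis by (simp add: central_def algebra_simps)
qed

text \<open>
  Away from both ends of the cube every set has linearly many elements inside and outside, so a
  random full chain through it has at least linearly many ways to go up and down.
\<close>

definition balanced :: "nat \<Rightarrow> nat set set" where
  "balanced n = {A. A \<subseteq> {1..n} \<and> n \<le> 4 * card A \<and> n \<le> 4 * (n - card A)}"

text \<open>
  Compare one term of the binomial expansion of $(1+3)^n$ with the whole sum.
\<close>

lemma binomial_le_below_quarter:
  assumes "4 * i \<le> n"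
  shows "real (n choose i) \<le> 4 ^ n / 3 powr (3 * real n / 4)"
proof -
  have "real (n choose i) * 3 ^ (n - i) \<le> (\<Sum>j\<le>n. real (n choose j) * 1 ^ j * 3 ^ (n - j))"
    using assms member_le_sum[of i "{..n}" "\<lambda>j. real (n choose j) * 1 ^ j * 3 ^ (n - j)"] by simp
  also have "\<dots> = (1 + 3) ^ n" by (rule binomial_ring[symmetric])
  finally have 1: "real (n choose i) * 3 ^ (n - i) \<le> 4 ^ n" by simp
  have "3 powr (3 * real n / 4) \<le> 3 powr real (n - i)"
    using assms by (intro powr_mono) (auto simp: of_nat_diff)
  hence "3 powr (3 * real n / 4) \<le> 3 ^ (n - i)" by (simp add: powr_realpow)
  hence "real (n choose i) * 3 powr (3 * real n / 4) \<le> real (n choose i) * 3 ^ (n - i)"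
    by (intro mult_left_mono) auto
  with 1 have "real (n choose i) * 3 powr (3 * real n / 4) \<le> 4 ^ n" by linarith
  thus ?thesis by (simp add: field_simps)
qed

text \<open>
  The tails have size about $4^n / 3^{3n/4} = 2^n (16/27)^{n/4}$, which is exponentially smaller
  than the middle layer.
\<close>

lemma unbalanced_small:
  fixes \<epsilon> :: real
  assumes "\<epsilon> > 0"
  shows "\<forall>\<^sub>F n in sequentially. real (card (Pow {1..n} - balanced n)) \<le> \<epsilon> * central n"
proof -
  have "(\<lambda>n. (real n + 1)\<^sup>2 * (16 / 27) powr (real n / 4)) \<longlonglongrightarrow> 0" by real_asymp
  hence "\<forall>\<^sub>F n in sequentially. (real n + 1)\<^sup>2 * (16 / 27) powr (real n / 4) < \<epsilon>"
    using assms by (rule order_tendstoD(2))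
  thus ?thesis
  proof eventually_elim
    case (elim n)
    have "Pow {1..n} - balanced n \<subseteq> (\<Union>i\<in>{i. i \<le> n \<and> (4 * i < n \<or> 4 * (n - i) < n)}. {A. A \<subseteq> {1..n} \<and> card A = i})"
      using card_mono[of "{1..n}"] by (fastforce simp: balanced_def)
    hence "card (Pow {1..n} - balanced n) \<le> card (\<Union>i\<in>{i. i \<le> n \<and> (4 * i < n \<or> 4 * (n - i) < n)}. {A. A \<subseteq> {1..n} \<and> card A = i})"
      by (intro card_mono finite_UN_I) (auto intro: finite_subset[of _ "Pow {1..n}"])
    also have "\<dots> \<le> (\<Sum>i\<in>{i. i \<le> n \<and> (4 * i < n \<or> 4 * (n - i) < n)}. card {A. A \<subseteq> {1..n} \<and> card A = i})"
      by (intro card_UN_le) simp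
    also have "\<dots> = (\<Sum>i\<in>{i. i \<le> n \<and> (4 * i < n \<or> 4 * (n - i) < n)}. n choose i)" by (simp add: n_subsets)
    finally have "real (card (Pow {1..n} - balanced n)) \<le> real (\<Sum>i\<in>{i. i \<le> n \<and> (4 * i < n \<or> 4 * (n - i) < n)}. n choose i)"
      by (rule of_nat_mono)
    also have "\<dots> = (\<Sum>i\<in>{i. i \<le> n \<and> (4 * i < n \<or> 4 * (n - i) < n)}. real (n choose i))" by simp
    also have "\<dots> \<le> (\<Sum>i\<in>{i. i \<le> n \<and> (4 * i < n \<or> 4 * (n - i) < n)}. 4 ^ n / 3 powr (3 * real n / 4))"
    proof (intro sum_mono)
      fix i assume i: "i \<in> {i. i \<le> n \<and> (4 * i < n \<or> 4 * (n - i) < n)}"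
      show "real (n choose i) \<le> 4 ^ n / 3 powr (3 * real n / 4)"
      proof (cases "4 * i < n")
        case False
        hence "real (n choose (n - i)) \<le> 4 ^ n / 3 powr (3 * real n / 4)" using i by (intro binomial_le_below_quarter) auto
        thus ?thesis using i binomial_symmetric[of i n] by simp
      qed (auto intro: binomial_le_below_quarter)
    qed
    also have "\<dots> \<le> (\<Sum>i\<in>{..n}. 4 ^ n / 3 powr (3 * real n / 4))"
      by (intro sum_mono2) auto
    also have "\<dots> = (real n + 1) * (2 ^ n * (16 / 27) powr (real n / 4))"
    proof -
      have e: "4 powr real n = 2 powr real n * 16 powr (real n / 4)"
      proof -
        have "16 powr (real n / 4) = (2 powr 4) powr (real n / 4)" by simp
        also have "\<dots> = 2 powr real n" by (simp only: powr_powr) simp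
        finally show ?thesis by (simp flip: powr_mult)
      qed
      have t: "3 powr (3 * real n / 4) = 27 powr (real n / 4)"
      proof -
        have "27 powr (real n / 4) = (3 powr 3) powr (real n / 4)" by simp
        thus ?thesis by (simp only: powr_powr) simp
      qed
      have "4 ^ n / 3 powr (3 * real n / 4) = 2 ^ n * (16 / 27) powr (real n / 4)"
        using e by (simp add: t powr_realpow powr_divide)
      thus ?thesis by simp
    qed
    also have "\<dots> \<le> (real n + 1) * ((central n * (real n + 1)) * (16 / 27) powr (real n / 4))"
      by (intro mult_left_mono mult_right_mono central_lower) auto
    also have "\<dots> = ((real n + 1)\<^sup>2 * (16 / 27) powr (real n / 4)) * central n"
      by (simp add: power2_eq_square)
    also have "\<dots> \<le> \<epsilon> * central n"
      using elim central_pos[of n] by (intro mult_right_mono) auto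
    finally show ?case .
  qed
qed

section \<open>A coloring that separates sets at small distance\<close>

text \<open>
  In an algebraic closure of the field with two elements, the fixed points of the \<open>r\<close>-fold
  Frobenius map form the field with \<open>2 ^ r\<close> elements. The characteristic is two because there is
  always a power of two between \<open>n\<close> and \<open>2 * n\<close>, so that the field is not much larger than the
  ground set.
\<close>

definition frob_field :: "nat \<Rightarrow> bit alg_closure set" where
  "frob_field r = {x. x ^ 2 ^ r = x}"

lemma bit_alg_closure_add_self [simp]: "(x :: bit alg_closure) + x = 0"
proof -
  have "x + x = to_ac (1 + 1) * x"
    unfolding to_ac_add by (simp add: algebra_simps)
  also have "1 + 1 = (0 :: bit)" by simp
  finally show ?thesis by simp
qed

lemma bit_alg_closure_two [simp]: "(2 :: bit alg_closure) = 0"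
  using bit_alg_closure_add_self[of 1] by (simp only: one_add_one)

lemma frob_add: "((x :: bit alg_closure) + y) ^ 2 ^ r = x ^ 2 ^ r + y ^ 2 ^ r"
proof (induction r)
  case (Suc r)
  have sq: "(a + b)\<^sup>2 = a\<^sup>2 + b\<^sup>2" for a b :: "bit alg_closure"
    by (simp add: power2_sum)
  have e: "a ^ 2 ^ Suc r = (a ^ 2 ^ r)\<^sup>2" for a :: "bit alg_closure"
    by (metis mult.commute power_Suc power_mult)
  show ?case unfolding e Suc sq ..
qed simp

lemma frob_field_add: "x \<in> frob_field r \<Longrightarrow> y \<in> frob_field r \<Longrightarrow> x + y \<in> frob_field r"
  by (simp add: frob_field_def frob_add)

lemma frob_field_mult: "x \<in> frob_field r \<Longrightarrow> y \<in> frob_field r \<Longrightarrow> x * y \<in> frob_field r"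
  by (simp add: frob_field_def power_mult_distrib)

lemma frob_field_0: "0 \<in> frob_field r" and frob_field_1: "1 \<in> frob_field r"
  by (simp_all add: frob_field_def)

text \<open>
  The polynomial $x^q - x$ splits, and its derivative is the constant $-1$, so it has no multiple
  root.
\<close>

lemma card_frob_field:
  assumes "r > 0"
  shows "finite (frob_field r) \<and> card (frob_field r) = 2 ^ r"
proof -
  define q :: nat where "q = 2 ^ r"
  have q: "q \<ge> 2" using assms unfolding q_def by (cases r) auto
  define p :: "bit alg_closure poly" where "p = monom 1 q - monom 1 1"
  have p_eq: "poly p x = x ^ q - x" for x by (simp add: p_def poly_monom)
  have deg: "degree p = q"
  proof -
    have "degree p \<le> q"
      unfolding p_def using q by (intro degree_diff_le) (simp_all add: degree_monom_eq)
    moreover have "coeff p q = 1" using q by (simp add: p_def)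
    ultimately show ?thesis by (intro antisym le_degree) simp_all
  qed
  have "p \<noteq> 0" using deg q by auto
  have two: "(of_nat q :: bit alg_closure) = 0"
    using assms by (cases r) (simp_all add: q_def)
  have pd: "pderiv p = - 1"
    unfolding p_def pderiv_diff pderiv_monom two by simp
  obtain c A where A: "size A = degree p" "p = smult c (\<Prod>x\<in>#A. [:-x, 1:])" and "c \<noteq> 0"
    using alg_closed_imp_factorization[OF \<open>p \<noteq> 0\<close>] \<open>p \<noteq> 0\<close> by (metis leading_coeff_0_iff)
  have le1: "count A x \<le> 1" for x
  proof (rule ccontr)
    assume "\<not> count A x \<le> 1"
    hence "replicate_mset 2 x \<subseteq># A"
      by (simp flip: count_le_replicate_mset_subset_eq)
    then obtain B where "A = replicate_mset 2 x + B"
      by (auto simp: subset_mset.le_iff_add)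
    hence "p = [:-x, 1:] * ([:-x, 1:] * smult c (\<Prod>x\<in>#B. [:-x, 1:]))"
      unfolding A(2) by (simp add: numeral_2_eq_2 mult.assoc)
    hence "poly (pderiv p) x = poly (pderiv ([:-x, 1:] * ([:-x, 1:] * smult c (\<Prod>x\<in>#B. [:-x, 1:])))) x"
      by (rule arg_cong)
    also have "\<dots> = 0"
      by (simp only: pderiv_mult poly_add poly_mult) simp
    finally show False by (simp add: pd)
  qed
  have cnt: "A = mset_set (set_mset A)"
  proof (intro multiset_eqI)
    fix x show "count A x = count (mset_set (set_mset A)) x"
      using le1[of x] by (cases "x \<in># A") (auto simp: not_in_iff intro!: antisym)
  qed
  have set: "set_mset A = frob_field r"
  proof -
    have "poly p x = 0 \<longleftrightarrow> x \<in># A" for x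
      unfolding A(2) using \<open>c \<noteq> 0\<close> by (auto simp: poly_prod_mset prod_mset_zero_iff)
    thus ?thesis by (auto simp: frob_field_def p_eq q_def)
  qed
  have "card (set_mset A) = size A" using cnt by (metis size_mset_set)
  thus ?thesis using set A(1) deg by (metis finite_set_mset q_def)
qed

text \<open>
  Polynomials with constant coefficient 1 are units modulo every power of the variable.
\<close>

lemma coeff_mult_unit_const_eq_0:
  fixes p q :: "'a :: comm_ring_1 poly"
  assumes "coeff p 0 = 1" and "\<And>i. i \<le> e \<Longrightarrow> coeff (p * q) i = 0" and "i \<le> e"
  shows "coeff q i = 0"
  using assms(3)
proof (induction i rule: less_induct)
  case (less i)
  have "0 = (\<Sum>j\<le>i. coeff p j * coeff q (i - j))"
    using assms(2)[OF less.prems] by (simp add: coeff_mult)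
  also have "\<dots> = coeff p 0 * coeff q (i - 0)"
  proof (subst sum.remove[of _ 0])
    have "(\<Sum>j\<in>{..i} - {0}. coeff p j * coeff q (i - j)) = 0"
      using less by (intro sum.neutral ballI) simp
    thus "coeff p 0 * coeff q (i - 0) + (\<Sum>j\<in>{..i} - {0}. coeff p j * coeff q (i - j)) =
            coeff p 0 * coeff q (i - 0)" by simp
  qed auto
  finally show ?case using assms(1) by simp
qed

text \<open>
  Identify the points with nonzero elements \<open>g a\<close> of the field and color \<open>A\<close> by the coefficients
  $1,\dots,e$ of $\prod_{a \in A} (1 + g(a) x)$. If two sets have the same color, then after
  cancelling the factor of \<open>A \<inter> B\<close> the products over \<open>A - B\<close> and \<open>B - A\<close> agree modulo $x^{e+1}$. Both have
  degree at most \<open>e\<close>, so they are equal, and a root of the first, given by an element of \<open>A - B\<close>, must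
  come from an element of \<open>B - A\<close>: impossible, since \<open>g\<close> is injective.
\<close>

lemma distance_coloring:
  assumes "n \<ge> (1 :: nat)"
  shows "\<exists>col :: nat set \<Rightarrow> nat. (\<forall>A\<subseteq>{1..n}. col A < (2 * n) ^ e) \<and>
           (\<forall>A\<subseteq>{1..n}. \<forall>B\<subseteq>{1..n}. A \<noteq> B \<longrightarrow> card A = card B \<longrightarrow> card (A - B) \<le> e \<longrightarrow> col A \<noteq> col B)"
proof -
  obtain r0 where r0: "2 ^ r0 \<le> n" "n < 2 ^ (r0 + 1)"
    using ex_power_ivl1[of 2 n] assms by auto
  define r where "r = r0 + 1"
  define S where "S = frob_field r"
  have S: "finite S" "card S = 2 ^ r" using card_frob_field[of r] by (auto simp: S_def r_def)
  have "0 \<in> S" by (simp add: S_def frob_field_0)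
  hence "card (S - {0}) = 2 ^ r - 1" using S by simp
  hence "card {1..n} \<le> card (S - {0})" using r0 by (simp add: r_def)
  then obtain g where g: "g ` {1..n} \<subseteq> S - {0}" "inj_on g {1..n}"
    using card_le_inj[of "{1..n}" "S - {0}"] S by auto
  define P where "P A = (\<Prod>a\<in>A. [:1, g a:])" for A :: "nat set"
  have P0: "coeff (P A) 0 = 1" for A
    by (simp add: P_def coeff_0_prod_list poly_prod flip: poly_0_coeff_0)
  have Pdeg: "degree (P A) \<le> card A" if "finite A" for A
  proof -
    have "degree (P A) \<le> sum (degree o (\<lambda>a. [:1, g a:])) A"
      unfolding P_def using that by (rule degree_prod_sum_le)
    also have "\<dots> \<le> sum (\<lambda>_. 1) A" by (intro sum_mono) simp
    finally show ?thesis by simp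
  qed
  have Pc: "coeff (P A) i \<in> S" if "A \<subseteq> {1..n}" for A i
  proof -
    have "finite A" using that finite_subset by blast
    thus ?thesis using that
    proof (induction A arbitrary: i)
      case empty
      show ?case by (cases i) (auto simp: P_def S_def frob_field_0 frob_field_1)
    next
      case (insert a A)
      have "P (insert a A) = P A + pCons 0 (smult (g a) (P A))"
        using insert.hyps by (simp add: P_def)
      moreover have "g a \<in> S" using g(1) insert.prems by blast
      ultimately show ?case using insert
        by (cases i) (auto simp: coeff_pCons S_def intro!: frob_field_add frob_field_mult)
    qed
  qed
  define L where "L = {xs. set xs \<subseteq> S \<and> length xs = e}"
  have cardL: "finite L" "card L = (2 ^ r) ^ e"
    using S by (auto simp: L_def card_lists_length_eq finite_lists_length_eq)
  obtain h where h: "bij_betw h L {0..<card L}"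
    using ex_bij_betw_finite_nat[OF cardL(1)] by blast
  define v where "v A = map (\<lambda>i. coeff (P A) (Suc i)) [0..<e]" for A
  have vL: "v A \<in> L" if "A \<subseteq> {1..n}" for A
    using Pc[OF that] by (auto simp: v_def L_def)
  have "card L \<le> (2 * n) ^ e"
    unfolding cardL(2) using r0 by (intro power_mono) (simp_all add: r_def)
  moreover have "h (v A) \<in> {0..<card L}" if "A \<subseteq> {1..n}" for A
    using h vL[OF that] by (rule bij_betwE[THEN bspec])
  ultimately have 1: "h (v A) < (2 * n) ^ e" if "A \<subseteq> {1..n}" for A
    using that by (meson atLeastLessThan_iff order_less_le_trans)
  have 2: "v A \<noteq> v B"
    if AB: "A \<subseteq> {1..n}" "B \<subseteq> {1..n}" "A \<noteq> B" "card A = card B" "card (A - B) \<le> e" for A B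
  proof
    assume eq: "v A = v B"
    have fin: "finite A" "finite B" using AB finite_subset by blast+
    have ceq: "coeff (P A) i = coeff (P B) i" if "i \<le> e" for i
    proof (cases i)
      case (Suc j)
      hence "v A ! j = v B ! j" "j < e" using eq that by auto
      thus ?thesis using Suc by (simp add: v_def)
    qed (simp add: P0)
    have split: "P A = P (A \<inter> B) * P (A - B)" if "finite A" for A B
      unfolding P_def using prod.union_disjoint[of "A \<inter> B" "A - B" "\<lambda>a. [:1, g a:]"] that
      by (simp add: Int_Diff_Un Int_Diff_disjoint)
    have "card (A - B) = card (B - A)"
      using AB(4) fin by (metis card_Diff_subset_Int Int_commute finite_Int)
    hence cB: "card (B - A) \<le> e" and ne: "A - B \<noteq> {}"
      using AB fin by (auto simp: card_eq_0_iff) (metis Diff_eq_empty_iff card.empty card_0_eq finite_Diff subset_antisym)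
    have "P (A \<inter> B) * (P (A - B) - P (B - A)) = P A - P B"
      using split[OF fin(1), of B] split[OF fin(2), of A] by (simp add: algebra_simps Int_commute)
    hence "coeff (P (A \<inter> B) * (P (A - B) - P (B - A))) i = 0" if "i \<le> e" for i
      using ceq[OF that] by simp
    hence "coeff (P (A - B) - P (B - A)) i = 0" if "i \<le> e" for i
      using coeff_mult_unit_const_eq_0[OF P0] that by blast
    moreover have "coeff (P (A - B) - P (B - A)) i = 0" if "i > e" for i
      using that Pdeg[of "A - B"] Pdeg[of "B - A"] cB AB(5) fin by (simp add: coeff_eq_0)
    ultimately have "P (A - B) - P (B - A) = 0"
      by (intro poly_eqI) (metis coeff_0 linorder_not_le)
    hence Peq: "P (A - B) = P (B - A)" by simp
    obtain a where a: "a \<in> A - B" using ne by blast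
    have ga: "g a \<noteq> 0" using a AB(1) g(1) by blast
    have "poly (P (A - B)) (- 1 / g a) = 0"
      unfolding P_def poly_prod using a fin ga by (auto intro!: bexI[of _ a])
    hence "poly (P (B - A)) (- 1 / g a) = 0" by (simp add: Peq)
    then obtain b where b: "b \<in> B - A" "1 - g b / g a = 0"
      unfolding P_def poly_prod using fin by auto
    hence "g a = g b" using ga by simp
    thus False using a b(1) AB g(2) by (auto dest: inj_onD)
  qed
  have "h (v A) \<noteq> h (v B)"
    if "A \<subseteq> {1..n}" "B \<subseteq> {1..n}" "A \<noteq> B" "card A = card B" "card (A - B) \<le> e" for A B
    using 2[OF that] vL that(1,2) h by (metis bij_betw_imp_inj_on inj_onD)
  with 1 show ?thesis by (intro exI[of _ "h \<circ> v"]) auto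
qed

section \<open>Full chains and permutations\<close>

text \<open>
  A permutation of the ground set, written as a list, determines the full chain of its prefix
  sets. Random full chains are studied by counting permutations.
\<close>

definition prefixes :: "'a list \<Rightarrow> 'a set list" where
  "prefixes xs = map (\<lambda>i. set (take i xs)) [0..<Suc (length xs)]"

lemma set_prefixes: "set (prefixes xs) = (\<lambda>i. set (take i xs)) ` {..length xs}"
  by (simp add: prefixes_def atLeast0LessThan lessThan_Suc_atMost del: upt_Suc)

lemma sorted_prefixes:
  assumes "distinct xs"
  shows "sorted_wrt (\<subset>) (prefixes xs)"
proof -
  have "set (take i xs) \<subset> set (take j xs)" if "i < j" "j \<le> length xs" for i j
  proof
    show "set (take i xs) \<subseteq> set (take j xs)" using that by (simp add: set_take_subset_set_take)
    have "card (set (take i xs)) \<noteq> card (set (take j xs))"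
      using that assms by (simp add: distinct_card)
    thus "set (take i xs) \<noteq> set (take j xs)" by metis
  qed
  thus ?thesis
    by (auto simp: sorted_wrt_iff_nth_less prefixes_def simp del: upt_Suc)
qed

lemma in_prefixes_iff:
  assumes "distinct xs" "finite A"
  shows "A \<in> set (prefixes xs) \<longleftrightarrow> A = set (take (card A) xs)"
proof
  assume "A \<in> set (prefixes xs)"
  then obtain i where "i \<le> length xs" "A = set (take i xs)" by (auto simp: set_prefixes)
  moreover from this have "card A = i" using assms by (simp add: distinct_card)
  ultimately show "A = set (take (card A) xs)" by simp
next
  assume *: "A = set (take (card A) xs)"
  hence "card A \<le> length xs"
    by (metis card_length length_take min.cobounded1 min.bounded_iff)
  with * show "A \<in> set (prefixes xs)" unfolding set_prefixes by blast
qed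

text \<open>
  A permutation whose chain passes through \<open>A \<subseteq> B\<close> orders first \<open>A\<close>, then \<open>B - A\<close>, then the rest.
\<close>

lemma card_perms_through_pair:
  assumes "finite N" "A \<subseteq> B" "B \<subseteq> N"
  shows "card {xs \<in> permutations_of_set N. A \<in> set (prefixes xs) \<and> B \<in> set (prefixes xs)} =
           fact (card A) * fact (card B - card A) * fact (card N - card B)"
proof -
  have fin: "finite B" "finite A"
    using assms by (metis finite_subset, metis finite_subset)
  have cards: "card A \<le> card B" "card B \<le> card N" using assms fin by (auto intro: card_mono)
  let ?S = "permutations_of_set A \<times> permutations_of_set (B - A) \<times> permutations_of_set (N - B)"
  let ?h = "\<lambda>(a, b, c). a @ b @ c"
  have "bij_betw ?h ?S {xs \<in> permutations_of_set N. A \<in> set (prefixes xs) \<and> B \<in> set (prefixes xs)}"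
  proof (rule bij_betwI[where g = "\<lambda>xs. (take (card A) xs, take (card B - card A) (drop (card A) xs), drop (card B) xs)"])
    show "?h \<in> ?S \<rightarrow> {xs \<in> permutations_of_set N. A \<in> set (prefixes xs) \<and> B \<in> set (prefixes xs)}"
    proof
      fix t assume t: "t \<in> ?S"
      obtain a b c where abc: "t = (a, b, c)" by (cases t)
      have a: "set a = A" "distinct a" "length a = card A"
        and b: "set b = B - A" "distinct b" "length b = card B - card A"
        and c: "set c = N - B" "distinct c"
        using t fin assms unfolding abc
        by (auto dest: permutations_of_setD length_finite_permutations_of_set simp: card_Diff_subset)
      have d: "distinct (a @ b @ c)" using a b c assms by auto
      have "a @ b @ c \<in> permutations_of_set N"
        using a b c assms d by (intro permutations_of_setI) auto
      moreover have "A = set (take (card A) (a @ b @ c))" "B = set (take (card B) (a @ b @ c))"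
        using a b cards assms by auto
      ultimately show "?h t \<in> {xs \<in> permutations_of_set N. A \<in> set (prefixes xs) \<and> B \<in> set (prefixes xs)}"
        using d fin by (simp add: abc in_prefixes_iff)
    qed
  next
    show "(\<lambda>xs. (take (card A) xs, take (card B - card A) (drop (card A) xs), drop (card B) xs)) \<in>
      {xs \<in> permutations_of_set N. A \<in> set (prefixes xs) \<and> B \<in> set (prefixes xs)} \<rightarrow> ?S"
    proof
      fix xs assume xs: "xs \<in> {xs \<in> permutations_of_set N. A \<in> set (prefixes xs) \<and> B \<in> set (prefixes xs)}"
      hence d: "distinct xs" "set xs = N" by (auto dest: permutations_of_setD)
      have AB: "A = set (take (card A) xs)" "B = set (take (card B) xs)"
        using xs in_prefixes_iff[OF d(1)] fin by auto
      have tk: "take (card B) xs = take (card A) xs @ take (card B - card A) (drop (card A) xs)"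
        using cards by (metis le_add_diff_inverse take_add)
      have dt: "distinct (take (card B) xs)" using d by simp
      have "set (take (card B - card A) (drop (card A) xs)) = B - A"
        using AB dt unfolding tk by auto
      moreover have "set (drop (card B) xs) = N - B"
      proof -
        have "set (take (card B) xs) \<union> set (drop (card B) xs) = N"
          using d(2) by (metis append_take_drop_id set_append)
        moreover have "set (take (card B) xs) \<inter> set (drop (card B) xs) = {}"
          using d(1) by (simp add: set_take_disj_set_drop_if_distinct)
        ultimately show ?thesis using AB(2) by blast
      qed
      ultimately show "(take (card A) xs, take (card B - card A) (drop (card A) xs), drop (card B) xs) \<in> ?S"
        using AB(1)[symmetric] d by (simp add: permutations_of_setI)
    qed
  next
    fix t assume "t \<in> ?S"
    thus "(\<lambda>xs. (take (card A) xs, take (card B - card A) (drop (card A) xs), drop (card B) xs)) (?h t) = t"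
      using fin assms cards
      by (auto dest!: length_finite_permutations_of_set simp: card_Diff_subset)
  next
    fix xs
    show "?h ((\<lambda>xs. (take (card A) xs, take (card B - card A) (drop (card A) xs), drop (card B) xs)) xs) = xs"
      using cards by simp (metis append.assoc append_take_drop_id le_add_diff_inverse take_add)
  qed
  hence "card {xs \<in> permutations_of_set N. A \<in> set (prefixes xs) \<and> B \<in> set (prefixes xs)} = card ?S"
    by (simp add: bij_betw_same_card)
  also have "\<dots> = fact (card A) * fact (card B - card A) * fact (card N - card B)"
    using fin assms by (simp add: card_cartesian_product card_Diff_subset mult.assoc)
  finally show ?thesis .
qed

lemma real_binomial_fact: "k \<le> n \<Longrightarrow> fact n = fact k * fact (n - k) * real (n choose k)"
  using arg_cong[OF binomial_fact_lemma[of k n], of real] by simp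

text \<open>
  The probability to pass through both sets, as the probability to pass through the lower one
  times the conditional probability to continue through the upper one.
\<close>

lemma fact_product_up:
  assumes "a \<le> b" "b \<le> n"
  shows "real (fact a * fact (b - a) * fact (n - b)) = fact n * (1 / real (n choose a)) / real ((n - a) choose (b - a))"
proof -
  have "fact n = fact a * fact (n - a) * real (n choose a)"
    using assms by (intro real_binomial_fact) simp
  moreover have "fact (n - a) = fact (b - a) * fact (n - b) * real ((n - a) choose (b - a))"
    using assms real_binomial_fact[of "b - a" "n - a"] by simp
  moreover have "real (n choose a) > 0" "real ((n - a) choose (b - a)) > 0" using assms by simp_all
  ultimately show ?thesis by simp
qed

text \<open>
  The same probability, conditioned on the upper set.
\<close>

lemma fact_product_down:
  assumes "a \<le> b" "b \<le> n"
  shows "real (fact a * fact (b - a) * fact (n - b)) = fact n * (1 / real (n choose b)) / real (b choose a)"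
proof -
  have "fact n = fact b * fact (n - b) * real (n choose b)"
    using assms by (intro real_binomial_fact) simp
  moreover have "fact b = fact a * fact (b - a) * real (b choose a)"
    using assms by (intro real_binomial_fact) simp
  moreover have "real (n choose b) > 0" "real (b choose a) > 0" using assms by simp_all
  ultimately show ?thesis by simp
qed

definition trace :: "'a set set \<Rightarrow> 'a list \<Rightarrow> 'a set list" where
  "trace F xs = filter (\<lambda>A. A \<in> F) (prefixes xs)"

text \<open>
  Only runs of consecutive members are counted, and not all subchains: a run is determined by any
  one of its entries together with its position, so the runs with a given set in a given position
  never weigh more than the set itself.
\<close>

definition windows :: "nat \<Rightarrow> 'b list \<Rightarrow> 'b list set" where
  "windows k L = {take k (drop i L) | i. i + k \<le> length L}"

lemma card_windows:
  assumes "k \<ge> 1" "distinct L"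
  shows "finite (windows k L)" "card (windows k L) = Suc (length L) - k"
proof -
  have eq: "windows k L = (\<lambda>i. take k (drop i L)) ` {..<Suc (length L) - k}"
    by (auto simp: windows_def)
  show "finite (windows k L)" unfolding eq by simp
  have "inj_on (\<lambda>i. take k (drop i L)) {..<Suc (length L) - k}"
  proof (rule inj_onI)
    fix i j assume ij: "i \<in> {..<Suc (length L) - k}" "j \<in> {..<Suc (length L) - k}"
      and "take k (drop i L) = take k (drop j L)"
    hence "take k (drop i L) ! 0 = take k (drop j L) ! 0" by simp
    hence "L ! i = L ! j" using ij assms by simp
    thus "i = j" using ij assms by (simp add: nth_eq_iff_index_eq)
  qed
  thus "card (windows k L) = Suc (length L) - k" unfolding eq by (simp add: card_image)
qed

lemma windows_nth_unique:
  assumes "distinct L" "c \<in> windows k L" "c' \<in> windows k L" "i < k" "c ! i = c' ! i"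
  shows "c = c'"
proof -
  obtain a b where ab: "a + k \<le> length L" "b + k \<le> length L" "c = take k (drop a L)" "c' = take k (drop b L)"
    using assms by (auto simp: windows_def)
  hence "L ! (a + i) = L ! (b + i)" using assms by simp
  hence "a = b" using ab assms by (simp add: nth_eq_iff_index_eq)
  thus ?thesis using ab by simp
qed

lemma in_windowsD:
  assumes "c \<in> windows k (trace F xs)" "distinct xs"
  shows "length c = k" "set c \<subseteq> F" "sorted_wrt (\<subset>) c" "set c \<subseteq> set (prefixes xs)"
proof -
  obtain i where i: "i + k \<le> length (trace F xs)" "c = take k (drop i (trace F xs))"
    using assms by (auto simp: windows_def)
  show "length c = k" using i by simp
  have "set c \<subseteq> set (trace F xs)" using i by (meson in_set_dropD in_set_takeD subsetI)
  thus "set c \<subseteq> F" "set c \<subseteq> set (prefixes xs)" by (auto simp: trace_def)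
  show "sorted_wrt (\<subset>) c" unfolding i(2)
    using assms sorted_prefixes by (auto simp: trace_def intro!: sorted_wrt_take sorted_wrt_drop sorted_wrt_filter)
qed

lemma distinct_sorted_psubset: "sorted_wrt (\<subset>) (L :: 'a set list) \<Longrightarrow> distinct L"
  by (induction L) auto

lemma distinct_trace: "distinct xs \<Longrightarrow> distinct (trace F xs)"
  unfolding trace_def by (intro distinct_filter distinct_sorted_psubset sorted_prefixes)

section \<open>Weights, roles and pruning\<close>

text \<open>
  The expected number of members of \<open>F\<close> on a uniformly random full chain.
\<close>

definition lubell :: "nat \<Rightarrow> nat set set \<Rightarrow> real" where
  "lubell n F = (\<Sum>A\<in>F. 1 / real (n choose card A))"

text \<open>
  The probability that \<open>c\<close> is a run of consecutive members of \<open>F\<close> on a random full chain.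
\<close>

definition weight :: "nat \<Rightarrow> nat set set \<Rightarrow> nat set list \<Rightarrow> real" where
  "weight n F c = real (card {xs \<in> permutations_of_set {1..n}. c \<in> windows (length c) (trace F xs)}) / fact n"

lemma weight_nonneg: "weight n F c \<ge> 0"
  by (simp add: weight_def)

definition all_windows :: "nat \<Rightarrow> nat set set \<Rightarrow> nat \<Rightarrow> nat set list set" where
  "all_windows n F k = (\<Union>xs\<in>permutations_of_set {1..n}. windows k (trace F xs))"

lemma in_all_windowsD:
  assumes "c \<in> all_windows n F k"
  shows "length c = k" "set c \<subseteq> F" "sorted_wrt (\<subset>) c"
proof -
  obtain xs where xs: "xs \<in> permutations_of_set {1..n}" "c \<in> windows k (trace F xs)"
    using assms by (auto simp: all_windows_def)
  show "length c = k" "set c \<subseteq> F" "sorted_wrt (\<subset>) c"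
    using in_windowsD[OF xs(2) permutations_of_setD(2)[OF xs(1)]] by blast+
qed

lemma finite_all_windows: "k \<ge> 1 \<Longrightarrow> finite (all_windows n F k)"
  unfolding all_windows_def
  by (intro finite_UN_I finite_permutations_of_set card_windows(1) distinct_trace permutations_of_setD(2))

lemma weight_all_windows:
  assumes "c \<in> all_windows n F k"
  shows "weight n F c = real (card {xs \<in> permutations_of_set {1..n}. c \<in> windows k (trace F xs)}) / fact n"
  using in_all_windowsD(1)[OF assms] by (simp add: weight_def)

lemma sum_card_swap:
  assumes "finite Z" "finite Y"
  shows "(\<Sum>x\<in>Z. real (card {y \<in> Y. R x y})) = (\<Sum>y\<in>Y. real (card {x \<in> Z. R x y}))"
proof -
  have "(\<Sum>x\<in>Z. card {y \<in> Y. R x y}) = (\<Sum>y\<in>Y. card {x \<in> Z. R x y})"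
    using sum_multicount_gen[of Z Y R "\<lambda>y. card {x \<in> Z. R x y}"] assms by auto
  from arg_cong[OF this, of real] show ?thesis by simp
qed

text \<open>
  A chain that meets \<open>F\<close> in \<open>l\<close> sets contains at least \<open>l - (k - 1)\<close> runs of length \<open>k\<close>; take
  expectations.
\<close>

lemma sum_weight_all_windows:
  assumes "k \<ge> 1" "F \<subseteq> Pow {1..n}"
  shows "(\<Sum>c\<in>all_windows n F k. weight n F c) \<ge> lubell n F - (real k - 1)"
proof -
  let ?P = "permutations_of_set {1..n}"
  have cardP: "real (card ?P) = fact n" by simp
  have finF: "finite F" using assms(2) finite_subset by blast
  have d: "distinct xs" if "xs \<in> ?P" for xs using that by (rule permutations_of_setD)
  have "(\<Sum>c\<in>all_windows n F k. weight n F c) =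
        (\<Sum>c\<in>all_windows n F k. real (card {xs \<in> ?P. c \<in> windows k (trace F xs)})) / fact n"
    by (simp add: sum_divide_distrib weight_all_windows cong: sum.cong)
  also have "(\<Sum>c\<in>all_windows n F k. real (card {xs \<in> ?P. c \<in> windows k (trace F xs)})) =
        (\<Sum>xs\<in>?P. real (card {c \<in> all_windows n F k. c \<in> windows k (trace F xs)}))"
    by (intro sum_card_swap finite_all_windows assms finite_permutations_of_set)
  also have "\<dots> = (\<Sum>xs\<in>?P. real (card (windows k (trace F xs))))"
    by (intro sum.cong refl arg_cong[of _ _ real] arg_cong[of _ _ card]) (auto simp: all_windows_def)
  also have "\<dots> = (\<Sum>xs\<in>?P. real (Suc (length (trace F xs)) - k))"
    by (intro sum.cong refl) (simp only: card_windows(2)[OF assms(1) distinct_trace[OF d]])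
  finally have 1: "(\<Sum>c\<in>all_windows n F k. weight n F c) = (\<Sum>xs\<in>?P. real (Suc (length (trace F xs)) - k)) / fact n" .
  have len: "length (trace F xs) = card {A \<in> F. A \<in> set (prefixes xs)}" if "xs \<in> ?P" for xs
  proof -
    have "length (trace F xs) = card (set (trace F xs))"
      using distinct_trace[OF d[OF that]] by (simp add: distinct_card)
    also have "set (trace F xs) = {A \<in> F. A \<in> set (prefixes xs)}" by (auto simp: trace_def)
    finally show ?thesis .
  qed
  have "(\<Sum>xs\<in>?P. real (length (trace F xs))) = (\<Sum>xs\<in>?P. real (card {A \<in> F. A \<in> set (prefixes xs)}))"
    by (intro sum.cong refl) (simp only: len)
  also have "\<dots> = (\<Sum>A\<in>F. real (card {xs \<in> ?P. A \<in> set (prefixes xs)}))"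
    by (intro sum_card_swap finF finite_permutations_of_set)
  also have "\<dots> = (\<Sum>A\<in>F. fact n * (1 / real (n choose card A)))"
  proof (intro sum.cong refl)
    fix A assume "A \<in> F"
    hence A: "A \<subseteq> {1..n}" using assms by auto
    hence cA: "card A \<le> n" using card_mono[of "{1..n}" A] by simp
    show "real (card {xs \<in> ?P. A \<in> set (prefixes xs)}) = fact n * (1 / real (n choose card A))"
      using card_perms_through_pair[of "{1..n}" A A] fact_product_up[of "card A" "card A" n] A cA by simp
  qed
  also have "\<dots> = fact n * lubell n F" by (simp add: lubell_def sum_distrib_left)
  finally have 2: "(\<Sum>xs\<in>?P. real (length (trace F xs))) = fact n * lubell n F" .
  have "fact n * (lubell n F - (real k - 1)) = (\<Sum>xs\<in>?P. real (length (trace F xs)) - (real k - 1))"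
    using 2 cardP by (simp only: sum_subtractf sum_constant right_diff_distrib)
  also have "\<dots> \<le> (\<Sum>xs\<in>?P. real (Suc (length (trace F xs)) - k))"
    by (intro sum_mono) linarith
  finally have "(lubell n F - (real k - 1)) * fact n \<le> (\<Sum>xs\<in>?P. real (Suc (length (trace F xs)) - k))"
    by (simp only: mult.commute)
  thus ?thesis unfolding 1 by (subst pos_le_divide_eq[OF fact_gt_zero])
qed

text \<open>
  On one full chain at most one run has \<open>A\<close> in position \<open>i\<close>, so the total weight is at most the
  probability that the full chain passes through both sets of the pair.
\<close>

lemma sum_weight_pair_le:
  assumes "k \<ge> 1" "i < k" "W \<subseteq> all_windows n F k"
    and "\<And>c. c \<in> W \<Longrightarrow> c ! i = A \<and> {A', B} \<subseteq> set c" and "A \<in> {A', B}" "A' \<subseteq> B" "B \<subseteq> {1..n}"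
  shows "(\<Sum>c\<in>W. weight n F c) \<le> real (fact (card A') * fact (card B - card A') * fact (n - card B)) / fact n"
proof -
  let ?P = "permutations_of_set {1..n}"
  have finW: "finite W" using finite_all_windows[OF assms(1)] assms(3) finite_subset by blast
  have d: "distinct xs" if "xs \<in> ?P" for xs using that by (rule permutations_of_setD)
  have "(\<Sum>c\<in>W. weight n F c) = (\<Sum>c\<in>W. real (card {xs \<in> ?P. c \<in> windows k (trace F xs)})) / fact n"
    unfolding sum_divide_distrib using assms(3) by (intro sum.cong refl weight_all_windows) auto
  also have "(\<Sum>c\<in>W. real (card {xs \<in> ?P. c \<in> windows k (trace F xs)})) =
      (\<Sum>xs\<in>?P. real (card {c \<in> W. c \<in> windows k (trace F xs)}))"
    by (intro sum_card_swap finW finite_permutations_of_set)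
  also have "\<dots> \<le> (\<Sum>xs\<in>?P. if A' \<in> set (prefixes xs) \<and> B \<in> set (prefixes xs) then 1 else 0)"
  proof (intro sum_mono)
    fix xs assume xs: "xs \<in> ?P"
    have uniq: "c = c'" if "c \<in> {c \<in> W. c \<in> windows k (trace F xs)}" "c' \<in> {c \<in> W. c \<in> windows k (trace F xs)}" for c c'
      using windows_nth_unique[OF distinct_trace[OF d[OF xs]], of c k F c' i] that assms(2,4) by fastforce
    have "card {c \<in> W. c \<in> windows k (trace F xs)} \<le> 1"
      using uniq by (intro card_le_Suc0_iff_eq[THEN iffD2, folded One_nat_def]) (use finW in auto)
    moreover have "{c \<in> W. c \<in> windows k (trace F xs)} = {}" if "\<not> (A' \<in> set (prefixes xs) \<and> B \<in> set (prefixes xs))"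
    proof (rule ccontr)
      assume "{c \<in> W. c \<in> windows k (trace F xs)} \<noteq> {}"
      then obtain c where "c \<in> W" "c \<in> windows k (trace F xs)" by blast
      thus False using in_windowsD(4)[OF _ d[OF xs], of c k F] assms(4)[of c] that by auto
    qed
    ultimately show "real (card {c \<in> W. c \<in> windows k (trace F xs)}) \<le> (if A' \<in> set (prefixes xs) \<and> B \<in> set (prefixes xs) then 1 else 0)"
      by (cases "A' \<in> set (prefixes xs) \<and> B \<in> set (prefixes xs)") (simp_all only: if_True if_False card.empty of_nat_0 of_nat_le_1_iff simp_thms order_refl)
  qed
  also have "\<dots> = real (card {xs \<in> ?P. A' \<in> set (prefixes xs) \<and> B \<in> set (prefixes xs)})"
    by (simp add: sum.If_cases Int_def)
  also have "\<dots> = real (fact (card A') * fact (card B - card A') * fact (n - card B))"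
    using card_perms_through_pair[of "{1..n}" A' B] assms by simp
  finally show ?thesis by (simp add: divide_right_mono)
qed

text \<open>
  Used to cut a family down so that its members do not occur too often on a random chain: pruning
  loses an amount proportional to that number.
\<close>

lemma subset_sum_between:
  fixes m :: "'b \<Rightarrow> real"
  assumes "finite F" "\<And>x. x \<in> F \<Longrightarrow> 0 \<le> m x \<and> m x \<le> 1" "0 \<le> a" "a \<le> sum m F"
  shows "\<exists>F'\<subseteq>F. a \<le> sum m F' \<and> sum m F' \<le> a + 1"
  using assms
proof (induction F rule: finite_induct)
  case empty
  thus ?case by auto
next
  case (insert x F)
  show ?case
  proof (cases "a \<le> sum m F")
    case True
    thus ?thesis using insert by (metis insertCI subset_insertI2)
  next
    case False
    hence "sum m (insert x F) \<le> a + 1" using insert.hyps insert.prems(1)[of x] by simp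
    thus ?thesis using insert.prems by blast
  qed
qed

text \<open>
  Averaging over \<open>I\<close>: if every \<open>c\<close> satisfies \<open>Q x c\<close> for a proportion \<open>p\<close> of all \<open>x\<close>, then some \<open>x\<close>
  keeps a proportion \<open>p\<close> of the weight.
\<close>

lemma exists_heavy_subfamily:
  fixes w :: "'c \<Rightarrow> real"
  assumes "finite I" "I \<noteq> {}" "finite W" "\<And>c. c \<in> W \<Longrightarrow> 0 \<le> w c"
    and "\<And>c. c \<in> W \<Longrightarrow> real (card {x \<in> I. Q x c}) \<ge> p * real (card I)"
  shows "\<exists>x\<in>I. (\<Sum>c\<in>{c \<in> W. Q x c}. w c) \<ge> p * (\<Sum>c\<in>W. w c)"
proof (rule ccontr)
  assume "\<not> ?thesis"
  hence lt: "(\<Sum>c\<in>{c \<in> W. Q x c}. w c) < p * (\<Sum>c\<in>W. w c)" if "x \<in> I" for x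
    using that by auto
  have "(\<Sum>x\<in>I. \<Sum>c\<in>{c \<in> W. Q x c}. w c) < (\<Sum>x\<in>I. p * (\<Sum>c\<in>W. w c))"
    using assms lt by (intro sum_strict_mono) auto
  also have "\<dots> = (\<Sum>c\<in>W. w c * (p * real (card I)))"
    by (simp only: sum_distrib_right[symmetric] sum_constant) simp
  also have "\<dots> \<le> (\<Sum>c\<in>W. w c * real (card {x \<in> I. Q x c}))"
    by (intro sum_mono mult_left_mono assms(4,5))
  also have "\<dots> = (\<Sum>c\<in>W. \<Sum>x\<in>I. if Q x c then w c else 0)"
    using assms(1) by (intro sum.cong refl) (simp add: sum.If_cases Int_def mult.commute)
  also have "\<dots> = (\<Sum>x\<in>I. \<Sum>c\<in>W. if Q x c then w c else 0)"
    by (rule sum.swap)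
  also have "\<dots> = (\<Sum>x\<in>I. \<Sum>c\<in>{c \<in> W. Q x c}. w c)"
    by (simp only: sum.inter_filter[OF assms(3)])
  finally show False by simp
qed

text \<open>
  A random assignment of the \<open>k\<close> roles gives each of the \<open>k\<close> distinct entries of \<open>c\<close> the role of its
  position with probability $k^{-k}$.
\<close>

lemma card_role_functions:
  assumes "finite F" "distinct c" "set c \<subseteq> F" "length c = k" "k \<ge> 1"
  shows "real (card {f \<in> PiE F (\<lambda>_. {..<k}). \<forall>i<k. f (c ! i) = i}) = real (card (PiE F (\<lambda>_. {..<k}))) / real k ^ k"
proof -
  define idx where "idx A = (THE i. i < k \<and> c ! i = A)" for A
  have idx: "idx (c ! i) = i" if "i < k" for i
    unfolding idx_def using assms that by (auto simp: nth_eq_iff_index_eq)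
  have "{f \<in> PiE F (\<lambda>_. {..<k}). \<forall>i<k. f (c ! i) = i} = PiE F (\<lambda>A. if A \<in> set c then {idx A} else {..<k})"
  proof (intro equalityI subsetI)
    fix f assume f: "f \<in> {f \<in> PiE F (\<lambda>_. {..<k}). \<forall>i<k. f (c ! i) = i}"
    show "f \<in> PiE F (\<lambda>A. if A \<in> set c then {idx A} else {..<k})"
      using f assms(4) idx by (auto simp: PiE_iff in_set_conv_nth)
  next
    fix f assume f: "f \<in> PiE F (\<lambda>A. if A \<in> set c then {idx A} else {..<k})"
    have "f (c ! i) = i" if "i < k" for i
      using f that assms idx[OF that] by (auto simp: PiE_iff) (metis nth_mem singletonD subsetD)
    moreover have "f A < k" if "A \<in> F" for A
      using f that assms(4) idx by (auto simp: PiE_iff in_set_conv_nth split: if_splits)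
    ultimately show "f \<in> {f \<in> PiE F (\<lambda>_. {..<k}). \<forall>i<k. f (c ! i) = i}"
      using f by (auto simp: PiE_iff)
  qed
  hence "card {f \<in> PiE F (\<lambda>_. {..<k}). \<forall>i<k. f (c ! i) = i} = (\<Prod>A\<in>F. if A \<in> set c then 1 else k)"
    using assms(1) by (simp add: card_PiE if_distrib cong: if_cong)
  also have "\<dots> = k ^ (card F - k)"
    using assms by (simp add: prod.If_cases distinct_card card_Diff_subset Diff_eq[symmetric])
  finally have "real (card {f \<in> PiE F (\<lambda>_. {..<k}). \<forall>i<k. f (c ! i) = i}) = real k ^ (card F - k)" by simp
  moreover have "k \<le> card F" using assms by (metis card_mono distinct_card)
  ultimately show ?thesis using assms
    by (simp add: card_PiE power_diff)
qed

text \<open>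
  Choose \<open>C\<close> maximizing the total weight minus \<open>\<eta>\<close> times the measure of the sets that occur in each
  position. Removing all lists with a given entry in a given position cannot increase this
  potential, so these lists weigh at least \<open>\<eta>\<close> times the measure of that entry.
\<close>

lemma robust_subfamily:
  fixes w :: "'b list \<Rightarrow> real" and m :: "'b \<Rightarrow> real"
  assumes "finite W" "\<And>A. m A \<ge> 0" "\<eta> \<ge> 0"
    and big: "(\<Sum>c\<in>W. w c) > \<eta> * (\<Sum>i<k. \<Sum>A\<in>(\<lambda>c. c ! i) ` W. m A)"
  shows "\<exists>C\<subseteq>W. C \<noteq> {} \<and> (\<forall>c\<in>C. \<forall>i<k. \<eta> * m (c ! i) \<le> (\<Sum>c'\<in>{c' \<in> C. c' ! i = c ! i}. w c'))"
proof -
  define \<Phi> where "\<Phi> C = (\<Sum>c\<in>C. w c) - \<eta> * (\<Sum>i<k. \<Sum>A\<in>(\<lambda>c. c ! i) ` C. m A)" for C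
  have "Max (\<Phi> ` Pow W) \<in> \<Phi> ` Pow W" using assms(1) by (intro Max_in) auto
  then obtain C where C: "C \<subseteq> W" "\<Phi> C = Max (\<Phi> ` Pow W)" by auto
  have max: "\<Phi> C' \<le> \<Phi> C" if "C' \<subseteq> W" for C'
    unfolding C(2) using that assms(1) by (intro Max_ge) auto
  have finC: "finite C" using C assms(1) finite_subset by blast
  have "\<Phi> W > 0" using big by (simp add: \<Phi>_def)
  hence "\<Phi> C > 0" using max[of W] by simp
  hence "C \<noteq> {}" by (auto simp: \<Phi>_def)
  moreover have "\<eta> * m (c ! i) \<le> (\<Sum>c'\<in>{c' \<in> C. c' ! i = c ! i}. w c')" if "c \<in> C" "i < k" for c i
  proof -
    define R where "R = {c' \<in> C. c' ! i = c ! i}"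
    have "(\<Sum>l<k. \<Sum>A\<in>(\<lambda>c. c ! l) ` (C - R). m A) \<le> (\<Sum>l<k. (\<Sum>A\<in>(\<lambda>c. c ! l) ` C. m A) - (if l = i then m (c ! i) else 0))"
    proof (intro sum_mono)
      fix l
      show "(\<Sum>A\<in>(\<lambda>c. c ! l) ` (C - R). m A) \<le> (\<Sum>A\<in>(\<lambda>c. c ! l) ` C. m A) - (if l = i then m (c ! i) else 0)"
      proof (cases "l = i")
        case True
        have "(\<Sum>A\<in>(\<lambda>c. c ! i) ` (C - R). m A) \<le> (\<Sum>A\<in>(\<lambda>c. c ! i) ` C - {c ! i}. m A)"
          using finC assms(2) by (intro sum_mono2) (auto simp: R_def)
        also have "\<dots> = (\<Sum>A\<in>(\<lambda>c. c ! i) ` C. m A) - m (c ! i)"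
          using finC that by (simp add: sum_diff1)
        finally show ?thesis using True by simp
      next
        case False
        have "(\<Sum>A\<in>(\<lambda>c. c ! l) ` (C - R). m A) \<le> (\<Sum>A\<in>(\<lambda>c. c ! l) ` C. m A)"
          using finC assms(2) by (intro sum_mono2) auto
        thus ?thesis using False by simp
      qed
    qed
    also have "\<dots> = (\<Sum>l<k. \<Sum>A\<in>(\<lambda>c. c ! l) ` C. m A) - m (c ! i)"
      using that(2) by (simp add: sum_subtractf)
    finally have "\<eta> * (\<Sum>l<k. \<Sum>A\<in>(\<lambda>c. c ! l) ` (C - R). m A) \<le> \<eta> * ((\<Sum>l<k. \<Sum>A\<in>(\<lambda>c. c ! l) ` C. m A) - m (c ! i))"
      using assms(3) by (rule mult_left_mono)
    moreover have "(\<Sum>c\<in>C - R. w c) = (\<Sum>c\<in>C. w c) - (\<Sum>c\<in>R. w c)"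
      using finC by (intro sum_diff) (auto simp: R_def)
    moreover have "\<Phi> (C - R) \<le> \<Phi> C" using C by (intro max) auto
    ultimately show ?thesis unfolding \<Phi>_def R_def[symmetric] by (simp add: algebra_simps)
  qed
  ultimately show ?thesis using C(1) by blast
qed

section \<open>Systems of chains in a dense family\<close>

text \<open>
  A robust family of \<open>k\<close>-chains. The sets occurring in different positions are different, and from
  a set in position \<open>i\<close> the chains of the family reach in position \<open>i'\<close> a proportion of at least \<open>\<eta>\<close> of
  all supersets (or subsets), each weighted with the probability that a random full chain through
  the set passes through it.
\<close>

locale chain_system =
  fixes n k :: nat and \<eta> :: real and C :: "nat set list set"
  assumes \<eta>_pos: "\<eta> > 0"
    and nonempty: "C \<noteq> {}"
    and len: "c \<in> C \<Longrightarrow> length c = k"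
    and bal: "c \<in> C \<Longrightarrow> set c \<subseteq> balanced n"
    and chain: "c \<in> C \<Longrightarrow> sorted_wrt (\<subset>) c"
    and roles: "c \<in> C \<Longrightarrow> c' \<in> C \<Longrightarrow> i < k \<Longrightarrow> i' < k \<Longrightarrow> c ! i = c' ! i' \<Longrightarrow> i = i'"
    and up_sum: "c \<in> C \<Longrightarrow> i < i' \<Longrightarrow> i' < k \<Longrightarrow>
       \<eta> \<le> (\<Sum>B\<in>(\<lambda>c'. c' ! i') ` {c' \<in> C. c' ! i = c ! i}. 1 / real ((n - card (c ! i)) choose (card B - card (c ! i))))"
    and down_sum: "c \<in> C \<Longrightarrow> i' < i \<Longrightarrow> i < k \<Longrightarrow>
       \<eta> \<le> (\<Sum>B\<in>(\<lambda>c'. c' ! i') ` {c' \<in> C. c' ! i = c ! i}. 1 / real (card (c ! i) choose card B))"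

text \<open>
  The runs of length \<open>k\<close> have total weight at least \<open>\<epsilon>\<close>. A constant proportion of it survives when the
  runs are sorted by roles and by the value of \<open>g\<close>, and pruning then makes the surviving family
  robust. The value of \<open>\<eta>\<close> is half of what this argument allows, so that pruning leaves something.
\<close>

lemma exists_chain_system_lubell:
  fixes \<epsilon> :: real
  assumes "k \<ge> 1" "q \<ge> 1" "\<epsilon> > 0"
  shows "\<exists>\<eta>>0. \<forall>n F (g :: nat set list \<Rightarrow> nat). F \<subseteq> balanced n \<longrightarrow>
     lubell n F \<ge> real k - 1 + \<epsilon> \<longrightarrow> (\<forall>c. g c < q) \<longrightarrow>
     (\<exists>C \<sigma>. chain_system n k \<eta> C \<and> (\<forall>c\<in>C. set c \<subseteq> F \<and> g c = \<sigma>))"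
proof -
  define p where "p = 1 / (real q * real k ^ k)"
  have p: "p > 0" using assms by (simp add: p_def)
  define \<eta> where "\<eta> = p * \<epsilon> / (2 * real k * (real k + \<epsilon>))"
  have \<eta>: "\<eta> > 0" using p assms by (simp add: \<eta>_def)
  show ?thesis
  proof (intro exI[of _ \<eta>] conjI \<eta> allI impI)
    fix n and F :: "nat set set" and g :: "nat set list \<Rightarrow> nat"
    assume Fb: "F \<subseteq> balanced n" and lub: "lubell n F \<ge> real k - 1 + \<epsilon>" and g: "\<forall>c. g c < q"
    have F: "F \<subseteq> Pow {1..n}" using Fb by (auto simp: balanced_def)
    define m where "m A = 1 / real (n choose card A)" for A :: "nat set"
    have "1 / real x \<le> 1" for x by (cases x) auto
    hence m: "0 \<le> m A" "m A \<le> 1" for A by (simp_all only: m_def zero_le_divide_1_iff of_nat_0_le_iff)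
    have m_pos: "0 < m A" if "A \<subseteq> {1..n}" for A
      using card_mono[OF _ that] by (simp add: m_def)
    have lub_m: "lubell n G = sum m G" for G by (simp add: lubell_def m_def)
    have "finite F" using F by (rule finite_subset) simp
    then obtain F' where F': "F' \<subseteq> F" "real k - 1 + \<epsilon> \<le> sum m F'" "sum m F' \<le> real k + \<epsilon>"
      using subset_sum_between[of F m "real k - 1 + \<epsilon>"] m lub assms unfolding lub_m by auto
    have finF': "finite F'" using F'(1) \<open>finite F\<close> by (rule finite_subset)
    have F'n: "F' \<subseteq> Pow {1..n}" using F F' by blast
    define W where "W = all_windows n F' k"
    define w where "w = weight n F'"
    have sumW: "(\<Sum>c\<in>W. w c) \<ge> \<epsilon>"
      using sum_weight_all_windows[OF assms(1) F'n] F'(2) unfolding lub_m W_def w_def by linarith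
    have W: "length c = k" "set c \<subseteq> F'" "sorted_wrt (\<subset>) c" if "c \<in> W" for c
      using in_all_windowsD that unfolding W_def by blast+
    have finW: "finite W" unfolding W_def using assms(1) by (rule finite_all_windows)
    define I where "I = PiE F' (\<lambda>_. {..<k}) \<times> {..<q}"
    define Q where "Q = (\<lambda>(f, \<sigma>) c. (\<forall>i<k. f (c ! i) = i) \<and> g c = (\<sigma> :: nat))"
    have cardQ: "real (card {x \<in> I. Q x c}) = p * real (card I)" if "c \<in> W" for c
    proof -
      have "{x \<in> I. Q x c} = {f \<in> PiE F' (\<lambda>_. {..<k}). \<forall>i<k. f (c ! i) = i} \<times> {g c}"
        using g by (auto simp: I_def Q_def)
      hence "real (card {x \<in> I. Q x c}) = real (card {f \<in> PiE F' (\<lambda>_. {..<k}). \<forall>i<k. f (c ! i) = i})"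
        by (simp add: card_cartesian_product)
      also have "\<dots> = real (card (PiE F' (\<lambda>_. {..<k}))) / real k ^ k"
        using W[OF that] assms(1) finF' by (intro card_role_functions distinct_sorted_psubset)
      also have "\<dots> = p * real (card I)"
        using assms by (simp add: I_def card_cartesian_product p_def)
      finally show ?thesis .
    qed
    have "\<exists>x\<in>I. (\<Sum>c\<in>{c \<in> W. Q x c}. w c) \<ge> p * (\<Sum>c\<in>W. w c)"
    proof (rule exists_heavy_subfamily)
      show "finite I" using finF' by (auto simp: I_def intro!: finite_PiE)
      show "I \<noteq> {}" using assms by (auto simp: I_def PiE_eq_empty_iff lessThan_empty_iff)
    qed (use finW cardQ in \<open>simp_all add: w_def weight_nonneg\<close>)
    then obtain f \<sigma> where f: "(\<Sum>c\<in>{c \<in> W. Q (f, \<sigma>) c}. w c) \<ge> p * (\<Sum>c\<in>W. w c)"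
      by auto
    define W' where "W' = {c \<in> W. Q (f, \<sigma>) c}"
    have "p * \<epsilon> \<le> p * (\<Sum>c\<in>W. w c)" using sumW p by (intro mult_left_mono) auto
    hence sumW': "(\<Sum>c\<in>W'. w c) \<ge> p * \<epsilon>" using f unfolding W'_def by linarith
    have "\<eta> * (\<Sum>i<k. \<Sum>A\<in>(\<lambda>c. c ! i) ` W'. m A) \<le> \<eta> * (\<Sum>i<k. real k + \<epsilon>)"
    proof (intro mult_left_mono sum_mono)
      fix i assume "i \<in> {..<k}"
      hence "(\<lambda>c. c ! i) ` W' \<subseteq> F'" using W by (fastforce simp: W'_def)
      hence "(\<Sum>A\<in>(\<lambda>c. c ! i) ` W'. m A) \<le> sum m F'" using finF' m by (intro sum_mono2) auto
      thus "(\<Sum>A\<in>(\<lambda>c. c ! i) ` W'. m A) \<le> real k + \<epsilon>" using F'(3) by linarith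
    qed (use \<eta> in simp)
    also have "\<dots> = p * \<epsilon> / 2"
    proof -
      obtain s where s: "s = real k + \<epsilon>" by blast
      have "s \<noteq> 0" using assms unfolding s by linarith
      thus ?thesis using assms unfolding \<eta>_def s[symmetric] by simp
    qed
    also have "\<dots> < p * \<epsilon>" using p assms by simp
    finally have big: "(\<Sum>c\<in>W'. w c) > \<eta> * (\<Sum>i<k. \<Sum>A\<in>(\<lambda>c. c ! i) ` W'. m A)" using sumW' by linarith
    obtain C where C: "C \<subseteq> W'" "C \<noteq> {}"
      and Cw: "\<And>c i. c \<in> C \<Longrightarrow> i < k \<Longrightarrow> \<eta> * m (c ! i) \<le> (\<Sum>c'\<in>{c' \<in> C. c' ! i = c ! i}. w c')"
    proof -
      have "finite W'" using finW by (simp add: W'_def)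
      from robust_subfamily[OF this m(1) less_imp_le[OF \<eta>] big] show ?thesis using that by blast
    qed
    have CW: "C \<subseteq> W" using C by (auto simp: W'_def)
    have finC: "finite C" using CW finW by (rule finite_subset)
    have props: "length c = k \<and> set c \<subseteq> F \<and> sorted_wrt (\<subset>) c \<and> (\<forall>i<k. f (c ! i) = i) \<and> g c = \<sigma>" if "c \<in> C" for c
      using C(1) W[of c] F'(1) that by (auto simp: W'_def Q_def)
    have nth: "c ! i \<subset> c ! i'" if "c \<in> C" "i < i'" "i' < k" for c i i'
      using props[OF that(1)] that(2,3) by (auto simp: sorted_wrt_iff_nth_less)
    have nth_n: "c ! i \<subseteq> {1..n}" if "c \<in> C" "i < k" for c i
      using props[OF that(1)] that(2) F by (meson PowD nth_mem subsetD)
    have grp: "\<eta> * m (c ! i) \<le> (\<Sum>B\<in>(\<lambda>c'. c' ! i') ` {c' \<in> C. c' ! i = c ! i}. \<Sum>c'\<in>{c' \<in> C. c' ! i = c ! i \<and> c' ! i' = B}. w c')"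
      if "c \<in> C" "i < k" for c i i'
    proof -
      have "(\<Sum>c'\<in>{c' \<in> C. c' ! i = c ! i}. w c') =
        (\<Sum>B\<in>(\<lambda>c'. c' ! i') ` {c' \<in> C. c' ! i = c ! i}. \<Sum>c'\<in>{c' \<in> {c' \<in> C. c' ! i = c ! i}. c' ! i' = B}. w c')"
        using finC by (intro sum.image_gen) auto
      thus ?thesis using Cw[OF that] by (simp add: conj_assoc)
    qed
    have up: "\<eta> \<le> (\<Sum>B\<in>(\<lambda>c'. c' ! i') ` {c' \<in> C. c' ! i = c ! i}. 1 / real ((n - card (c ! i)) choose (card B - card (c ! i))))"
      if "c \<in> C" "i < i'" "i' < k" for c i i'
    proof -
      have ii: "i < k" "i' < k" using that by auto
      have "\<eta> * m (c ! i) \<le> (\<Sum>B\<in>(\<lambda>c'. c' ! i') ` {c' \<in> C. c' ! i = c ! i}.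
               1 / real ((n - card (c ! i)) choose (card B - card (c ! i))) * m (c ! i))"
      proof (rule order_trans[OF grp[OF that(1), of i i']])
        show "i < k" using that by simp
        show "(\<Sum>B\<in>(\<lambda>c'. c' ! i') ` {c' \<in> C. c' ! i = c ! i}. \<Sum>c'\<in>{c' \<in> C. c' ! i = c ! i \<and> c' ! i' = B}. w c') \<le>
          (\<Sum>B\<in>(\<lambda>c'. c' ! i') ` {c' \<in> C. c' ! i = c ! i}.
               1 / real ((n - card (c ! i)) choose (card B - card (c ! i))) * m (c ! i))"
        proof (intro sum_mono)
          fix B assume "B \<in> (\<lambda>c'. c' ! i') ` {c' \<in> C. c' ! i = c ! i}"
          then obtain b where b: "b \<in> C" "b ! i = c ! i" "B = b ! i'" by auto
          have B: "c ! i \<subseteq> B" "B \<subseteq> {1..n}" using b nth[OF b(1) that(2,3)] nth_n[OF b(1) that(3)] by auto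
          have mem: "c ! i \<in> set c'" "c' ! i' \<in> set c'" if "c' \<in> C" "c' ! i = c ! i" for c'
          proof -
            have "length c' = k" using props[OF that(1)] by blast
            thus "c ! i \<in> set c'" "c' ! i' \<in> set c'"
              using nth_mem[of i c'] nth_mem[of i' c'] that(2) ii by auto
          qed
          have cds: "card (c ! i) \<le> card B" "card B \<le> n"
            using B card_mono[of "{1..n}" B] card_mono[of B "c ! i"] finite_subset[of B "{1..n}"] by auto
          have "(\<Sum>c'\<in>{c' \<in> C. c' ! i = c ! i \<and> c' ! i' = B}. w c') \<le>
              real (fact (card (c ! i)) * fact (card B - card (c ! i)) * fact (n - card B)) / fact n"
            unfolding w_def
          proof (rule sum_weight_pair_le[of k i _ n F' "c ! i"])
            show "{c' \<in> C. c' ! i = c ! i \<and> c' ! i' = B} \<subseteq> all_windows n F' k" using CW by (auto simp: W_def)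
          qed (use assms(1) B mem ii in auto)
          also have "\<dots> = 1 / real ((n - card (c ! i)) choose (card B - card (c ! i))) * m (c ! i)"
            unfolding fact_product_up[OF cds] m_def by simp
          finally show "(\<Sum>c'\<in>{c' \<in> C. c' ! i = c ! i \<and> c' ! i' = B}. w c') \<le> \<dots>" .
        qed
      qed
      thus ?thesis using m_pos[OF nth_n[OF that(1)], of i] that unfolding sum_distrib_right[symmetric] by simp
    qed
    have down: "\<eta> \<le> (\<Sum>B\<in>(\<lambda>c'. c' ! i') ` {c' \<in> C. c' ! i = c ! i}. 1 / real (card (c ! i) choose card B))"
      if "c \<in> C" "i < k" "i' < i" for c i i'
    proof -
      have ii: "i < k" "i' < k" using that by auto
      have "\<eta> * m (c ! i) \<le> (\<Sum>B\<in>(\<lambda>c'. c' ! i') ` {c' \<in> C. c' ! i = c ! i}.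
               1 / real (card (c ! i) choose card B) * m (c ! i))"
      proof (rule order_trans[OF grp[OF that(1,2), of i']])
        show "(\<Sum>B\<in>(\<lambda>c'. c' ! i') ` {c' \<in> C. c' ! i = c ! i}. \<Sum>c'\<in>{c' \<in> C. c' ! i = c ! i \<and> c' ! i' = B}. w c') \<le>
          (\<Sum>B\<in>(\<lambda>c'. c' ! i') ` {c' \<in> C. c' ! i = c ! i}. 1 / real (card (c ! i) choose card B) * m (c ! i))"
        proof (intro sum_mono)
          fix B assume "B \<in> (\<lambda>c'. c' ! i') ` {c' \<in> C. c' ! i = c ! i}"
          then obtain b where b: "b \<in> C" "b ! i = c ! i" "B = b ! i'" by auto
          have B: "B \<subseteq> c ! i" "c ! i \<subseteq> {1..n}" using b nth[OF b(1) that(3,2)] nth_n[OF that(1,2)] by auto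
          have mem: "c ! i \<in> set c'" "c' ! i' \<in> set c'" if "c' \<in> C" "c' ! i = c ! i" for c'
          proof -
            have "length c' = k" using props[OF that(1)] by blast
            thus "c ! i \<in> set c'" "c' ! i' \<in> set c'"
              using nth_mem[of i c'] nth_mem[of i' c'] that(2) ii by auto
          qed
          have cds: "card B \<le> card (c ! i)" "card (c ! i) \<le> n"
            using B card_mono[of "{1..n}" "c ! i"] card_mono[of "c ! i" B] finite_subset[of "c ! i" "{1..n}"] by auto
          have "(\<Sum>c'\<in>{c' \<in> C. c' ! i = c ! i \<and> c' ! i' = B}. w c') \<le>
              real (fact (card B) * fact (card (c ! i) - card B) * fact (n - card (c ! i))) / fact n"
            unfolding w_def
          proof (rule sum_weight_pair_le[of k i _ n F' "c ! i"])
            show "{c' \<in> C. c' ! i = c ! i \<and> c' ! i' = B} \<subseteq> all_windows n F' k" using CW by (auto simp: W_def)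
          qed (use assms(1) B mem ii in auto)
          also have "\<dots> = 1 / real (card (c ! i) choose card B) * m (c ! i)"
            unfolding fact_product_down[OF cds] m_def by simp
          finally show "(\<Sum>c'\<in>{c' \<in> C. c' ! i = c ! i \<and> c' ! i' = B}. w c') \<le> \<dots>" .
        qed
      qed
      thus ?thesis using m_pos[OF nth_n[OF that(1)], of i] that unfolding sum_distrib_right[symmetric] by simp
    qed
    have "chain_system n k \<eta> C"
    proof
      show "set c \<subseteq> balanced n" if "c \<in> C" for c using props[OF that] Fb by blast
      show "i = i'" if "c \<in> C" "c' \<in> C" "i < k" "i' < k" "c ! i = c' ! i'" for c c' i i'
        using props[OF that(1)] props[OF that(2)] that(3-5) by metis
    qed (use \<eta> C(2) props up down in simp_all)
    thus "\<exists>C \<sigma>. chain_system n k \<eta> C \<and> (\<forall>c\<in>C. set c \<subseteq> F \<and> g c = \<sigma>)"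
      using props by (intro exI[of _ C] exI[of _ \<sigma>]) simp
  qed
qed

section \<open>Tree posets and greedy embeddings\<close>

text \<open>
  Connectedness is stated with reachability, which composes more easily than paths.
\<close>

definition connected_in :: "('v \<times> 'v) set \<Rightarrow> 'v set \<Rightarrow> bool" where
  "connected_in E S \<longleftrightarrow> (\<forall>x\<in>S. \<forall>y\<in>S. (x, y) \<in> (Restr E S)\<^sup>*)"

lemma rtrancl_of_path:
  assumes "path_between E x y p" "set p \<subseteq> S"
  shows "(x, y) \<in> (Restr E S)\<^sup>*"
proof -
  have "successively (\<lambda>x y. (x, y) \<in> E) p \<Longrightarrow> p \<noteq> [] \<Longrightarrow> set p \<subseteq> S \<Longrightarrow> (hd p, last p) \<in> (Restr E S)\<^sup>*" for p
  proof (induction p rule: induct_list012)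
    case (3 a b p)
    hence "(a, b) \<in> Restr E S" "(b, last (b # p)) \<in> (Restr E S)\<^sup>*" by auto
    thus ?case by (auto intro: converse_rtrancl_into_rtrancl)
  qed auto
  thus ?thesis using assms by (auto simp: path_between_def path_in_def)
qed

text \<open>
  A walk that returns to a vertex is cut at its first visit.
\<close>

lemma path_of_rtrancl:
  assumes "(x, y) \<in> (Restr E S)\<^sup>*" "x \<in> S"
  shows "\<exists>p. set p \<subseteq> S \<and> path_between E x y p"
  using assms(1)
proof (induction rule: rtrancl_induct)
  case base
  show ?case using assms(2) by (intro exI[of _ "[x]"]) (simp add: path_between_def path_in_def)
next
  case (step y z)
  then obtain p where p: "set p \<subseteq> S" "path_between E x y p" by blast
  show ?case
  proof (cases "z \<in> set p")
    case True
    then obtain p1 p2 where "p = p1 @ z # p2" by (meson split_list)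
    hence "path_between E x z (p1 @ [z])" "set (p1 @ [z]) \<subseteq> S"
      using p by (auto simp: path_between_def path_in_def successively_append_iff hd_append)
    thus ?thesis by blast
  next
    case False
    hence "path_between E x z (p @ [z])" "set (p @ [z]) \<subseteq> S"
      using p step by (auto simp: path_between_def path_in_def successively_append_iff)
    thus ?thesis by blast
  qed
qed

text \<open>
  A path between two neighbours of \<open>v\<close> inside \<open>S\<close> is closed to a cycle by \<open>v\<close>. This is the form in
  which acyclicity makes the greedy embedding possible.
\<close>

lemma at_most_one_neighbour:
  assumes "tree_graph V E" "sym E" "S \<subseteq> V" "connected_in E S" "v \<in> V - S"
    and "u \<in> S" "u' \<in> S" "(v, u) \<in> E" "(v, u') \<in> E"
  shows "u = u'"
proof (rule ccontr)
  assume ne: "u \<noteq> u'"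
  obtain p where p: "set p \<subseteq> S" "path_between E u u' p"
    using assms path_of_rtrancl[of u u' E S] by (auto simp: connected_in_def)
  have "length p \<ge> 2" using p(2) ne by (cases p rule: list.exhaust; cases "tl p") (auto simp: path_between_def path_in_def)
  moreover have "path_in E (v # p)"
    using p assms by (auto simp: path_between_def path_in_def successively_Cons)
  moreover have "(last (v # p), hd (v # p)) \<in> E"
    using p assms by (auto simp: path_between_def path_in_def dest: symD)
  ultimately have "cycle_in E (v # p)" by (simp add: cycle_in_def)
  moreover have "set (v # p) \<subseteq> V" using p assms by auto
  ultimately show False using assms(1) unfolding tree_graph_def by blast
qed

lemma sym_hasse: "sym (hasse T)"
  by (auto simp: hasse_def sym_def)

lemma connected_in_star:
  assumes "sym E" "a \<in> S" "\<And>x. x \<in> S \<Longrightarrow> (a, x) \<in> (Restr E S)\<^sup>*"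
  shows "connected_in E S"
proof -
  have "sym ((Restr E S)\<^sup>*)" using assms(1) by (intro sym_rtrancl) (auto simp: sym_def)
  thus ?thesis unfolding connected_in_def using assms(3) by (meson rtrancl_trans symD)
qed

locale tree =
  fixes T :: "('a \<times> 'a) set"
  assumes tree: "tree_poset T"
begin

lemma fin: "finite (Field T)" and po: "Partial_order T" and graph: "tree_graph (Field T) (hasse T)"
  using tree by (auto simp: tree_poset_def)

lemma refl: "x \<in> Field T \<Longrightarrow> (x, x) \<in> T"
  using po by (auto simp: partial_order_on_def preorder_on_def refl_on_def)

lemma trans: "(x, y) \<in> T \<Longrightarrow> (y, z) \<in> T \<Longrightarrow> (x, z) \<in> T"
  using po by (auto simp: partial_order_on_def preorder_on_def dest: transD)

lemma antisym: "(x, y) \<in> T \<Longrightarrow> (y, x) \<in> T \<Longrightarrow> x = y"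
  using po by (auto simp: partial_order_on_def dest: antisymD)

lemma field: "(x, y) \<in> T \<Longrightarrow> x \<in> Field T \<and> y \<in> Field T"
  by (auto simp: Field_def)

lemma field_nonempty: "Field T \<noteq> {}"
  using graph by (simp add: tree_graph_def)

lemma coversD: "covers T q p \<Longrightarrow> (p, q) \<in> T" "covers T q p \<Longrightarrow> p \<noteq> q"
  by (auto simp: covers_def)

definition below :: "'a \<Rightarrow> nat" where
  "below v = card {u. (u, v) \<in> T}"

lemma below_mono:
  assumes "(u, v) \<in> T" "u \<noteq> v"
  shows "below u < below v"
  unfolding below_def
proof (rule psubset_card_mono)
  show "finite {u. (u, v) \<in> T}" using fin by (rule finite_subset[rotated]) (auto simp: Field_def)
  show "{w. (w, u) \<in> T} \<subset> {u. (u, v) \<in> T}"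
  proof
    show "{w. (w, u) \<in> T} \<subseteq> {u. (u, v) \<in> T}" using assms trans by blast
    have "v \<in> {u. (u, v) \<in> T}" using field[OF assms(1)] refl by blast
    moreover have "v \<notin> {w. (w, u) \<in> T}" using assms antisym by blast
    ultimately show "{w. (w, u) \<in> T} \<noteq> {u. (u, v) \<in> T}" by blast
  qed
qed

lemma below_le: "below v \<le> card (Field T)"
  unfolding below_def by (intro card_mono fin) (auto simp: Field_def)

lemma lower_cover:
  assumes "(x, v) \<in> T" "x \<noteq> v"
  shows "\<exists>u. covers T v u \<and> (x, u) \<in> T"
proof -
  define P where "P = (\<lambda>u. (x, u) \<in> T \<and> (u, v) \<in> T \<and> u \<noteq> v)"
  have "P x" using assms refl field unfolding P_def by blast
  moreover have "\<forall>y. P y \<longrightarrow> below y < Suc (card (Field T))" using below_le by (auto simp: less_Suc_eq_le)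
  ultimately obtain u where u: "P u" "\<forall>y. P y \<longrightarrow> below y \<le> below u"
    using ex_has_greatest_nat[of P x below "Suc (card (Field T))"] by blast
  have "covers T v u"
    unfolding covers_def
  proof (intro conjI notI)
    assume "\<exists>z. (u, z) \<in> T \<and> (z, v) \<in> T \<and> z \<noteq> u \<and> z \<noteq> v"
    then obtain z where z: "(u, z) \<in> T" "(z, v) \<in> T" "z \<noteq> u" "z \<noteq> v" by blast
    hence "P z" using u trans unfolding P_def by blast
    thus False using u(2) below_mono[OF z(1)] z(3) by force
  qed (use u in \<open>auto simp: P_def\<close>)
  thus ?thesis using u by (auto simp: P_def)
qed

text \<open>
  Descend from \<open>x\<close> along lower covers that stay above \<open>a\<close>.
\<close>

lemma interval_connected:
  assumes "(a, x) \<in> T"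
  shows "(a, x) \<in> (Restr (hasse T) {y. (a, y) \<in> T \<and> (y, x) \<in> T})\<^sup>*"
  using assms
proof (induction "below x" arbitrary: x rule: less_induct)
  case less
  show ?case
  proof (cases "a = x")
    case False
    obtain u where u: "covers T x u" "(a, u) \<in> T" using lower_cover less.prems False by blast
    note ux = coversD[OF u(1)]
    have "(a, u) \<in> (Restr (hasse T) {y. (a, y) \<in> T \<and> (y, u) \<in> T})\<^sup>*"
      using less.hyps[OF below_mono[OF ux] u(2)] .
    moreover have "Restr (hasse T) {y. (a, y) \<in> T \<and> (y, u) \<in> T} \<subseteq> Restr (hasse T) {y. (a, y) \<in> T \<and> (y, x) \<in> T}"
      using ux trans by blast
    ultimately have "(a, u) \<in> (Restr (hasse T) {y. (a, y) \<in> T \<and> (y, x) \<in> T})\<^sup>*"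
      by (meson rtrancl_mono subsetD)
    moreover have "(u, x) \<in> Restr (hasse T) {y. (a, y) \<in> T \<and> (y, x) \<in> T}"
      using u ux less.prems field refl by (auto simp: hasse_def)
    ultimately show ?thesis by (rule rtrancl_into_rtrancl)
  qed simp
qed

lemma connected_above:
  assumes "a \<in> S" "\<And>x. x \<in> S \<Longrightarrow> (a, x) \<in> T" "\<And>x y. x \<in> S \<Longrightarrow> (a, y) \<in> T \<Longrightarrow> (y, x) \<in> T \<Longrightarrow> y \<in> S"
  shows "connected_in (hasse T) S"
proof (rule connected_in_star[OF sym_hasse assms(1)])
  fix x assume x: "x \<in> S"
  have "Restr (hasse T) {y. (a, y) \<in> T \<and> (y, x) \<in> T} \<subseteq> Restr (hasse T) S" using assms x by blast
  thus "(a, x) \<in> (Restr (hasse T) S)\<^sup>*"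
    using interval_connected[OF assms(2)[OF x]] by (meson rtrancl_mono subsetD)
qed

text \<open>
  Both covers lie in the set of elements above \<open>a\<close> and strictly below \<open>v\<close>, which is connected
  through \<open>a\<close>.
\<close>

lemma unique_lower_cover:
  assumes "(a, u) \<in> T" "(a, u') \<in> T" "covers T v u" "covers T v u'"
  shows "u = u'"
proof (rule at_most_one_neighbour[OF graph sym_hasse])
  let ?S = "{x. (a, x) \<in> T \<and> (x, v) \<in> T \<and> x \<noteq> v}"
  note c = coversD[OF assms(3)] coversD[OF assms(4)]
  show "?S \<subseteq> Field T" using field by blast
  have "a \<noteq> v" using assms(1) c antisym by blast
  show "connected_in (hasse T) ?S"
  proof (rule connected_above[of a])
    show "a \<in> ?S" using \<open>a \<noteq> v\<close> assms(1) c trans field refl by blast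
  next
    fix x y assume "x \<in> ?S" "(a, y) \<in> T" "(y, x) \<in> T"
    thus "y \<in> ?S" using trans antisym by blast
  qed blast
  show "v \<in> Field T - ?S" using c field by blast
  show "u \<in> ?S" "u' \<in> ?S" using c assms by auto
  show "(v, u) \<in> hasse T" "(v, u') \<in> hasse T" using assms by (auto simp: hasse_def)
qed

text \<open>
  In a tree poset intervals are chains, because going down from \<open>v\<close> towards \<open>a\<close> there is never a
  choice.
\<close>

lemma interval_chain:
  assumes "(a, x) \<in> T" "(a, y) \<in> T" "(x, v) \<in> T" "(y, v) \<in> T"
  shows "(x, y) \<in> T \<or> (y, x) \<in> T"
  using assms
proof (induction "below v" arbitrary: v rule: less_induct)
  case less
  show ?case
  proof (cases "x = v \<or> y = v")
    case False
    obtain u where u: "covers T v u" "(x, u) \<in> T" using lower_cover less.prems False by blast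
    obtain u' where u': "covers T v u'" "(y, u') \<in> T" using lower_cover less.prems False by blast
    have "u = u'" using unique_lower_cover[of a u u' v] u u' less.prems trans by blast
    thus ?thesis using less.hyps[OF below_mono[OF coversD[OF u(1)]]] u u' less.prems by blast
  qed (use less.prems in auto)
qed

lemma crossing_edge:
  assumes "S \<subseteq> Field T" "S \<noteq> {}" "S \<noteq> Field T"
  shows "\<exists>u\<in>S. \<exists>v\<in>Field T - S. (u, v) \<in> hasse T"
proof (rule ccontr)
  assume no: "\<not> ?thesis"
  obtain s where s: "s \<in> S" using assms by blast
  obtain w where w: "w \<in> Field T" "w \<notin> S" using assms by blast
  obtain p where "set p \<subseteq> Field T" "path_between (hasse T) s w p"
    using graph s w assms unfolding tree_graph_def by blast
  hence "(s, w) \<in> (Restr (hasse T) (Field T))\<^sup>*" by (intro rtrancl_of_path)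
  hence "w \<in> S" using s by (induction rule: rtrancl_induct) (use no in blast)+
  thus False using w by blast
qed

lemma monotone_of_covers:
  assumes "\<And>u v. covers T v u \<Longrightarrow> \<phi> u \<subseteq> \<phi> v" "(u, v) \<in> T"
  shows "\<phi> u \<subseteq> \<phi> v"
  using assms(2)
proof (induction "below v" arbitrary: v rule: less_induct)
  case less
  show ?case
  proof (cases "u = v")
    case False
    obtain w where w: "covers T v w" "(u, w) \<in> T" using lower_cover less.prems False by blast
    show ?thesis using less.hyps[OF below_mono[OF coversD[OF w(1)]] w(2)] assms(1)[OF w(1)] by blast
  qed simp
qed

text \<open>
  A vertex next to the part that is already embedded has exactly one neighbour there, because the
  Hasse diagram is a tree. So only one inclusion has to be respected when its image is chosen, and
  there are more candidates than sets used so far. The positions \<open>pos\<close> are fixed in advance and leave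
  room for all later choices.
\<close>

lemma greedy_embedding:
  fixes \<phi> :: "'a \<Rightarrow> 'b set" and pos :: "'a \<Rightarrow> nat"
  assumes pos: "\<And>u v. (u, v) \<in> T \<Longrightarrow> u \<noteq> v \<Longrightarrow> pos u < pos v" "\<And>v. v \<in> Field T \<Longrightarrow> pos v < k"
    and up: "\<And>i i' A. i < i' \<Longrightarrow> i' < k \<Longrightarrow> A \<in> V i \<Longrightarrow> card (Field T) \<le> card {B \<in> V i'. A \<subset> B}"
    and down: "\<And>i i' A. i' < i \<Longrightarrow> i < k \<Longrightarrow> A \<in> V i \<Longrightarrow> card (Field T) \<le> card {B \<in> V i'. B \<subset> A}"
    and S: "S \<subseteq> Field T" "S \<noteq> {}" "connected_in (hasse T) S"
    and \<phi>: "inj_on \<phi> S" "\<And>v. v \<in> S \<Longrightarrow> \<phi> v \<in> V (pos v)" "\<And>u v. u \<in> S \<Longrightarrow> v \<in> S \<Longrightarrow> covers T v u \<Longrightarrow> \<phi> u \<subseteq> \<phi> v"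
  shows "\<exists>\<G>. \<G> \<subseteq> (\<Union>i<k. V i) \<and> weak_copy T \<G> \<and> \<phi> ` S \<subseteq> \<G>"
  using S \<phi>
proof (induction "card (Field T - S)" arbitrary: S \<phi> rule: less_induct)
  case less
  note S = less.prems(1-3) and \<phi> = less.prems(4-6)
  show ?case
  proof (cases "S = Field T")
    case True
    have "\<phi> u \<subseteq> \<phi> v" if "(u, v) \<in> T" for u v
    proof (rule monotone_of_covers[OF _ that])
      fix u v assume "covers T v u"
      thus "\<phi> u \<subseteq> \<phi> v" using \<phi>(3)[of u v] True field coversD by blast
    qed
    hence "weak_copy T (\<phi> ` S)"
      using \<phi>(1) True unfolding weak_copy_def by (metis bij_betw_imageI)
    moreover have "\<phi> ` S \<subseteq> (\<Union>i<k. V i)" using \<phi>(2) pos(2) S(1) by blast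
    ultimately show ?thesis by blast
  next
    case False
    obtain u v where uv: "u \<in> S" "v \<in> Field T" "v \<notin> S" "(u, v) \<in> hasse T"
      using crossing_edge[OF S(1,2) False] by blast
    have only: "w = u" if "w \<in> S" "(v, w) \<in> hasse T" for w
    proof (rule at_most_one_neighbour[OF graph sym_hasse S(1,3)])
      show "(v, u) \<in> hasse T" using uv(4) by (rule symD[OF sym_hasse])
    qed (use that uv in simp_all)
    have "finite S" using S(1) fin by (rule finite_subset)
    have "S \<subset> Field T" using S(1) False by blast
    hence small: "card (\<phi> ` S) < card (Field T)"
      by (meson psubset_card_mono[OF fin] card_image_le[OF \<open>finite S\<close>] le_less_trans)
    have avoid: "\<exists>B\<in>Y. B \<notin> \<phi> ` S" if "card (Field T) \<le> card Y" for Y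
    proof (rule ccontr)
      assume "\<not> ?thesis"
      hence "card Y \<le> card (\<phi> ` S)" using \<open>finite S\<close> by (intro card_mono) auto
      thus False using small that by linarith
    qed
    have "\<exists>B. B \<in> V (pos v) \<and> B \<notin> \<phi> ` S \<and> (covers T v u \<longrightarrow> \<phi> u \<subseteq> B) \<and> (covers T u v \<longrightarrow> B \<subseteq> \<phi> u)"
    proof (cases "covers T v u")
      case True
      hence nc: "\<not> covers T u v" using coversD antisym by blast
      have "pos u < pos v" using pos(1) coversD[OF True] by blast
      hence "card (Field T) \<le> card {B \<in> V (pos v). \<phi> u \<subset> B}" by (rule up[OF _ pos(2)[OF uv(2)] \<phi>(2)[OF uv(1)]])
      from avoid[OF this] show ?thesis using nc by blast
    next
      case nc: False
      hence c: "covers T u v" using uv(4) by (auto simp: hasse_def)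
      have "pos v < pos u" using pos(1) coversD[OF c] by blast
      hence "card (Field T) \<le> card {B \<in> V (pos v). B \<subset> \<phi> u}" using uv(1) S(1) by (intro down[OF _ pos(2) \<phi>(2)[OF uv(1)]]) auto
      from avoid[OF this] show ?thesis using nc by blast
    qed
    then obtain B where B: "B \<in> V (pos v)" "B \<notin> \<phi> ` S" "covers T v u \<Longrightarrow> \<phi> u \<subseteq> B" "covers T u v \<Longrightarrow> B \<subseteq> \<phi> u"
      by blast
    define \<psi> where "\<psi> = \<phi>(v := B)"
    have \<psi>: "\<psi> v = B" "\<And>w. w \<in> S \<Longrightarrow> \<psi> w = \<phi> w" using uv by (auto simp: \<psi>_def)
    have "\<exists>\<G>. \<G> \<subseteq> (\<Union>i<k. V i) \<and> weak_copy T \<G> \<and> \<psi> ` insert v S \<subseteq> \<G>"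
    proof (rule less.hyps)
      have "Field T - insert v S \<subset> Field T - S" using uv by blast
      thus "card (Field T - insert v S) < card (Field T - S)" using fin by (intro psubset_card_mono) auto
      show "insert v S \<subseteq> Field T" "insert v S \<noteq> {}" using S uv by auto
      show "connected_in (hasse T) (insert v S)"
      proof (rule connected_in_star[OF sym_hasse])
        show "u \<in> insert v S" using uv by blast
        fix x assume x: "x \<in> insert v S"
        show "(u, x) \<in> (Restr (hasse T) (insert v S))\<^sup>*"
        proof (cases "x = v")
          case True
          thus ?thesis using uv by (intro r_into_rtrancl) auto
        next
          case False
          hence "(u, x) \<in> (Restr (hasse T) S)\<^sup>*" using x uv S(3) by (auto simp: connected_in_def)
          moreover have "Restr (hasse T) S \<subseteq> Restr (hasse T) (insert v S)" by blast
          ultimately show ?thesis by (meson rtrancl_mono subsetD)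
        qed
      qed
      show "inj_on \<psi> (insert v S)"
      proof -
        have "inj_on \<psi> S" using \<phi>(1) inj_on_cong[of S \<psi> \<phi>] \<psi>(2) by blast
        moreover have "\<psi> ` S = \<phi> ` S" using \<psi>(2) by (rule image_cong[OF HOL.refl])
        ultimately show ?thesis using \<psi>(1) B(2) uv(3) by simp
      qed
      show "\<psi> w \<in> V (pos w)" if "w \<in> insert v S" for w
        using that \<psi> B(1) \<phi>(2) by (metis insertE)
      show "\<psi> x \<subseteq> \<psi> y" if xy: "x \<in> insert v S" "y \<in> insert v S" "covers T y x" for x y
      proof -
        have "x \<noteq> y" using coversD[OF xy(3)] by blast
        consider "x \<in> S" "y \<in> S" | "x = v" "y \<in> S" | "x \<in> S" "y = v" using xy \<open>x \<noteq> y\<close> by blast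
        thus ?thesis
        proof cases
          case 1
          thus ?thesis using \<phi>(3) xy \<psi> by simp
        next
          case 2
          hence "y = u" using only[of y] xy(3) by (auto simp: hasse_def)
          thus ?thesis using 2 B(4) xy(3) \<psi> by simp
        next
          case 3
          hence "x = u" using only[of x] xy(3) by (auto simp: hasse_def)
          thus ?thesis using 3 B(3) xy(3) \<psi> by simp
        qed
      qed
    qed
    moreover have "\<phi> ` S \<subseteq> \<psi> ` insert v S" using \<psi>(2) by force
    ultimately show ?thesis by (meson order_trans)
  qed
qed

end

section \<open>Embedding trees into systems of chains\<close>

text \<open>
  Decreasing \<open>s\<close> to \<open>m\<close> decreases the binomial coefficient.
\<close>

lemma binomial_ge_power:
  fixes n :: nat
  assumes "1 \<le> m" "m \<le> s" "n \<le> 4 * t"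
  shows "real ((s + t) choose t) \<ge> (real n / (4 * real m)) ^ m" "real ((s + t) choose s) \<ge> (real n / (4 * real m)) ^ m"
proof -
  have "(real n / (4 * real m)) ^ m \<le> (real (m + t) / real m) ^ m"
  proof (rule power_mono)
    have "real n \<le> 4 * real t" using assms(3) by linarith
    thus "real n / (4 * real m) \<le> real (m + t) / real m" using assms(1) by (simp add: field_simps)
  qed simp
  also have "\<dots> \<le> real ((m + t) choose m)" by (rule binomial_ge_n_over_k_pow_k) simp
  also have "(m + t) choose m = (m + t) choose t" by (simp add: binomial_symmetric[of m "m + t"])
  also have "real ((m + t) choose t) \<le> real ((s + t) choose t)"
    using assms(2) by (simp add: binomial_right_mono)
  finally show "real ((s + t) choose t) \<ge> (real n / (4 * real m)) ^ m" .
  thus "real ((s + t) choose s) \<ge> (real n / (4 * real m)) ^ m" by (simp add: binomial_symmetric[of s "s + t"])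
qed

text \<open>
  A sum of at least \<open>e\<close> with summands at most \<open>1 / M\<close> has at least \<open>e * M\<close> terms.
\<close>

lemma card_from_sum:
  fixes h :: "'b \<Rightarrow> real"
  assumes "e \<le> (\<Sum>x\<in>D. 1 / h x)" "\<And>x. x \<in> D \<Longrightarrow> h x \<ge> M" "M > 0"
  shows "real (card D) \<ge> e * M"
proof -
  have "(\<Sum>x\<in>D. 1 / h x) \<le> (\<Sum>x\<in>D. 1 / M)"
  proof (intro sum_mono divide_left_mono)
    fix x assume "x \<in> D"
    thus "M \<le> h x" "0 < h x * M" using assms(2)[of x] assms(3) by (auto intro!: mult_pos_pos less_le_trans[OF assms(3)])
  qed simp
  with assms(1) have "e \<le> real (card D) / M" by simp
  thus ?thesis using assms(3) by (simp add: field_simps)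
qed

context chain_system
begin

definition layer :: "nat \<Rightarrow> nat set set" where
  "layer i = (\<lambda>c. c ! i) ` C"

abbreviation members :: "nat set set" where
  "members \<equiv> (\<Union>i<k. layer i)"

definition linked :: "nat \<Rightarrow> nat \<Rightarrow> nat set \<Rightarrow> nat set set" where
  "linked i i' A = (\<lambda>c. c ! i') ` {c \<in> C. c ! i = A}"

lemma nth_balanced: "c \<in> C \<Longrightarrow> i < k \<Longrightarrow> c ! i \<in> balanced n"
  using bal len by (metis nth_mem subsetD)

lemma finite_balanced: "finite (balanced n)"
  by (rule finite_subset[of _ "Pow {1..n}"]) (auto simp: balanced_def)

lemma finite_nth: "c \<in> C \<Longrightarrow> i < k \<Longrightarrow> finite (c ! i)"
  using nth_balanced finite_subset[of "c ! i" "{1..n}"] by (auto simp: balanced_def)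

lemma nth_mono: "c \<in> C \<Longrightarrow> i < i' \<Longrightarrow> i' < k \<Longrightarrow> c ! i \<subset> c ! i'"
  using chain len by (simp add: sorted_wrt_iff_nth_less)

lemma nth_le: "c \<in> C \<Longrightarrow> i \<le> i' \<Longrightarrow> i' < k \<Longrightarrow> c ! i \<subseteq> c ! i'"
  using nth_mono[of c i i'] by (cases "i = i'") auto

lemma card_nth_mono:
  assumes "c \<in> C" "i \<le> i'" "i' < k"
  shows "card (c ! i) + (i' - i) \<le> card (c ! i')"
  using assms(2,3)
proof (induction i' rule: dec_induct)
  case (step j)
  have "card (c ! j) < card (c ! Suc j)"
    using step assms(1) by (intro psubset_card_mono nth_mono finite_nth) auto
  thus ?case using step by simp
qed simp

lemma layer_balanced: "i < k \<Longrightarrow> layer i \<subseteq> balanced n"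
  using nth_balanced by (auto simp: layer_def)

lemma linked_subset: "linked i i' A \<subseteq> layer i'"
  by (auto simp: linked_def layer_def)

lemma linked_sym: "B \<in> linked i i' A \<longleftrightarrow> A \<in> linked i' i B"
  by (auto simp: linked_def)

lemma linked_up: "B \<in> linked i i' A \<Longrightarrow> i < i' \<Longrightarrow> i' < k \<Longrightarrow> A \<subset> B"
  unfolding linked_def using nth_mono by blast

lemma linked_down: "B \<in> linked i i' A \<Longrightarrow> i' < i \<Longrightarrow> i < k \<Longrightarrow> B \<subset> A"
  unfolding linked_def using nth_mono by blast

lemma up_sum': "A \<in> layer i \<Longrightarrow> i < i' \<Longrightarrow> i' < k \<Longrightarrow>
    \<eta> \<le> (\<Sum>B\<in>linked i i' A. 1 / real ((n - card A) choose (card B - card A)))"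
  using up_sum unfolding linked_def layer_def by blast

lemma down_sum': "A \<in> layer i \<Longrightarrow> i' < i \<Longrightarrow> i < k \<Longrightarrow>
    \<eta> \<le> (\<Sum>B\<in>linked i i' A. 1 / real (card A choose card B))"
  using down_sum unfolding linked_def layer_def by blast

text \<open>
  If every step from position \<open>i\<close> to position \<open>i'\<close> adds or removes at least \<open>m\<close> elements, each reached
  set has probability $O(n^{-m})$, so there must be of the order of $n^m$ of them.
\<close>

lemma card_linked:
  assumes "A \<in> layer i" "i < k" "i' < k" "i \<noteq> i'" "1 \<le> m" "n \<ge> 1"
    and "\<And>B. B \<in> linked i i' A \<Longrightarrow> card A + m \<le> card B \<or> card B + m \<le> card A"
  shows "real (card (linked i i' A)) \<ge> \<eta> * (real n / (4 * real m)) ^ m"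
proof -
  have A: "A \<in> balanced n" using assms layer_balanced by blast
  have finA: "finite A" using A finite_subset[of A "{1..n}"] by (auto simp: balanced_def)
  have pos: "(real n / (4 * real m)) ^ m > 0" using assms by (intro zero_less_power divide_pos_pos) auto
  show ?thesis
  proof (cases "i < i'")
    case True
    show ?thesis
    proof (rule card_from_sum[OF up_sum'[OF assms(1) True assms(3)] _ pos])
      fix B assume B: "B \<in> linked i i' A"
      have bB: "B \<in> balanced n" using B linked_subset layer_balanced assms by blast
      hence finB: "finite B" "card B \<le> n"
        using finite_subset[of B "{1..n}"] card_mono[of "{1..n}" B] by (auto simp: balanced_def)
      have "card A \<le> card B" using linked_up[OF B True assms(3)] finB by (intro card_mono) auto
      hence m: "m \<le> card B - card A" using assms(7)[OF B] assms(5) by auto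
      have "n - card A = (card B - card A) + (n - card B)" using \<open>card A \<le> card B\<close> finB by simp
      thus "real ((n - card A) choose (card B - card A)) \<ge> (real n / (4 * real m)) ^ m"
        using binomial_ge_power(2)[OF assms(5) m, of n "n - card B"] bB by (simp add: balanced_def)
    qed
  next
    case False
    hence ii: "i' < i" using assms by simp
    show ?thesis
    proof (rule card_from_sum[OF down_sum'[OF assms(1) ii assms(2)] _ pos])
      fix B assume B: "B \<in> linked i i' A"
      have bB: "B \<in> balanced n" using B linked_subset layer_balanced assms by blast
      have "card B \<le> card A" using linked_down[OF B ii assms(2)] finA by (intro card_mono) auto
      hence m: "m \<le> card A - card B" using assms(7)[OF B] assms(5) by auto
      have "card A = (card A - card B) + card B" using \<open>card B \<le> card A\<close> by simp
      thus "real (card A choose card B) \<ge> (real n / (4 * real m)) ^ m"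
        using binomial_ge_power(1)[OF assms(5) m, of n "card B"] bB by (simp add: balanced_def)
    qed
  qed
qed

lemma card_linked_ge:
  assumes "A \<in> layer i" "i < k" "i' < k" "i \<noteq> i'" "n \<ge> 1"
  shows "real (card (linked i i' A)) \<ge> \<eta> * real n / 4"
proof -
  have "real (card (linked i i' A)) \<ge> \<eta> * (real n / (4 * real (1::nat))) ^ 1"
  proof (rule card_linked[OF assms(1-4) _ assms(5)])
    fix B assume "B \<in> linked i i' A"
    then obtain c where c: "c \<in> C" "c ! i = A" "c ! i' = B" by (auto simp: linked_def)
    show "card A + 1 \<le> card B \<or> card B + 1 \<le> card A"
      using card_nth_mono[of c i i'] card_nth_mono[of c i' i] c assms by (cases "i < i'") auto
  qed simp
  thus ?thesis by simp
qed

lemma embed: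
  fixes T :: "('a \<times> 'a) set"
  assumes T: "tree_poset T" and big: "\<eta> * real n / 4 \<ge> real (card (Field T))"
    and pos: "\<And>u v. (u, v) \<in> T \<Longrightarrow> u \<noteq> v \<Longrightarrow> pos u < pos v" "\<And>v. v \<in> Field T \<Longrightarrow> pos v < k"
    and S: "S \<subseteq> Field T" "S \<noteq> {}" "connected_in (hasse T) S"
    and \<phi>: "inj_on \<phi> S" "\<And>v. v \<in> S \<Longrightarrow> \<phi> v \<in> layer (pos v)" "\<And>u v. u \<in> S \<Longrightarrow> v \<in> S \<Longrightarrow> covers T v u \<Longrightarrow> \<phi> u \<subseteq> \<phi> v"
  shows "\<exists>\<G>. \<G> \<subseteq> members \<and> weak_copy T \<G> \<and> \<phi> ` S \<subseteq> \<G>"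
proof -
  interpret tree T by unfold_locales (rule T)
  have "card (Field T) > 0" using field_nonempty fin by (simp add: card_gt_0_iff) 
  hence "real (card (Field T)) > 0" by simp
  hence n1: "n \<ge> 1" using big by (cases n) auto
  show ?thesis
  proof (rule greedy_embedding[OF pos _ _ S \<phi>])
    fix i i' A assume i: "i < i'" "i' < k" "A \<in> layer i"
    have "card (linked i i' A) \<le> card {B \<in> layer i'. A \<subset> B}"
    proof (rule card_mono)
      show "finite {B \<in> layer i'. A \<subset> B}" using layer_balanced[OF i(2)] finite_balanced by (simp add: finite_subset)
    qed (use linked_up linked_subset i in blast)
    moreover have "real (card (Field T)) \<le> real (card (linked i i' A))"
      using card_linked_ge[of A i i'] i n1 big by simp
    ultimately show "card (Field T) \<le> card {B \<in> layer i'. A \<subset> B}" by linarith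
  next
    fix i i' A assume i: "i' < i" "i < k" "A \<in> layer i"
    have "card (linked i i' A) \<le> card {B \<in> layer i'. B \<subset> A}"
    proof (rule card_mono)
      have "i' < k" using i by simp
      thus "finite {B \<in> layer i'. B \<subset> A}" using layer_balanced[of i'] finite_balanced by (simp add: finite_subset)
    qed (use linked_down linked_subset i in blast)
    moreover have "real (card (Field T)) \<le> real (card (linked i i' A))"
      using card_linked_ge[of A i i'] i n1 big by simp
    ultimately show "card (Field T) \<le> card {B \<in> layer i'. B \<subset> A}" by linarith
  qed
qed

end

text \<open>
  Unbalanced sets may be discarded, and every set has Lubell weight at least the reciprocal of the
  central binomial coefficient.
\<close>

lemma exists_chain_system:
  fixes \<epsilon> :: real
  assumes "k \<ge> 1" "q \<ge> 1" "\<epsilon> > 0"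
  shows "\<exists>\<eta>>0. \<forall>\<^sub>F n in sequentially. \<forall>F (g :: nat set list \<Rightarrow> nat). F \<subseteq> Pow {1..n} \<longrightarrow>
     real (card F) \<ge> (real k - 1 + \<epsilon>) * central n \<longrightarrow> (\<forall>c. g c < q) \<longrightarrow>
     (\<exists>C \<sigma>. chain_system n k \<eta> C \<and> (\<forall>c\<in>C. set c \<subseteq> F \<and> g c = \<sigma>))"
proof -
  have "\<epsilon> / 2 > 0" using assms by simp
  from exists_chain_system_lubell[OF assms(1,2) this] show ?thesis
  proof (elim exE conjE, goal_cases)
    case (1 \<eta>)
    note \<eta> = 1(1) and cs = 1(2)[THEN spec, THEN spec, THEN spec, THEN mp, THEN mp, THEN mp]
    have "\<forall>\<^sub>F n in sequentially. real (card (Pow {1..n} - balanced n)) \<le> \<epsilon> / 2 * central n"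
      by (rule unbalanced_small) (use assms in simp)
    thus ?thesis
    proof (intro exI[of _ \<eta>] conjI \<eta>, eventually_elim, intro allI impI)
      fix n F and g :: "nat set list \<Rightarrow> nat"
      assume small: "real (card (Pow {1..n} - balanced n)) \<le> \<epsilon> / 2 * central n"
        and F: "F \<subseteq> Pow {1..n}" and big: "real (card F) \<ge> (real k - 1 + \<epsilon>) * central n" and g: "\<forall>c. g c < q"
      define F' where "F' = F \<inter> balanced n"
      have F': "F' \<subseteq> Pow {1..n}" "F' \<subseteq> balanced n" "F' \<subseteq> F" using F by (auto simp: F'_def)
      have finF: "finite F" using F by (rule finite_subset) simp
      have "card F \<le> card (F' \<union> (Pow {1..n} - balanced n))"
        using F finF by (intro card_mono) (auto simp: F'_def)
      also have "\<dots> \<le> card F' + card (Pow {1..n} - balanced n)" by (rule card_Un_le)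
      finally have "(real k - 1 + \<epsilon>) * central n \<le> real (card F') + \<epsilon> / 2 * central n"
        using big small by linarith
      hence c: "(real k - 1 + \<epsilon> / 2) * central n \<le> real (card F')" by (simp add: algebra_simps)
      have "real (card F') * (1 / central n) = (\<Sum>A\<in>F'. 1 / central n)" by simp
      also have "\<dots> \<le> lubell n F'" unfolding lubell_def
      proof (rule sum_mono)
        fix A assume "A \<in> F'"
        hence "card A \<le> n" using F'(1) card_mono[of "{1..n}" A] by auto
        thus "1 / central n \<le> 1 / real (n choose card A)"
          using binomial_maximum[of n "card A"] by (intro divide_left_mono) (auto simp: central_def)
      qed
      finally have "real (card F') / central n \<le> lubell n F'" by simp
      moreover have "real k - 1 + \<epsilon> / 2 \<le> real (card F') / central n"
        using c central_pos[of n] by (simp only: pos_le_divide_eq)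
      ultimately have "lubell n F' \<ge> real k - 1 + \<epsilon> / 2" by linarith
      from cs[OF F'(2) this, of g, OF g] obtain C \<sigma> where C: "chain_system n k \<eta> C" "\<forall>c\<in>C. set c \<subseteq> F' \<and> g c = \<sigma>"
        by (elim exE conjE)
      have "\<forall>c\<in>C. set c \<subseteq> F \<and> g c = \<sigma>" using C(2) F'(3) by (meson order_trans)
      thus "\<exists>C \<sigma>. chain_system n k \<eta> C \<and> (\<forall>c\<in>C. set c \<subseteq> F \<and> g c = \<sigma>)" using C(1) by (intro exI conjI)
    qed
  qed
qed

section \<open>From cliques to the exponent\<close>

definition copy_clique :: "('a \<times> 'a) set \<Rightarrow> 'b set set \<Rightarrow> 'b set set \<Rightarrow> bool" where
  "copy_clique T F S \<longleftrightarrow> S \<subseteq> F \<and>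
     (\<forall>A\<in>S. \<forall>B\<in>S. A \<noteq> B \<longrightarrow> (\<exists>\<G>. \<G> \<subseteq> F \<and> weak_copy T \<G> \<and> A \<in> \<G> \<and> B \<in> \<G>))"

lemma copy_clique_mono: "copy_clique T F S \<Longrightarrow> F \<subseteq> F' \<Longrightarrow> copy_clique T F' S"
  unfolding copy_clique_def by (meson order_trans)

text \<open>
  The common core of the lower bound for \<open>ar_m\<close> and of the lower bound for the chromatic number:
  every family of the relevant density contains a clique of the copy graph of order \<open>n ^ e\<close>.
\<close>

definition clique_bound :: "('a \<times> 'a) set \<Rightarrow> nat \<Rightarrow> nat \<Rightarrow> bool" where
  "clique_bound T k e \<longleftrightarrow> (\<forall>\<epsilon>>0. \<exists>\<delta>>0. \<forall>\<^sub>F n in sequentially. \<forall>F\<subseteq>Pow {1..n}.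
     real (card F) \<ge> (real k - 1 + \<epsilon>) * central n \<longrightarrow>
     (\<exists>S. copy_clique T F S \<and> real (card S) \<ge> \<delta> * real n ^ e))"

text \<open>
  The condition that makes \<open>n ^ e\<close> an upper bound for the order of the chromatic number: two sets of
  equal size in a copy of \<open>T\<close> differ by exchanging at most \<open>e\<close> elements.
\<close>

definition copies_near :: "('a \<times> 'a) set \<Rightarrow> nat \<Rightarrow> nat \<Rightarrow> bool" where
  "copies_near T k e \<longleftrightarrow> (\<forall>n \<G> A B. \<G> \<subseteq> middle_layers n k \<longrightarrow> weak_copy T \<G> \<longrightarrow> A \<in> \<G> \<longrightarrow> B \<in> \<G> \<longrightarrow> A \<noteq> B \<longrightarrow>
     card A = card B \<longrightarrow> card (A - B) \<le> e)"

lemma copy_clique_colors: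
  assumes "copy_clique T F S" "finite F" "col ` F \<subseteq> {1..c}"
    and "\<And>A B. A \<noteq> B \<Longrightarrow> (\<exists>\<G>. \<G> \<subseteq> F \<and> weak_copy T \<G> \<and> A \<in> \<G> \<and> B \<in> \<G>) \<Longrightarrow> col A \<noteq> col B"
  shows "card S \<le> c"
proof -
  have S: "S \<subseteq> F" using assms(1) by (simp add: copy_clique_def)
  have "inj_on col S"
    using assms(1,4) unfolding copy_clique_def inj_on_def by metis
  hence "card S = card (col ` S)" by (simp add: card_image)
  also have "\<dots> \<le> card {1..c}" using assms(3) S by (intro card_mono) auto
  finally show ?thesis by simp
qed

lemma chromatic_number_le:
  assumes "f ` V \<subseteq> {1..c}" "\<And>x y. x \<in> V \<Longrightarrow> y \<in> V \<Longrightarrow> (x, y) \<in> E \<Longrightarrow> f x \<noteq> f y"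
  shows "chromatic_number V E \<le> c"
  unfolding chromatic_number_def by (rule Least_le) (intro exI[of _ f] conjI ballI impI assms)

lemma chromatic_number_coloring:
  assumes "finite V" "\<And>x. (x, x) \<notin> E"
  shows "\<exists>f. f ` V \<subseteq> {1..chromatic_number V E} \<and> (\<forall>x\<in>V. \<forall>y\<in>V. (x, y) \<in> E \<longrightarrow> f x \<noteq> f y)"
  unfolding chromatic_number_def
proof (rule LeastI_ex)
  obtain h where h: "bij_betw h V {1..card V}"
    using ex_bij_betw_nat_finite_1[OF assms(1)] bij_betw_inv by blast
  have h1: "h x \<noteq> h y" if "x \<in> V" "y \<in> V" "(x, y) \<in> E" for x y
    using h that assms(2) by (metis bij_betw_imp_inj_on inj_onD)
  have h2: "h ` V \<subseteq> {1..card V}" using h by (simp add: bij_betw_def)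
  show "\<exists>(c :: nat) f. f ` V \<subseteq> {1..c} \<and> (\<forall>x\<in>V. \<forall>y\<in>V. (x, y) \<in> E \<longrightarrow> f x \<noteq> f y)"
    by (intro exI[of _ "card V"] exI[of _ h] conjI ballI impI h1 h2)
qed

lemma finite_middle_layers: "finite (middle_layers n k)"
  using middle_layers_subset by (rule finite_subset) simp

text \<open>
  Color a set by its layer together with its color in a coloring that separates close sets. Adjacent
  sets of one layer are close by hypothesis.
\<close>

lemma chromatic_upper:
  assumes near: "copies_near T k e" and n: "n \<ge> 1"
  shows "chromatic_number (middle_layers n k) (copy_graph T (middle_layers n k)) \<le> k * (2 * n) ^ e"
proof -
  obtain col :: "nat set \<Rightarrow> nat" where col: "\<And>A. A \<subseteq> {1..n} \<Longrightarrow> col A < (2 * n) ^ e"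
    "\<And>A B. A \<subseteq> {1..n} \<Longrightarrow> B \<subseteq> {1..n} \<Longrightarrow> A \<noteq> B \<Longrightarrow> card A = card B \<Longrightarrow> card (A - B) \<le> e \<Longrightarrow> col A \<noteq> col B"
    using distance_coloring[OF n, of e] by metis
  define N where "N = (2 * n) ^ e"
  define lev where "lev A = nat (int (card A) - (int n - int k) div 2 - 1)" for A :: "nat set"
  have lev: "lev A < k" "int (card A) = (int n - int k) div 2 + 1 + int (lev A)" if "A \<in> middle_layers n k" for A
    using that by (auto simp: middle_layers_def lev_def)
  define f where "f A = lev A * N + col A + 1" for A
  show ?thesis
  proof (rule chromatic_number_le[of f])
    show "f ` middle_layers n k \<subseteq> {1..k * (2 * n) ^ e}"
    proof
      fix c assume "c \<in> f ` middle_layers n k"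
      then obtain A where A: "A \<in> middle_layers n k" "c = f A" by blast
      have "col A + 1 \<le> N" using col(1)[of A] A middle_layers_subset[of n k] by (auto simp: N_def)
      moreover have "lev A * N + N \<le> k * N"
        using lev(1)[OF A(1)] by (metis Suc_leI add.commute mult_Suc mult_le_mono1)
      ultimately show "c \<in> {1..k * (2 * n) ^ e}" unfolding A(2) f_def N_def[symmetric] by simp
    qed
  next
    fix A B assume A: "A \<in> middle_layers n k" and B: "B \<in> middle_layers n k"
      and adj: "(A, B) \<in> copy_graph T (middle_layers n k)"
    have AB: "A \<subseteq> {1..n}" "B \<subseteq> {1..n}" using A B middle_layers_subset by blast+
    show "f A \<noteq> f B"
    proof
      assume "f A = f B"
      hence eq: "lev A * N + col A = lev B * N + col B" by (simp add: f_def)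
      have lt: "col A < N" "col B < N" using col(1) AB by (simp_all add: N_def)
      have "lev A = (lev A * N + col A) div N" "lev B = (lev B * N + col B) div N" using lt by simp_all
      hence l: "lev A = lev B" using eq by simp
      hence "col A = col B" using eq by simp
      have "card A = card B" using lev(2)[OF A] lev(2)[OF B] l by simp
      moreover obtain \<G> where "\<G> \<subseteq> middle_layers n k" "weak_copy T \<G>" "A \<in> \<G>" "B \<in> \<G>" "A \<noteq> B"
        using adj by (auto simp: copy_graph_def)
      ultimately show False using near[unfolded copies_near_def, rule_format, of \<G> n A B] col(2)[OF AB] \<open>col A = col B\<close> by blast
    qed
  qed
qed

text \<open>
  The middle layers themselves form a family of density nearly \<open>k\<close>, so the clique bound applies with
  \<open>\<epsilon> = 1 / 2\<close>.
\<close>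

lemma clique_bound_chromatic:
  assumes "clique_bound T k e"
  shows "\<exists>\<delta>>0. \<forall>\<^sub>F n in sequentially.
     real (chromatic_number (middle_layers n k) (copy_graph T (middle_layers n k))) \<ge> \<delta> * real n ^ e"
proof -
  obtain \<delta> where \<delta>: "\<delta> > 0" "\<forall>\<^sub>F n in sequentially. \<forall>F\<subseteq>Pow {1..n}.
     real (card F) \<ge> (real k - 1 + 1/2) * central n \<longrightarrow>
     (\<exists>S. copy_clique T F S \<and> real (card S) \<ge> \<delta> * real n ^ e)"
  proof -
    have "(1 / 2 :: real) > 0" by simp
    from assms[unfolded clique_bound_def, THEN spec, THEN mp, OF this] show ?thesis using that by blast
  qed
  have "\<forall>\<^sub>F n in sequentially. real (card (middle_layers n k)) \<ge> (real k - 1/2) * central n"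
    by (rule card_middle_layers) simp
  with \<delta>(2) have "\<forall>\<^sub>F n in sequentially.
     real (chromatic_number (middle_layers n k) (copy_graph T (middle_layers n k))) \<ge> \<delta> * real n ^ e"
  proof eventually_elim
    case (elim n)
    let ?M = "middle_layers n k"
    have "(real k - 1 + 1/2) * central n \<le> real (card ?M)" using elim(2) by simp
    then obtain S where S: "copy_clique T ?M S" "real (card S) \<ge> \<delta> * real n ^ e"
      using elim(1) middle_layers_subset by blast
    have irr: "(A, A) \<notin> copy_graph T ?M" for A by (simp add: copy_graph_def)
    obtain f where ff: "f ` ?M \<subseteq> {1..chromatic_number ?M (copy_graph T ?M)} \<and>
      (\<forall>x\<in>?M. \<forall>y\<in>?M. (x, y) \<in> copy_graph T ?M \<longrightarrow> f x \<noteq> f y)"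
      using chromatic_number_coloring[OF finite_middle_layers[of n k] irr] by (elim exE)
    note f = conjunct1[OF ff] conjunct2[OF ff, rule_format]
    have "card S \<le> chromatic_number ?M (copy_graph T ?M)"
    proof (rule copy_clique_colors[OF S(1) finite_middle_layers f(1)])
      fix A B assume "A \<noteq> B" "\<exists>\<G>\<subseteq>?M. weak_copy T \<G> \<and> A \<in> \<G> \<and> B \<in> \<G>"
      then obtain \<G> where "\<G> \<subseteq> ?M" "weak_copy T \<G>" "A \<in> \<G>" "B \<in> \<G>" by (elim exE conjE)
      moreover from this have "A \<in> ?M" "B \<in> ?M" by (simp_all only: subsetD)
      moreover from calculation \<open>A \<noteq> B\<close> have "(A, B) \<in> copy_graph T ?M"
        unfolding copy_graph_def mem_Collect_eq prod.case by (intro conjI exI[of _ \<G>])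
      ultimately show "f A \<noteq> f B" by (intro f(2))
    qed
    thus ?case using S(2) by linarith
  qed
  thus ?thesis using \<delta>(1) by blast
qed

lemma m_exponent_eq:
  assumes near: "copies_near T k e"
    and bound: "clique_bound T k e"
  shows "m_exponent T k = e"
proof -
  define \<chi> where "\<chi> n = real (chromatic_number (middle_layers n k) (copy_graph T (middle_layers n k)))" for n
  have up: "\<chi> \<in> O(\<lambda>n. real n ^ e)"
  proof (rule bigoI[of _ "real k * 2 ^ e"])
    have "\<forall>\<^sub>F n in sequentially. n \<ge> (1::nat)" by (rule eventually_ge_at_top)
    thus "\<forall>\<^sub>F n in sequentially. norm (\<chi> n) \<le> real k * 2 ^ e * norm (real n ^ e)"
    proof eventually_elim
      case (elim n)
      have "real (chromatic_number (middle_layers n k) (copy_graph T (middle_layers n k))) \<le> real (k * (2 * n) ^ e)"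
        by (intro of_nat_mono chromatic_upper near elim)
      also have "\<dots> = real k * 2 ^ e * real n ^ e" by (simp add: power_mult_distrib)
      finally show ?case by (simp add: \<chi>_def)
    qed
  qed
  obtain \<delta> where \<delta>: "\<delta> > 0" "\<forall>\<^sub>F n in sequentially. \<chi> n \<ge> \<delta> * real n ^ e"
    using clique_bound_chromatic[OF bound] unfolding \<chi>_def by blast
  have low: "\<chi> \<in> \<Omega>(\<lambda>n. real n ^ e)"
  proof (rule landau_omega.bigI[OF \<delta>(1)])
    show "\<forall>\<^sub>F n in sequentially. norm (\<chi> n) \<ge> \<delta> * norm (real n ^ e)"
      using \<delta>(2) by eventually_elim (simp add: \<chi>_def)
  qed
  have \<Theta>: "\<chi> \<in> \<Theta>(\<lambda>n. real n ^ e)" using up low by (simp add: bigtheta_def)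
  show ?thesis unfolding m_exponent_def \<chi>_def[symmetric]
  proof (rule the_equality)
    show "\<chi> \<in> \<Theta>(\<lambda>n. real n ^ e)" by (rule \<Theta>)
  next
    fix e' assume "\<chi> \<in> \<Theta>(\<lambda>n. real n ^ e')"
    hence "(\<lambda>n. real n ^ e') \<in> \<Theta>(\<lambda>n. real n ^ e)"
      by (intro landau_theta.trans[OF _ \<Theta>]) (simp add: bigtheta_sym)
    moreover have pw: "(\<lambda>n. real n ^ d) \<in> \<Theta>(\<lambda>n. real n powr real d)" for d
    proof (rule bigthetaI_cong)
      show "\<forall>\<^sub>F n in sequentially. real n ^ d = real n powr real d"
        using eventually_gt_at_top[of "0 :: nat"] by eventually_elim (simp add: powr_realpow)
    qed
    ultimately have "(\<lambda>n. real n powr real e') \<in> \<Theta>(\<lambda>n. real n powr real e)"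
      using landau_theta.trans[OF landau_theta.trans[OF iffD1[OF bigtheta_sym pw]] pw] by blast
    thus "e' = e"
      by (simp add: powr_bigtheta_iff filterlim_real_sequentially)
  qed
qed

text \<open>
  A rainbow coloring is injective on a clique. Since the central binomial coefficient is of smaller
  order than $2^n$, families of the prescribed size exist for large \<open>n\<close>, so that the least number of
  colors is attained by some coloring.
\<close>

lemma ar_m_lower:
  fixes \<epsilon> :: real
  assumes near: "copies_near T k e"
    and bound: "clique_bound T k e" and \<epsilon>: "\<epsilon> > 0"
  shows "\<exists>\<delta>>0. \<forall>\<^sub>F n in sequentially.
     real (ar_m n (nat \<lceil>(real k - 1 + \<epsilon>) * real (n choose (n div 2))\<rceil>) T) \<ge> \<delta> * real n ^ m_exponent T k"
proof -
  have m: "m_exponent T k = e" using near bound by (rule m_exponent_eq)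
  obtain \<delta> where \<delta>: "\<delta> > 0" "\<forall>\<^sub>F n in sequentially. \<forall>F\<subseteq>Pow {1..n}.
     real (card F) \<ge> (real k - 1 + \<epsilon>) * central n \<longrightarrow>
     (\<exists>S. copy_clique T F S \<and> real (card S) \<ge> \<delta> * real n ^ e)"
    using bound \<epsilon> unfolding clique_bound_def by blast
  have "\<forall>\<^sub>F n in sequentially. (real k + \<epsilon>) * central n \<le> 2 ^ n" by (rule central_small)
  with \<delta>(2) have "\<forall>\<^sub>F n in sequentially.
     real (ar_m n (nat \<lceil>(real k - 1 + \<epsilon>) * real (n choose (n div 2))\<rceil>) T) \<ge> \<delta> * real n ^ e"
  proof eventually_elim
    case (elim n)
    define m where "m = nat \<lceil>(real k - 1 + \<epsilon>) * central n\<rceil>"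
    have m_ge: "real m \<ge> (real k - 1 + \<epsilon>) * central n" unfolding m_def by linarith
    have "(real k - 1 + \<epsilon>) * central n + central n \<le> 2 ^ n" using elim(2) by (simp add: algebra_simps)
    moreover have "n choose (n div 2) \<ge> 1" using zero_less_binomial[of "n div 2" n] by linarith
    hence "central n \<ge> 1" unfolding central_def by simp
    moreover have "2 ^ n \<ge> (1::real)" by simp
    ultimately have "real m \<le> 2 ^ n"
      unfolding m_def by (cases "(real k - 1 + \<epsilon>) * central n \<ge> 0") linarith+
    hence "real m \<le> real (2 ^ n)" by simp
    hence "m \<le> card (Pow {1..n})" unfolding of_nat_le_iff by (simp add: card_Pow)
    \<comment> \<open>some family of size \<open>m\<close> with all colors different shows that the minimum exists\<close>
    then obtain F0 where F0: "F0 \<subseteq> Pow {1..n}" "card F0 = m" "finite F0"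
      using obtain_subset_with_card_n by metis
    obtain h where h: "bij_betw h F0 {1..m}"
      using ex_bij_betw_nat_finite_1[OF F0(3)] F0(2) bij_betw_inv by blast
    have "\<exists>(F :: nat set set) (col :: nat set \<Rightarrow> nat).
        F \<subseteq> Pow {1..n} \<and> card F = m \<and> col ` F \<subseteq> {1..m} \<and>
        (\<forall>\<G>. \<G> \<subseteq> F \<and> weak_copy T \<G> \<longrightarrow> inj_on col \<G>)"
      using F0 h by (intro exI[of _ F0] exI[of _ h]) (auto simp: bij_betw_def intro: inj_on_subset)
    hence "\<exists>(F :: nat set set) (col :: nat set \<Rightarrow> nat).
        F \<subseteq> Pow {1..n} \<and> card F = m \<and> col ` F \<subseteq> {1..ar_m n m T} \<and>
        (\<forall>\<G>. \<G> \<subseteq> F \<and> weak_copy T \<G> \<longrightarrow> inj_on col \<G>)"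
      unfolding ar_m_def by (rule LeastI)
    then obtain F :: "nat set set" and col :: "nat set \<Rightarrow> nat" where FF: "F \<subseteq> Pow {1..n} \<and> card F = m \<and>
      col ` F \<subseteq> {1..ar_m n m T} \<and> (\<forall>\<G>. \<G> \<subseteq> F \<and> weak_copy T \<G> \<longrightarrow> inj_on col \<G>)" by (elim exE)
    hence F: "F \<subseteq> Pow {1..n}" "card F = m" "col ` F \<subseteq> {1..ar_m n m T}"
      "\<And>\<G>. \<G> \<subseteq> F \<Longrightarrow> weak_copy T \<G> \<Longrightarrow> inj_on col \<G>" by simp_all
    have "finite F" using F(1) by (rule finite_subset) simp
    obtain S where S: "copy_clique T F S" "real (card S) \<ge> \<delta> * real n ^ e"
      using elim(1) F(1,2) m_ge by blast
    have "card S \<le> ar_m n m T"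
    proof (rule copy_clique_colors[OF S(1) \<open>finite F\<close> F(3)])
      fix A B assume "A \<noteq> B" "\<exists>\<G>\<subseteq>F. weak_copy T \<G> \<and> A \<in> \<G> \<and> B \<in> \<G>"
      thus "col A \<noteq> col B" using F(4) by (meson inj_onD)
    qed
    thus ?case using S(2) unfolding m_def central_def by linarith
  qed
  thus ?thesis using \<delta>(1) unfolding m by blast
qed

text \<open>
  It is enough to find large cliques inside systems of chains. The function \<open>g\<close> sorts chains into
  finitely many classes, of which the system may be assumed to use only one.
\<close>

lemma clique_boundI:
  fixes g :: "nat set list \<Rightarrow> nat" and \<delta> :: "real \<Rightarrow> real"
  assumes "k \<ge> 1" "\<And>c. g c < q" and \<delta>: "\<And>\<eta>. \<eta> > 0 \<Longrightarrow> \<delta> \<eta> > 0"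
    and main: "\<And>\<eta>. \<eta> > 0 \<Longrightarrow> \<forall>\<^sub>F n in sequentially. \<forall>C \<sigma>. chain_system n k \<eta> C \<longrightarrow> (\<forall>c\<in>C. g c = \<sigma>) \<longrightarrow>
      (\<exists>S. copy_clique T (\<Union>i<k. chain_system.layer C i) S \<and> real (card S) \<ge> \<delta> \<eta> * real n ^ e)"
  shows "clique_bound T k e"
  unfolding clique_bound_def
proof (intro allI impI)
  fix \<epsilon> :: real assume \<epsilon>: "\<epsilon> > 0"
  have "q \<ge> 1" using assms(2)[of "[]"] by simp
  from exists_chain_system[OF assms(1) this \<epsilon>] obtain \<eta> where \<eta>: "\<eta> > 0"
    and sys: "\<forall>\<^sub>F n in sequentially. \<forall>F (g :: nat set list \<Rightarrow> nat). F \<subseteq> Pow {1..n} \<longrightarrow>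
     real (card F) \<ge> (real k - 1 + \<epsilon>) * central n \<longrightarrow> (\<forall>c. g c < q) \<longrightarrow>
     (\<exists>C \<sigma>. chain_system n k \<eta> C \<and> (\<forall>c\<in>C. set c \<subseteq> F \<and> g c = \<sigma>))" by (elim exE conjE)
  from main[OF \<eta>] sys have "\<forall>\<^sub>F n in sequentially. \<forall>F\<subseteq>Pow {1..n}.
     real (card F) \<ge> (real k - 1 + \<epsilon>) * central n \<longrightarrow>
     (\<exists>S. copy_clique T F S \<and> real (card S) \<ge> \<delta> \<eta> * real n ^ e)"
  proof (eventually_elim, intro allI impI)
    fix n and F :: "nat set set"
    assume cl: "\<forall>C \<sigma>. chain_system n k \<eta> C \<longrightarrow> (\<forall>c\<in>C. g c = \<sigma>) \<longrightarrow>
        (\<exists>S. copy_clique T (\<Union>i<k. chain_system.layer C i) S \<and> real (card S) \<ge> \<delta> \<eta> * real n ^ e)"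
      and cs: "\<forall>F (g :: nat set list \<Rightarrow> nat). F \<subseteq> Pow {1..n} \<longrightarrow>
        real (card F) \<ge> (real k - 1 + \<epsilon>) * central n \<longrightarrow> (\<forall>c. g c < q) \<longrightarrow>
        (\<exists>C \<sigma>. chain_system n k \<eta> C \<and> (\<forall>c\<in>C. set c \<subseteq> F \<and> g c = \<sigma>))"
      and F: "F \<subseteq> Pow {1..n}" "real (card F) \<ge> (real k - 1 + \<epsilon>) * central n"
    from cs[rule_format, OF F, of g, OF assms(2)] obtain C \<sigma> where C: "chain_system n k \<eta> C"
      "\<forall>c\<in>C. set c \<subseteq> F \<and> g c = \<sigma>" by (elim exE conjE)
    interpret chain_system n k \<eta> C by (rule C(1))
    have "\<forall>c\<in>C. g c = \<sigma>" using C(2) by simp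
    from cl[THEN spec, THEN spec, THEN mp, THEN mp, OF C(1) this] obtain S where S: "copy_clique T members S" "real (card S) \<ge> \<delta> \<eta> * real n ^ e"
      by (elim exE conjE)
    have "members \<subseteq> F"
    proof
      fix A assume "A \<in> members"
      then obtain i c where "i < k" "c \<in> C" "A = c ! i" by (auto simp: layer_def)
      moreover from this have "A \<in> set c" using len[of c] nth_mem[of i c] by simp
      ultimately show "A \<in> F" using C(2) by blast
    qed
    hence "copy_clique T F S" using S(1) by (rule copy_clique_mono[rotated])
    thus "\<exists>S. copy_clique T F S \<and> real (card S) \<ge> \<delta> \<eta> * real n ^ e" using S(2) by (intro exI conjI)
  qed
  thus "\<exists>\<delta>>0. \<forall>\<^sub>F n in sequentially. \<forall>F\<subseteq>Pow {1..n}.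
     real (card F) \<ge> (real k - 1 + \<epsilon>) * central n \<longrightarrow>
     (\<exists>S. copy_clique T F S \<and> real (card S) \<ge> \<delta> * real n ^ e)" using \<delta>[OF \<eta>] by (intro exI[of _ "\<delta> \<eta>"] conjI)
qed

text \<open>
  A single set is a clique.
\<close>

lemma clique_bound_zero: "k \<ge> 1 \<Longrightarrow> clique_bound T k 0"
  unfolding clique_bound_def
proof (intro allI impI exI[of _ 1] conjI always_eventually)
  fix \<epsilon> :: real and n and F :: "nat set set" assume "0 < \<epsilon>" "k \<ge> 1" "F \<subseteq> Pow {1..n}" "real (card F) \<ge> (real k - 1 + \<epsilon>) * central n"
  moreover from this have "(real k - 1 + \<epsilon>) * central n > 0"
    using central_pos[of n] by (intro mult_pos_pos) auto
  ultimately have "card F \<noteq> 0" by (intro notI) simp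
  then obtain A where "A \<in> F" by (cases "F = {}") auto
  thus "\<exists>S. copy_clique T F S \<and> real (card S) \<ge> 1 * real n ^ 0"
    by (intro exI[of _ "{A}"]) (auto simp: copy_clique_def)
qed simp

lemma weak_copy_complement:
  assumes "weak_copy (T\<inverse>) \<G>" "\<G> \<subseteq> Pow N"
  shows "weak_copy T ((\<lambda>A. N - A) ` \<G>)"
proof -
  obtain \<iota> where \<iota>: "bij_betw \<iota> (Field (T\<inverse>)) \<G>" "\<And>p q. (p, q) \<in> T\<inverse> \<Longrightarrow> \<iota> p \<subseteq> \<iota> q"
    using assms(1) by (auto simp: weak_copy_def)
  have "inj_on (\<lambda>A. N - A) \<G>" using assms(2) by (auto simp: inj_on_def)
  hence "bij_betw (\<lambda>A. N - A) \<G> ((\<lambda>A. N - A) ` \<G>)" by (rule inj_on_imp_bij_betw)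
  hence "bij_betw ((\<lambda>A. N - A) \<circ> \<iota>) (Field T) ((\<lambda>A. N - A) ` \<G>)"
    using bij_betw_trans[OF \<iota>(1)] by simp
  moreover have "((\<lambda>A. N - A) \<circ> \<iota>) p \<subseteq> ((\<lambda>A. N - A) \<circ> \<iota>) q" if "(p, q) \<in> T" for p q
    using \<iota>(2)[of q p] that by auto
  ultimately show ?thesis unfolding weak_copy_def by (intro exI[of _ "(\<lambda>A. N - A) \<circ> \<iota>"]) simp
qed

text \<open>
  Complementation reverses inclusions and preserves sizes of families.
\<close>

lemma clique_bound_dual:
  assumes "clique_bound (T\<inverse>) k e"
  shows "clique_bound T k e"
  unfolding clique_bound_def
proof (intro allI impI)
  fix \<epsilon> :: real assume "\<epsilon> > 0"
  then obtain \<delta> where \<delta>: "\<delta> > 0" "\<forall>\<^sub>F n in sequentially. \<forall>F\<subseteq>Pow {1..n}.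
     real (card F) \<ge> (real k - 1 + \<epsilon>) * central n \<longrightarrow>
     (\<exists>S. copy_clique (T\<inverse>) F S \<and> real (card S) \<ge> \<delta> * real n ^ e)"
    using assms unfolding clique_bound_def by blast
  from \<delta>(2) have "\<forall>\<^sub>F n in sequentially. \<forall>F\<subseteq>Pow {1..n}.
     real (card F) \<ge> (real k - 1 + \<epsilon>) * central n \<longrightarrow>
     (\<exists>S. copy_clique T F S \<and> real (card S) \<ge> \<delta> * real n ^ e)"
  proof (eventually_elim, intro allI impI)
    fix n F
    assume dual: "\<forall>F\<subseteq>Pow {1..n}. (real k - 1 + \<epsilon>) * central n \<le> real (card F) \<longrightarrow>
             (\<exists>S. copy_clique (T\<inverse>) F S \<and> \<delta> * real n ^ e \<le> real (card S))"
      and F: "F \<subseteq> Pow {1..n}" and big: "(real k - 1 + \<epsilon>) * central n \<le> real (card F)"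
    define c where "c = (\<lambda>A :: nat set. {1..n} - A)"
    have cc: "c (c A) = A" if "A \<subseteq> {1..n}" for A using that by (auto simp: c_def)
    have inj: "inj_on c Y" if "Y \<subseteq> Pow {1..n}" for Y
      using that by (intro inj_on_inverseI[of _ c] cc) blast
    have img: "c ` c ` Y = Y" if "Y \<subseteq> Pow {1..n}" for Y
    proof -
      have "c (c A) = id A" if "A \<in> Y" for A using \<open>Y \<subseteq> Pow {1..n}\<close> that cc[of A] by auto
      hence "(\<lambda>A. c (c A)) ` Y = id ` Y" by (intro image_cong) auto
      thus ?thesis by (simp add: image_image)
    qed
    have cP: "c ` Y \<subseteq> Pow {1..n}" for Y by (auto simp: c_def)
    have "card (c ` F) = card F" using inj[OF F] by (rule card_image)
    then obtain S where S: "copy_clique (T\<inverse>) (c ` F) S" "\<delta> * real n ^ e \<le> real (card S)"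
      using dual cP big by metis
    have ScF: "S \<subseteq> c ` F" using S(1) by (simp add: copy_clique_def)
    hence SP: "S \<subseteq> Pow {1..n}" using cP by (rule order_trans)
    have "copy_clique T F (c ` S)"
      unfolding copy_clique_def
    proof (intro conjI ballI impI)
      show "c ` S \<subseteq> F" using image_mono[OF ScF, of c] unfolding img[OF F] .
      fix A B assume AB: "A \<in> c ` S" "B \<in> c ` S" "A \<noteq> B"
      then obtain A' B' where A': "A' \<in> S" "A = c A'" "B' \<in> S" "B = c B'" by (elim imageE)
      hence "A' \<noteq> B'" using AB(3) by metis
      then obtain \<G> where G: "\<G> \<subseteq> c ` F" "weak_copy (T\<inverse>) \<G>" "A' \<in> \<G>" "B' \<in> \<G>"
        using S(1) A'(1,3) unfolding copy_clique_def by metis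
      have "weak_copy T (c ` \<G>)"
        unfolding c_def by (rule weak_copy_complement[OF G(2) order_trans[OF G(1) cP]])
      moreover have "c ` \<G> \<subseteq> F" using image_mono[OF G(1), of c] unfolding img[OF F] .
      ultimately show "\<exists>\<G>\<subseteq>F. weak_copy T \<G> \<and> A \<in> \<G> \<and> B \<in> \<G>" using A'(2,4) G(3,4) by (intro exI[of _ "c ` \<G>"]) simp
    qed
    moreover have "card (c ` S) = card S" using inj[OF SP] by (rule card_image)
    ultimately show "\<exists>S. copy_clique T F S \<and> \<delta> * real n ^ e \<le> real (card S)" using S(2) by metis
  qed
  thus "\<exists>\<delta>>0. \<forall>\<^sub>F n in sequentially. \<forall>F\<subseteq>Pow {1..n}.
     real (card F) \<ge> (real k - 1 + \<epsilon>) * central n \<longrightarrow>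
     (\<exists>S. copy_clique T F S \<and> real (card S) \<ge> \<delta> * real n ^ e)" using \<delta>(1) by blast
qed

section \<open>Chains, ranks and paths in tree posets\<close>

context tree
begin

lemma chain_subset: "C \<in> Chains T \<Longrightarrow> C \<subseteq> Field T"
  by (auto simp: Chains_def Field_def)

lemma finite_chain: "C \<in> Chains T \<Longrightarrow> finite C"
  using chain_subset fin finite_subset by metis

lemma finite_Chains: "finite (Chains T)"
  by (rule finite_subset[of _ "Pow (Field T)"]) (use chain_subset fin in auto)

lemma card_chain_le_height: "C \<in> Chains T \<Longrightarrow> card C \<le> height T"
  unfolding height_def using finite_Chains by (intro Max_ge) auto

definition rank :: "'a \<Rightarrow> nat" where
  "rank v = Max (card ` {C \<in> Chains T. \<forall>y\<in>C. (y, v) \<in> T \<and> y \<noteq> v})"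

lemma rank_ge: "C \<in> Chains T \<Longrightarrow> (\<And>y. y \<in> C \<Longrightarrow> (y, v) \<in> T \<and> y \<noteq> v) \<Longrightarrow> card C \<le> rank v"
  unfolding rank_def using finite_Chains by (intro Max_ge) auto

lemma rank_attained: "\<exists>C\<in>Chains T. card C = rank v \<and> (\<forall>y\<in>C. (y, v) \<in> T \<and> y \<noteq> v)"
proof -
  have "{} \<in> {C \<in> Chains T. \<forall>y\<in>C. (y, v) \<in> T \<and> y \<noteq> v}" by (simp add: Chains_def)
  hence "Max (card ` {C \<in> Chains T. \<forall>y\<in>C. (y, v) \<in> T \<and> y \<noteq> v}) \<in> card ` {C \<in> Chains T. \<forall>y\<in>C. (y, v) \<in> T \<and> y \<noteq> v}"
    using finite_Chains by (intro Max_in) auto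
  thus ?thesis unfolding rank_def by auto
qed

lemma insert_chain:
  assumes "C \<in> Chains T" "v \<in> Field T" "\<And>y. y \<in> C \<Longrightarrow> (y, v) \<in> T \<or> (v, y) \<in> T"
  shows "insert v C \<in> Chains T"
  using assms refl unfolding Chains_def by blast

lemma rank_mono:
  assumes "(u, v) \<in> T" "u \<noteq> v"
  shows "rank u < rank v"
proof -
  obtain C where C: "C \<in> Chains T" "card C = rank u" "\<forall>y\<in>C. (y, u) \<in> T \<and> y \<noteq> u" using rank_attained by blast
  have "card (insert u C) \<le> rank v"
  proof (rule rank_ge)
    show "insert u C \<in> Chains T" using C field[OF assms(1)] by (intro insert_chain) auto
    fix y assume "y \<in> insert u C"
    thus "(y, v) \<in> T \<and> y \<noteq> v" using C(3) assms trans antisym by blast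
  qed
  moreover have "card (insert u C) = Suc (card C)" using C(3) finite_chain[OF C(1)] by (intro card_insert_disjoint) auto
  ultimately show ?thesis using C(2) by simp
qed

lemma rank_less_height:
  assumes "v \<in> Field T"
  shows "rank v < height T"
proof -
  obtain C where C: "C \<in> Chains T" "card C = rank v" "\<forall>y\<in>C. (y, v) \<in> T \<and> y \<noteq> v" using rank_attained by blast
  have "card (insert v C) \<le> height T" using C assms by (intro card_chain_le_height insert_chain) auto
  moreover have "card (insert v C) = Suc (card C)" using C(3) finite_chain[OF C(1)] by (intro card_insert_disjoint) auto
  ultimately show ?thesis using C(2) by simp
qed

lemma copy_strict:
  assumes "bij_betw \<iota> (Field T) \<G>" "\<And>p q. (p, q) \<in> T \<Longrightarrow> \<iota> p \<subseteq> \<iota> q" "(u, v) \<in> T" "u \<noteq> v"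
  shows "\<iota> u \<subset> \<iota> v"
  using assms field[OF assms(3)] unfolding bij_betw_def inj_on_def by blast

text \<open>
  Strict inclusions along a chain force its top to have at least as many additional elements as the
  chain has steps.
\<close>

lemma copy_chain_card:
  assumes "bij_betw \<iota> (Field T) \<G>" "\<And>p q. (p, q) \<in> T \<Longrightarrow> \<iota> p \<subseteq> \<iota> q" "\<And>A. A \<in> \<G> \<Longrightarrow> finite A"
    and "C \<in> Chains T" "C \<noteq> {}"
  shows "\<exists>x\<in>C. \<exists>y\<in>C. (\<forall>w\<in>C. (x, w) \<in> T \<and> (w, y) \<in> T) \<and> card (\<iota> x) + card C \<le> card (\<iota> y) + 1"
proof -
  have fin_img: "finite (\<iota> v)" if "v \<in> Field T" for v using assms(1,3) that by (auto simp: bij_betw_def)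
  have "finite C" using assms(4) by (rule finite_chain)
  thus ?thesis using assms(4,5)
  proof (induction "card C" arbitrary: C)
    case 0
    thus ?case by simp
  next
    case (Suc n C)
    obtain y0 where "y0 \<in> C" using Suc.prems(3) by blast
    then obtain y where y: "y \<in> C" "\<And>w. w \<in> C \<Longrightarrow> below w \<le> below y"
      using ex_has_greatest_nat[of "\<lambda>w. w \<in> C" y0 below "Suc (card (Field T))"] below_le
      by (auto simp: less_Suc_eq_le)
    have top: "(w, y) \<in> T" if "w \<in> C" for w
    proof (rule ccontr)
      assume no: "(w, y) \<notin> T"
      hence "(y, w) \<in> T" using Suc.prems(2) y(1) that by (auto simp: Chains_def)
      moreover have "y \<noteq> w" using no \<open>(y, w) \<in> T\<close> by auto
      ultimately show False using below_mono[of y w] y(2)[OF that] by simp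
    qed
    show ?case
    proof (cases "C = {y}")
      case True
      thus ?thesis using top y by auto
    next
      case False
      define D where "D = C - {y}"
      have "D \<in> Chains T" using Suc.prems(2) by (auto simp: Chains_def D_def)
      moreover have "n = card D" "finite D" using Suc.hyps(2) y(1) Suc.prems(1) by (auto simp: D_def)
      moreover have "D \<noteq> {}" using False y(1) by (auto simp: D_def)
      ultimately obtain x y' where xy: "x \<in> D" "y' \<in> D" "\<And>w. w \<in> D \<Longrightarrow> (x, w) \<in> T \<and> (w, y') \<in> T"
        "card (\<iota> x) + card D \<le> card (\<iota> y') + 1" using Suc.hyps(1)[of D] by blast
      have "(y', y) \<in> T" "y' \<noteq> y" using xy(2) top by (auto simp: D_def)
      hence "card (\<iota> y') < card (\<iota> y)"
        using copy_strict[OF assms(1,2)] field fin_img by (intro psubset_card_mono) blast+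
      moreover have "card C = Suc (card D)" using \<open>n = card D\<close> Suc.hyps(2) by simp
      ultimately have "card (\<iota> x) + card C \<le> card (\<iota> y) + 1" using xy(4) by simp
      moreover have "(x, w) \<in> T" if "w \<in> C" for w
        using xy(1,3) that top by (cases "w = y") (auto simp: D_def)
      ultimately show ?thesis using xy(1) y(1) top by (auto simp: D_def)
    qed
  qed
qed

text \<open>
  A chord would close a cycle.
\<close>

lemma path_induced:
  assumes "path_in (hasse T) qs" "set qs \<subseteq> Field T" "a + 1 < b" "b < length qs"
  shows "(qs ! a, qs ! b) \<notin> hasse T"
proof
  assume adj: "(qs ! a, qs ! b) \<in> hasse T"
  define p where "p = drop a (take (Suc b) qs)"
  have len: "length p = Suc b - a" using assms(3,4) by (simp add: p_def)
  have "take (Suc b) qs = take a qs @ p"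
    using append_take_drop_id[of a "take (Suc b) qs"] assms(3) by (simp add: p_def min_def)
  hence split: "qs = take a qs @ p @ drop (Suc b) qs"
    using append_take_drop_id[of "Suc b" qs] by simp
  have "path_in (hasse T) p"
  proof -
    have "p \<noteq> []" using len assms(3) by auto
    moreover have "distinct p" using assms(1) unfolding p_def path_in_def by simp
    moreover have "successively (\<lambda>x y. (x, y) \<in> hasse T) (take a qs @ p @ drop (Suc b) qs)"
      using assms(1) split by (simp add: path_in_def)
    hence "successively (\<lambda>x y. (x, y) \<in> hasse T) p" by (simp only: successively_append_iff)
    ultimately show ?thesis by (simp add: path_in_def)
  qed
  moreover have "hd p = qs ! a" using assms(3,4) by (simp add: p_def hd_drop_conv_nth)
  moreover have "last p = qs ! b"
  proof -
    have "take (Suc b) qs = take b qs @ [qs ! b]" using assms(4) by (rule take_Suc_conv_app_nth)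
    thus ?thesis using assms(3,4) by (simp add: p_def)
  qed
  moreover have "(qs ! b, qs ! a) \<in> hasse T" using adj by (rule symD[OF sym_hasse])
  ultimately have "cycle_in (hasse T) p"
    using len assms(3) by (simp add: cycle_in_def)
  moreover have "set p \<subseteq> Field T"
    using assms(2) unfolding p_def by (meson in_set_dropD in_set_takeD subset_eq)
  ultimately show False using graph unfolding tree_graph_def by blast
qed

lemma path_connected_in:
  assumes "path_in (hasse T) qs"
  shows "connected_in (hasse T) (set qs)"
proof (rule connected_in_star[OF sym_hasse])
  show "hd qs \<in> set qs" using assms by (simp add: path_in_def)
  fix x assume "x \<in> set qs"
  then obtain ps rs where qs: "qs = ps @ x # rs" by (meson split_list)
  have "path_between (hasse T) (hd qs) x (ps @ [x])"
  proof -
    have "successively (\<lambda>x y. (x, y) \<in> hasse T) ((ps @ [x]) @ rs)" using assms by (simp add: path_in_def qs)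
    hence "successively (\<lambda>x y. (x, y) \<in> hasse T) (ps @ [x])" by (simp only: successively_append_iff)
    moreover have "distinct (ps @ [x])" using assms by (simp add: path_in_def qs)
    moreover have "hd qs = hd (ps @ [x])" unfolding qs by (cases ps) simp_all
    ultimately show ?thesis by (simp add: path_between_def path_in_def)
  qed
  thus "(hd qs, x) \<in> (Restr (hasse T) (set qs))\<^sup>*" by (rule rtrancl_of_path) (auto simp: qs)
qed

end

context chain_system
begin

text \<open>
  A path of the Hasse diagram is connected and has no chords, so its images may be prescribed freely
  as long as consecutive ones are comparable; the greedy embedding supplies the rest of the tree.
\<close>

lemma embed_path:
  fixes T :: "('a \<times> 'a) set"
  assumes T: "tree_poset T" and big: "\<eta> * real n / 4 \<ge> real (card (Field T))"
    and pos: "\<And>u v. (u, v) \<in> T \<Longrightarrow> u \<noteq> v \<Longrightarrow> pos u < pos v" "\<And>v. v \<in> Field T \<Longrightarrow> pos v < k"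
    and qs: "path_in (hasse T) qs" "set qs \<subseteq> Field T"
    and As: "length As = length qs" "distinct As" "\<And>j. j < length qs \<Longrightarrow> As ! j \<in> layer (pos (qs ! j))"
    and inc: "\<And>j. Suc j < length qs \<Longrightarrow> pos (qs ! j) < pos (qs ! Suc j) \<Longrightarrow> As ! j \<subseteq> As ! Suc j"
    and dec: "\<And>j. Suc j < length qs \<Longrightarrow> pos (qs ! Suc j) < pos (qs ! j) \<Longrightarrow> As ! Suc j \<subseteq> As ! j"
  shows "\<exists>\<G>. \<G> \<subseteq> members \<and> weak_copy T \<G> \<and> set As \<subseteq> \<G>"
proof -
  interpret tree T by unfold_locales (rule T)
  have dq: "distinct qs" "qs \<noteq> []" using qs(1) by (auto simp: path_in_def)
  define \<phi> where "\<phi> v = As ! (THE j. j < length qs \<and> qs ! j = v)" for v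
  have \<phi>: "\<phi> (qs ! j) = As ! j" if "j < length qs" for j
  proof -
    have "(THE j'. j' < length qs \<and> qs ! j' = qs ! j) = j"
      using that dq by (auto simp: nth_eq_iff_index_eq)
    thus ?thesis by (simp add: \<phi>_def)
  qed
  have img: "\<phi> ` set qs = set As"
    using \<phi> As(1) by (force simp: set_conv_nth image_def)
  have "\<exists>\<G>. \<G> \<subseteq> members \<and> weak_copy T \<G> \<and> \<phi> ` set qs \<subseteq> \<G>"
  proof (rule embed[OF T big pos qs(2)])
    show "set qs \<noteq> {}" using dq by simp
    show "connected_in (hasse T) (set qs)" using qs(1) by (rule path_connected_in)
    show "inj_on \<phi> (set qs)"
    proof (rule eq_card_imp_inj_on)
      show "card (\<phi> ` set qs) = card (set qs)"
        unfolding img using dq As by (simp add: distinct_card)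
    qed simp
    show "\<phi> v \<in> layer (pos v)" if v: "v \<in> set qs" for v
    proof -
      obtain j where "j < length qs" "v = qs ! j" using v by (metis in_set_conv_nth)
      thus ?thesis using \<phi> As(3) by simp
    qed
    show "\<phi> u \<subseteq> \<phi> v" if u: "u \<in> set qs" and v: "v \<in> set qs" and c: "covers T v u" for u v
    proof -
      obtain a b where ab: "a < length qs" "u = qs ! a" "b < length qs" "v = qs ! b"
        using u v by (metis in_set_conv_nth)
      have "(qs ! a, qs ! b) \<in> hasse T" "(qs ! b, qs ! a) \<in> hasse T" using c ab by (auto simp: hasse_def)
      hence "\<not> a + 1 < b" "\<not> b + 1 < a" using path_induced[OF qs] ab by blast+
      moreover have "u \<noteq> v" "pos u < pos v" using coversD[OF c] pos(1) by auto
      ultimately consider "b = Suc a" | "a = Suc b" using ab by (metis Suc_eq_plus1 Suc_lessI linorder_neqE_nat)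
      thus ?thesis
        using inc[of a] dec[of b] \<phi> ab \<open>pos u < pos v\<close> by cases auto
    qed
  qed
  thus ?thesis unfolding img .
qed

end

section \<open>Spheres in systems of two layers\<close>

definition sdiff :: "'a set \<Rightarrow> 'a set \<Rightarrow> 'a set" where
  "sdiff A B = (A - B) \<union> (B - A)"

lemma card_sdiff_eq:
  assumes "finite A" "finite B" "card A = card B"
  shows "card (sdiff A B) = 2 * card (A - B)"
proof -
  have "card (A - B) = card (B - A)"
    using assms by (metis card_Diff_subset_Int Int_commute finite_Int)
  moreover have "card (sdiff A B) = card (A - B) + card (B - A)"
    unfolding sdiff_def using assms by (intro card_Un_disjoint) auto
  ultimately show ?thesis by simp
qed

lemma card_sdiff_triangle:
  assumes "finite A" "finite B" "finite D"
  shows "card (sdiff A D) \<le> card (sdiff A B) + card (sdiff B D)"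
proof -
  have "card (sdiff A D) \<le> card (sdiff A B \<union> sdiff B D)"
    using assms by (intro card_mono) (auto simp: sdiff_def)
  also have "\<dots> \<le> card (sdiff A B) + card (sdiff B D)" by (rule card_Un_le)
  finally show ?thesis .
qed

lemma middle_layers_two_card:
  assumes "A \<in> middle_layers n 2" "B \<in> middle_layers n 2" "A \<subset> B"
  shows "card (sdiff A B) = 1"
proof -
  have fin: "finite A" "finite B" using assms finite_subset[of _ "{1..n}"] by (auto simp: middle_layers_def)
  have "card A < card B" using fin assms(3) by (intro psubset_card_mono)
  moreover have "card B \<le> card A + 1" using assms(1,2) by (auto simp: middle_layers_def)
  moreover have "sdiff A B = B - A" using assms(3) by (auto simp: sdiff_def)
  ultimately show ?thesis using fin assms(3) by (simp add: card_Diff_subset)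
qed

context tree
begin

text \<open>
  Along an edge of the Hasse diagram the set changes by one element, so sets at distance \<open>l\<close> in the
  tree differ in at most \<open>l\<close> elements. For sets of equal size, half of these are in \<open>A - B\<close>.
\<close>

lemma near_two_layers:
  assumes paths: "\<And>qs. path_in (hasse T) qs \<Longrightarrow> set qs \<subseteq> Field T \<Longrightarrow> length qs \<le> 2 * e + 2"
    and G: "\<G> \<subseteq> middle_layers n 2" "weak_copy T \<G>" "A \<in> \<G>" "B \<in> \<G>" "card A = card B"
  shows "card (A - B) \<le> e"
proof -
  obtain \<iota> where \<iota>: "bij_betw \<iota> (Field T) \<G>" "\<And>p q. (p, q) \<in> T \<Longrightarrow> \<iota> p \<subseteq> \<iota> q"
    using G(2) by (auto simp: weak_copy_def)
  obtain u v where uv: "u \<in> Field T" "A = \<iota> u" "v \<in> Field T" "B = \<iota> v"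
    using G(3,4) \<iota>(1) by (auto simp: bij_betw_def)
  have fin_mid: "finite M" if "M \<in> middle_layers n 2" for M
    using that finite_subset[of _ "{1..n}"] by (auto simp: middle_layers_def)
  have mid: "\<iota> w \<in> middle_layers n 2" if "w \<in> Field T" for w
    using that \<iota>(1) G(1) by (auto simp: bij_betw_def)
  have edge: "card (sdiff (\<iota> x) (\<iota> y)) = 1" if "(x, y) \<in> hasse T" for x y
  proof -
    have *: "card (sdiff (\<iota> a) (\<iota> b)) = 1" if "covers T b a" for a b
    proof -
      have "a \<in> Field T" "b \<in> Field T" using field coversD[OF that] by auto
      thus ?thesis using copy_strict[OF \<iota> coversD[OF that]] mid by (intro middle_layers_two_card) auto
    qed
    have "sdiff (\<iota> x) (\<iota> y) = sdiff (\<iota> y) (\<iota> x)" by (auto simp: sdiff_def)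
    thus ?thesis using *[of x y] *[of y x] that by (auto simp: hasse_def)
  qed
  obtain p where p: "set p \<subseteq> Field T" "path_between (hasse T) u v p"
    using graph uv unfolding tree_graph_def by blast
  have walk: "card (sdiff (\<iota> (hd p)) (\<iota> (last p))) + 1 \<le> length p"
    if "p \<noteq> []" "set p \<subseteq> Field T" "successively (\<lambda>x y. (x, y) \<in> hasse T) p" for p
    using that
  proof (induction p rule: induct_list012)
    case (3 x y zs)
    have "card (sdiff (\<iota> x) (\<iota> (last (y # zs)))) \<le> card (sdiff (\<iota> x) (\<iota> y)) + card (sdiff (\<iota> y) (\<iota> (last (y # zs))))"
    proof (rule card_sdiff_triangle)
      have "last (y # zs) \<in> set (y # zs)" by (rule last_in_set) simp
      hence "last (y # zs) \<in> Field T" using 3(4) by auto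
      thus "finite (\<iota> (last (y # zs)))" by (intro fin_mid mid)
    qed (use 3(4) fin_mid mid in auto)
    moreover have "card (sdiff (\<iota> x) (\<iota> y)) = 1" using 3(5) by (intro edge) simp
    moreover have "card (sdiff (\<iota> (hd (y # zs))) (\<iota> (last (y # zs)))) + 1 \<le> length (y # zs)"
      using 3(4,5) by (intro 3(2)) auto
    ultimately show ?case by simp
  qed (auto simp: sdiff_def)
  have "card (sdiff A B) + 1 \<le> length p"
    using walk[of p] p uv by (simp add: path_between_def path_in_def)
  moreover have "length p \<le> 2 * e + 2" using paths p by (simp add: path_between_def)
  moreover have "card (sdiff A B) = 2 * card (A - B)"
    using G(5) uv fin_mid mid by (intro card_sdiff_eq) auto
  ultimately show ?thesis by linarith
qed

end

lemma card_subsets_containing_le: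
  assumes "finite G" "x \<in> G" "s \<ge> 1"
  shows "card {D. D \<subseteq> G \<and> card D = s \<and> x \<in> D} \<le> (card G - 1) choose (s - 1)"
proof -
  have "inj_on (\<lambda>D. D - {x}) {D. D \<subseteq> G \<and> card D = s \<and> x \<in> D}" by (rule inj_onI) auto
  hence "card {D. D \<subseteq> G \<and> card D = s \<and> x \<in> D} \<le> card {D. D \<subseteq> G - {x} \<and> card D = s - 1}"
  proof (rule card_inj_on_le)
    show "(\<lambda>D. D - {x}) ` {D. D \<subseteq> G \<and> card D = s \<and> x \<in> D} \<subseteq> {D. D \<subseteq> G - {x} \<and> card D = s - 1}"
    proof clarify
      fix D assume "D \<subseteq> G" "x \<in> D" "s = card D"
      thus "D - {x} \<subseteq> G - {x} \<and> card (D - {x}) = card D - 1"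
        using assms(1) finite_subset[of D G] by auto
    qed
    show "finite {D. D \<subseteq> G - {x} \<and> card D = s - 1}"
      by (rule finite_subset[of _ "Pow G"]) (use assms(1) in auto)
  qed
  also have "\<dots> = (card G - 1) choose (s - 1)" using assms by (simp add: n_subsets)
  finally show ?thesis .
qed

text \<open>
  At most \<open>card \<tau> * s / card G\<close> of all \<open>s\<close>-subsets of \<open>G\<close> meet \<open>\<tau>\<close>, which is a small part of \<open>\<D>\<close>.
\<close>

lemma avoid_count:
  fixes e :: real
  assumes G: "finite G" "s \<ge> 1" and D: "\<D> \<subseteq> {D. D \<subseteq> G \<and> card D = s}"
    and big: "real (card \<D>) \<ge> e * real (card G choose s)"
    and \<tau>: "finite \<tau>" "2 * real (card \<tau>) * real s \<le> e * real (card G)"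
  shows "real (card {D \<in> \<D>. D \<inter> \<tau> = {}}) \<ge> e / 2 * real (card G choose s)"
proof -
  let ?c = "real (card G choose s)"
  have finP: "finite {D. D \<subseteq> G \<and> card D = s}" by (rule finite_subset[of _ "Pow G"]) (use G in auto)
  have finD: "finite \<D>" using D finP by (rule finite_subset)
  show ?thesis
  proof (cases "G = {}")
    case True
    hence "?c = 0" using G(2) by simp
    thus ?thesis by (simp only: mult_zero_right of_nat_0_le_iff)
  next
    case False
    hence g: "card G \<ge> 1" using G(1) by (simp add: Suc_le_eq card_gt_0_iff)
    have abs: "real s * ?c = real (card G) * real ((card G - 1) choose (s - 1))"
    proof -
      have "s * (card G choose s) = card G * ((card G - 1) choose (s - 1))"
        using G(2) g by (metis One_nat_def Suc_diff_le Suc_times_binomial_eq binomial_absorption diff_Suc_Suc le_add_diff_inverse minus_nat.diff_0 mult.commute plus_1_eq_Suc)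
      thus ?thesis by (metis of_nat_mult)
    qed
    have "{D \<in> \<D>. D \<inter> \<tau> \<noteq> {}} \<subseteq> (\<Union>x\<in>\<tau> \<inter> G. {D. D \<subseteq> G \<and> card D = s \<and> x \<in> D})" using D by auto
    hence "card {D \<in> \<D>. D \<inter> \<tau> \<noteq> {}} \<le> card (\<Union>x\<in>\<tau> \<inter> G. {D. D \<subseteq> G \<and> card D = s \<and> x \<in> D})"
      by (rule card_mono[rotated]) (use \<tau>(1) G(1) in \<open>auto intro!: finite_UN_I intro: finite_subset[of _ "Pow G"]\<close>)
    also have "\<dots> \<le> (\<Sum>x\<in>\<tau> \<inter> G. card {D. D \<subseteq> G \<and> card D = s \<and> x \<in> D})"
      by (rule card_UN_le) (use \<tau>(1) in simp)
    also have "\<dots> \<le> (\<Sum>x\<in>\<tau> \<inter> G. (card G - 1) choose (s - 1))"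
      using G by (intro sum_mono card_subsets_containing_le) auto
    also have "\<dots> \<le> card \<tau> * ((card G - 1) choose (s - 1))"
      using \<tau>(1) by (simp add: card_mono)
    finally have "real (card {D \<in> \<D>. D \<inter> \<tau> \<noteq> {}}) \<le> real (card \<tau> * ((card G - 1) choose (s - 1)))"
      by (rule of_nat_mono)
    hence bad: "real (card {D \<in> \<D>. D \<inter> \<tau> \<noteq> {}}) \<le> real (card \<tau>) * real ((card G - 1) choose (s - 1))" by simp
    have "2 * real (card \<tau>) * (real s * ?c) \<le> e * real (card G) * ?c"
      using mult_right_mono[OF \<tau>(2), of ?c] by (simp only: mult.assoc of_nat_0_le_iff)
    hence "real (card G) * (2 * real (card \<tau>) * real ((card G - 1) choose (s - 1))) \<le> real (card G) * (e * ?c)"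
      unfolding abs by (simp only: mult_ac)
    hence "2 * real (card \<tau>) * real ((card G - 1) choose (s - 1)) \<le> e * ?c"
      using g by (simp only: mult_le_cancel_left_pos of_nat_0_less_iff)
    hence bad': "real (card {D \<in> \<D>. D \<inter> \<tau> \<noteq> {}}) \<le> e / 2 * ?c" using bad by linarith
    have "card \<D> = card ({D \<in> \<D>. D \<inter> \<tau> = {}} \<union> {D \<in> \<D>. D \<inter> \<tau> \<noteq> {}})"
      by (rule arg_cong[of _ _ card]) auto
    also have "\<dots> \<le> card {D \<in> \<D>. D \<inter> \<tau> = {}} + card {D \<in> \<D>. D \<inter> \<tau> \<noteq> {}}" by (rule card_Un_le)
    finally show ?thesis using bad' big by linarith
  qed
qed

text \<open>
  The position after \<open>t\<close> steps of a walk that starts in position \<open>i\<close> and alternates between the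
  positions 0 and 1.
\<close>

definition role :: "nat \<Rightarrow> nat \<Rightarrow> nat" where
  "role i t = (if even t then i else 1 - i)"

context chain_system
begin

text \<open>
  The sets reached from \<open>Z\<close> by \<open>j\<close> alternating steps, where no step touches an element that an earlier
  step has added or removed. The walk that leads to \<open>A\<close> enters only through \<open>sdiff A Z\<close>, which consists of
  the elements touched so far.
\<close>

fun sphere :: "nat set \<Rightarrow> nat \<Rightarrow> nat \<Rightarrow> nat set set" where
  "sphere Z i 0 = {Z}"
| "sphere Z i (Suc j) = {B. \<exists>A\<in>sphere Z i j. B \<in> linked (role i j) (role i (Suc j)) A \<and> sdiff A B \<inter> sdiff A Z = {}}"

lemma role_props: "i < 2 \<Longrightarrow> role i t < 2" "i < 2 \<Longrightarrow> role i t \<noteq> role i (Suc t)" "i < 2 \<Longrightarrow> role i (Suc t) = 1 - role i t"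
  by (auto simp: role_def less_2_cases_iff)

lemma linked_two:
  assumes "k = 2" "\<And>c. c \<in> C \<Longrightarrow> card (c ! 1) = card (c ! 0) + s" "i < 2" "i' < 2" "i \<noteq> i'" "B \<in> linked i i' A"
  shows "card (sdiff A B) = s" "i < i' \<Longrightarrow> A \<subset> B \<and> card B = card A + s" "i' < i \<Longrightarrow> B \<subset> A \<and> card A = card B + s" "finite A" "finite B"
proof -
  obtain c where c: "c \<in> C" "c ! i = A" "c ! i' = B" using assms(6) by (auto simp: linked_def)
  have fin: "finite (c ! 0)" "finite (c ! 1)" using finite_nth[OF c(1)] assms(1) by auto
  have sub: "c ! 0 \<subset> c ! 1" using nth_mono[OF c(1), of 0 1] assms(1) by simp
  have cs: "card (c ! 1 - c ! 0) = s" using assms(2)[OF c(1)] sub fin by (simp add: card_Diff_subset)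
  have "(i = 0 \<and> i' = 1) \<or> (i = 1 \<and> i' = 0)" using assms(3-5) by auto
  moreover have "sdiff (c ! 0) (c ! 1) = c ! 1 - c ! 0" "sdiff (c ! 1) (c ! 0) = c ! 1 - c ! 0"
    using sub by (auto simp: sdiff_def)
  ultimately show "card (sdiff A B) = s" "i < i' \<Longrightarrow> A \<subset> B \<and> card B = card A + s" "i' < i \<Longrightarrow> B \<subset> A \<and> card A = card B + s" "finite A" "finite B"
    using c cs sub fin assms(2)[OF c(1)] by auto
qed

context
  fixes s Z i
  assumes two: "k = 2" and step: "\<And>c. c \<in> C \<Longrightarrow> card (c ! 1) = card (c ! 0) + s" and s: "s \<ge> 1"
    and i: "i < 2" and Z: "Z \<in> layer i"
begin

lemma linked_role:
  assumes "B \<in> linked (role i j) (role i (Suc j)) A"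
  shows "card (sdiff A B) = s" "finite A" "finite B"
  using linked_two[OF two step role_props(1)[OF i] role_props(1)[OF i] role_props(2)[OF i] assms] by blast+

lemma finite_Z: "finite Z"
  using Z layer_balanced[of i] i two finite_subset[of Z "{1..n}"] by (auto simp: balanced_def)

lemma sdiff_step:
  assumes "sdiff A B \<inter> sdiff A Z = {}"
  shows "sdiff B Z = sdiff A B \<union> sdiff A Z"
  using assms unfolding sdiff_def by blast

lemma sphere_props:
  assumes "A \<in> sphere Z i j"
  shows "A \<in> layer (role i j) \<and> finite A \<and> card (sdiff A Z) = j * s"
  using assms
proof (induction j arbitrary: A)
  case 0
  thus ?case using Z finite_Z by (simp add: role_def sdiff_def)
next
  case (Suc j B)
  then obtain A where A: "A \<in> sphere Z i j" "B \<in> linked (role i j) (role i (Suc j)) A" "sdiff A B \<inter> sdiff A Z = {}" by auto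
  note IH = Suc.IH[OF A(1)]
  have "card (sdiff B Z) = card (sdiff A B) + card (sdiff A Z)"
    unfolding sdiff_step[OF A(3)]
    using linked_role[OF A(2)] finite_Z by (intro card_Un_disjoint A(3)) (auto simp: sdiff_def)
  thus ?case using linked_role[OF A(2)] linked_subset A(2) IH by auto
qed

lemma finite_sphere: "finite (sphere Z i j)"
proof (rule finite_subset)
  show "sphere Z i j \<subseteq> balanced n"
    using sphere_props layer_balanced role_props(1)[OF i] two by blast
qed (rule finite_balanced)

text \<open>
  Boundedly many elements are forbidden, and a step of bounded size rarely hits them, so a constant
  proportion of all steps is admissible.
\<close>

lemma good_neighbours:
  assumes "A \<in> sphere Z i j" "j \<le> e" "s \<le> e" "\<eta> * real n \<ge> 8 * real e ^ 3" "n \<ge> 1"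
  shows "real (card {B \<in> linked (role i j) (role i (Suc j)) A. sdiff A B \<inter> sdiff A Z = {}}) \<ge> \<eta> * real n / 8"
proof -
  define L where "L = linked (role i j) (role i (Suc j)) A"
  note A = sphere_props[OF assms(1)]
  have r: "role i j < 2" "role i (Suc j) < 2" "role i j \<noteq> role i (Suc j)"
    using role_props[OF i] by auto
  have Ab: "A \<in> balanced n" using A layer_balanced[of "role i j"] r two by blast
  have An: "A \<subseteq> {1..n}" "n \<le> 4 * card A" "n \<le> 4 * (n - card A)" using Ab by (auto simp: balanced_def)
  \<comment> \<open>the elements that a step from \<open>A\<close> can change: those outside \<open>A\<close> for a step up, those of \<open>A\<close> for a step down\<close>
  define G where "G = (if role i j = 0 then {1..n} - A else A)"
  have G: "finite G" "n \<le> 4 * card G" using A An by (auto simp: G_def card_Diff_subset)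
  have LB: "B \<in> L \<Longrightarrow> sdiff A B \<subseteq> G \<and> card (sdiff A B) = s" for B
  proof -
    assume B: "B \<in> L"
    note l = linked_two[OF two step r B[unfolded L_def]]
    have "B \<subseteq> {1..n}" using B linked_subset layer_balanced[of "role i (Suc j)"] r two unfolding L_def balanced_def by blast
    moreover have "role i j = 0 \<and> role i (Suc j) = 1 \<or> role i j = 1 \<and> role i (Suc j) = 0" using r by auto
    ultimately show ?thesis using l by (auto simp: G_def sdiff_def)
  qed
  have inj: "inj_on (sdiff A) Y" for Y
    by (rule inj_on_inverseI[of _ "sdiff A"]) (auto simp: sdiff_def)
  have weights: "\<eta> * real (card G choose s) \<le> real (card L)"
  proof -
    have s_le: "card G choose s > 0" if ne: "L \<noteq> {}"
    proof -
      obtain B where "B \<in> L" using ne by blast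
      hence "s \<le> card G" using LB[of B] card_mono[OF G(1), of "sdiff A B"] by simp
      thus ?thesis by simp
    qed
    have "\<eta> \<le> (\<Sum>B\<in>L. 1 / real (card G choose s))"
    proof (cases "role i j = 0")
      case True
      hence r1: "role i (Suc j) = 1" using r by auto
      have "\<eta> \<le> (\<Sum>B\<in>L. 1 / real ((n - card A) choose (card B - card A)))"
        unfolding L_def using A r True r1 two by (intro up_sum') auto
      also have "\<dots> = (\<Sum>B\<in>L. 1 / real (card G choose s))"
      proof (rule sum.cong)
        fix B assume "B \<in> L"
        hence "card B = card A + s" using linked_two(2)[OF two step r, of B A] True r1 unfolding L_def by simp
        thus "1 / real ((n - card A) choose (card B - card A)) = 1 / real (card G choose s)"
          using True A An by (simp add: G_def card_Diff_subset)
      qed simp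
      finally show ?thesis .
    next
      case False
      hence r1: "role i j = 1" "role i (Suc j) = 0" using r by auto
      have "\<eta> \<le> (\<Sum>B\<in>L. 1 / real (card A choose card B))"
        unfolding L_def using A r r1 two by (intro down_sum') auto
      also have "\<dots> = (\<Sum>B\<in>L. 1 / real (card G choose s))"
      proof (rule sum.cong)
        fix B assume "B \<in> L"
        hence "card A = card B + s" using linked_two(3)[OF two step r, of B A] r1 unfolding L_def by simp
        thus "1 / real (card A choose card B) = 1 / real (card G choose s)"
          using False binomial_symmetric[of "card B" "card A"] by (simp add: G_def)
      qed simp
      finally show ?thesis .
    qed
    moreover from this have "L \<noteq> {}" using \<eta>_pos by auto
    ultimately show ?thesis using s_le by (simp add: field_simps)
  qed
  have cardimg: "card (sdiff A ` Y) = card Y" for Y using inj by (rule card_image)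
  have "real (card {D \<in> sdiff A ` L. D \<inter> sdiff A Z = {}}) \<ge> \<eta> / 2 * real (card G choose s)"
  proof (rule avoid_count[OF G(1) s])
    show "sdiff A ` L \<subseteq> {D. D \<subseteq> G \<and> card D = s}" using LB by blast
    show "\<eta> * real (card G choose s) \<le> real (card (sdiff A ` L))" using weights by (simp add: cardimg)
    show "finite (sdiff A Z)" using A finite_Z by (auto simp: sdiff_def)
    have "real (card (sdiff A Z)) * real s \<le> real e * real e * real e"
      using A assms(2,3) by (simp add: mult_mono)
    hence "2 * real (card (sdiff A Z)) * real s \<le> 2 * real e ^ 3" by (simp add: power3_eq_cube)
    also have "\<dots> \<le> \<eta> * real n / 4" using assms(4) by simp
    also have "\<dots> \<le> \<eta> * real (card G)" using G(2) \<eta>_pos by simp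
    finally show "2 * real (card (sdiff A Z)) * real s \<le> \<eta> * real (card G)" .
  qed
  moreover have "{D \<in> sdiff A ` L. D \<inter> sdiff A Z = {}} = sdiff A ` {B \<in> L. sdiff A B \<inter> sdiff A Z = {}}" by blast
  moreover have "real (card G choose s) \<ge> real n / 4"
  proof -
    have "L \<noteq> {}"
    proof
      assume "L = {}"
      moreover have "real (card L) \<ge> \<eta> * real n / 4"
        unfolding L_def using A r two assms(5) by (intro card_linked_ge) auto
      moreover have "\<eta> * real n / 4 > 0" using \<eta>_pos assms(5) by simp
      ultimately show False by simp
    qed
    then obtain B where B: "B \<in> L" by blast
    note l = linked_two[OF two step r B[unfolded L_def]]
    have "B \<in> balanced n"
      using B linked_subset layer_balanced[of "role i (Suc j)"] r two unfolding L_def by blast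
    hence Bb: "n \<le> 4 * card B" "n \<le> 4 * (n - card B)" "card B \<le> n"
      using card_mono[of "{1..n}" B] by (auto simp: balanced_def)
    define t where "t = (if role i j = 0 then n - card B else card B)"
    have "card G = s + t" "n \<le> 4 * t"
      using l Bb r An A by (auto simp: G_def t_def card_Diff_subset)
    thus ?thesis using binomial_ge_power(2)[of 1 s n t] s by simp
  qed
  hence "\<eta> / 2 * real (card G choose s) \<ge> \<eta> / 2 * (real n / 4)"
    using \<eta>_pos by (intro mult_left_mono) auto
  ultimately show ?thesis unfolding L_def[symmetric] by (simp add: cardimg)
qed

text \<open>
  Every set \<open>A\<close> of the sphere has linearly many successors, while a set \<open>B\<close> of the next sphere has
  boundedly many predecessors: \<open>sdiff A B\<close> is a subset of \<open>sdiff B Z\<close>, and it determines \<open>A\<close>.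
\<close>

lemma sphere_growth:
  assumes "j < e" "s \<le> e" "\<eta> * real n \<ge> 8 * real e ^ 3" "n \<ge> 1"
  shows "real (card (sphere Z i (Suc j))) \<ge> \<eta> * real n / (8 * 2 ^ (e * e)) * real (card (sphere Z i j))"
proof -
  define R where "R A B \<longleftrightarrow> B \<in> linked (role i j) (role i (Suc j)) A \<and> sdiff A B \<inter> sdiff A Z = {}" for A B
  have "\<eta> * real n / 8 * real (card (sphere Z i j)) = (\<Sum>A\<in>sphere Z i j. \<eta> * real n / 8)" by simp
  also have "\<dots> \<le> (\<Sum>A\<in>sphere Z i j. real (card {B \<in> sphere Z i (Suc j). R A B}))"
  proof (rule sum_mono)
    fix A assume A: "A \<in> sphere Z i j"
    have "{B \<in> sphere Z i (Suc j). R A B} = {B \<in> linked (role i j) (role i (Suc j)) A. sdiff A B \<inter> sdiff A Z = {}}"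
      using A unfolding R_def by auto
    thus "\<eta> * real n / 8 \<le> real (card {B \<in> sphere Z i (Suc j). R A B})"
      using good_neighbours[OF A _ assms(2-4)] assms(1) by simp
  qed
  also have "\<dots> = (\<Sum>B\<in>sphere Z i (Suc j). real (card {A \<in> sphere Z i j. R A B}))"
    by (intro sum_card_swap finite_sphere)
  also have "\<dots> \<le> (\<Sum>B\<in>sphere Z i (Suc j). 2 ^ (e * e))"
  proof (rule sum_mono)
    fix B assume B: "B \<in> sphere Z i (Suc j)"
    note Bp = sphere_props[OF B]
    have finB: "finite (sdiff B Z)" using Bp finite_Z by (auto simp: sdiff_def)
    have "inj_on (\<lambda>A. sdiff A B) {A \<in> sphere Z i j. R A B}"
      by (rule inj_on_inverseI[of _ "\<lambda>D. sdiff D B"]) (auto simp: sdiff_def)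
    moreover have "(\<lambda>A. sdiff A B) ` {A \<in> sphere Z i j. R A B} \<subseteq> Pow (sdiff B Z)"
    proof clarify
      fix A x assume "R A B" "x \<in> sdiff A B"
      thus "x \<in> sdiff B Z" using sdiff_step[of A B] unfolding R_def by blast
    qed
    ultimately have "card {A \<in> sphere Z i j. R A B} \<le> card (Pow (sdiff B Z))"
      using finB by (intro card_inj_on_le) auto
    also have "\<dots> = 2 ^ (Suc j * s)" using Bp finB by (simp add: card_Pow)
    also have "\<dots> \<le> 2 ^ (e * e)" using assms(1,2) by (intro power_increasing mult_le_mono) auto
    finally have "real (card {A \<in> sphere Z i j. R A B}) \<le> real (2 ^ (e * e))" by (rule of_nat_mono)
    thus "real (card {A \<in> sphere Z i j. R A B}) \<le> 2 ^ (e * e)" by simp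
  qed
  also have "\<dots> = real (card (sphere Z i (Suc j))) * 2 ^ (e * e)" by simp
  finally show ?thesis by (simp add: field_simps)
qed

lemma card_sphere:
  assumes "j \<le> e" "s \<le> e" "\<eta> * real n \<ge> 8 * real e ^ 3" "n \<ge> 1"
  shows "real (card (sphere Z i j)) \<ge> (\<eta> * real n / (8 * 2 ^ (e * e))) ^ j"
  using assms(1)
proof (induction j)
  case (Suc j)
  define \<beta> where "\<beta> = \<eta> * real n / (8 * 2 ^ (e * e))"
  have "\<beta> \<ge> 0" using \<eta>_pos by (simp add: \<beta>_def)
  hence "\<beta> * \<beta> ^ j \<le> \<beta> * real (card (sphere Z i j))" using Suc unfolding \<beta>_def by (intro mult_left_mono) auto
  also have "\<dots> \<le> real (card (sphere Z i (Suc j)))" using sphere_growth[of j e] Suc.prems assms unfolding \<beta>_def by simp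
  finally show ?case unfolding \<beta>_def by simp
qed simp

lemma sphere_walk:
  assumes "A \<in> sphere Z i j"
  shows "\<exists>w. w j = A \<and> (\<forall>l\<le>j. w l \<in> sphere Z i l) \<and> (\<forall>l<j. w (Suc l) \<in> linked (role i l) (role i (Suc l)) (w l))"
  using assms
proof (induction j arbitrary: A)
  case 0
  thus ?case by (intro exI[of _ "\<lambda>_. Z"]) simp
next
  case (Suc j B)
  then obtain A where A: "A \<in> sphere Z i j" "B \<in> linked (role i j) (role i (Suc j)) A" by auto
  obtain w where w: "w j = A" "\<forall>l\<le>j. w l \<in> sphere Z i l" "\<forall>l<j. w (Suc l) \<in> linked (role i l) (role i (Suc l)) (w l)"
    using Suc.IH[OF A(1)] by blast
  show ?case
    using w A(2) Suc.prems by (intro exI[of _ "w(Suc j := B)"]) (auto simp: le_Suc_eq less_Suc_eq)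
qed

text \<open>
  The index of the sphere can be read off from the number of elements in \<open>sdiff A Z\<close>.
\<close>

lemma sphere_disjoint: "A \<in> sphere Z i j \<Longrightarrow> A \<in> sphere Z i l \<Longrightarrow> j = l"
  using sphere_props[of A j] sphere_props[of A l] s by simp

end

end

section \<open>Tree posets of height two\<close>

lemma role_role: "a < 2 \<Longrightarrow> role (role a e) (e + j) = role a j"
  by (cases "even e"; cases "even j") (auto simp: role_def less_2_cases_iff)

lemma role_cong: "even a = even b \<Longrightarrow> role i a = role i b"
  by (simp add: role_def)

lemma path_in_take: "path_in E p \<Longrightarrow> l > 0 \<Longrightarrow> path_in E (take l p)"
  unfolding path_in_def
  by (metis append_take_drop_id distinct_take gr_implies_not0 successively_append_iff take_eq_Nil)

lemma path_in_nth: "path_in E p \<Longrightarrow> Suc j < length p \<Longrightarrow> (p ! j, p ! Suc j) \<in> E"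
  unfolding path_in_def by (simp add: successively_conv_nth)

context tree
begin

lemma hasse_alternates:
  assumes "\<And>u v. (u, v) \<in> T \<Longrightarrow> u \<noteq> v \<Longrightarrow> pos u < pos v" "\<And>v. v \<in> Field T \<Longrightarrow> pos v < (2 :: nat)"
    and "path_in (hasse T) p" "set p \<subseteq> Field T" "j < length p"
  shows "pos (p ! j) = role (pos (p ! 0)) j"
  using assms(5)
proof (induction j)
  case (Suc j)
  have "(p ! j, p ! Suc j) \<in> hasse T" using assms(3) Suc.prems by (rule path_in_nth)
  hence "pos (p ! j) \<noteq> pos (p ! Suc j)"
    using assms(1) coversD unfolding hasse_def by fastforce
  moreover have "pos (p ! j) < 2" "pos (p ! Suc j) < 2" "pos (p ! 0) < 2"
    using assms(2,4) Suc.prems by (auto intro!: assms(2) subsetD[OF assms(4)] nth_mem)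
  ultimately show ?case using Suc by (auto simp: role_def less_2_cases_iff split: if_splits)
qed (simp add: role_def)

end

context chain_system
begin

text \<open>
  Two walks from \<open>Z\<close> meet at most at equal times, since spheres are disjoint. Following the first walk
  back from \<open>S1\<close> to the last common set and then the second one to \<open>S2\<close> gives a path with \<open>2 * d\<close> steps,
  where \<open>1 \<le> d \<le> e\<close>. It alternates between the two positions as an initial part of \<open>P\<close> does.
\<close>

lemma sphere_pair_in_copy:
  fixes T :: "('a \<times> 'a) set"
  assumes two: "k = 2" and step: "\<And>c. c \<in> C \<Longrightarrow> card (c ! 1) = card (c ! 0) + s" and s: "s \<ge> 1"
    and T: "tree_poset T" and big: "\<eta> * real n / 4 \<ge> real (card (Field T))"
    and pos: "\<And>u v. (u, v) \<in> T \<Longrightarrow> u \<noteq> v \<Longrightarrow> pos u < pos v" "\<And>v. v \<in> Field T \<Longrightarrow> pos v < k"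
    and P: "path_in (hasse T) P" "set P \<subseteq> Field T" "length P = 2 * e + 1"
    and i: "i = pos (P ! e)" and Z: "Z \<in> layer i"
    and S: "S1 \<in> sphere Z i e" "S2 \<in> sphere Z i e" "S1 \<noteq> S2"
  shows "\<exists>\<G>. \<G> \<subseteq> members \<and> weak_copy T \<G> \<and> S1 \<in> \<G> \<and> S2 \<in> \<G>"
proof -
  interpret tree T by unfold_locales (rule T)
  have pos2: "pos v < 2" if "v \<in> Field T" for v using pos(2)[OF that] two by simp
  have inP: "P ! j \<in> Field T" if "j \<le> 2 * e" for j using P(2,3) that by (auto intro!: subsetD[OF P(2)] nth_mem)
  have i2: "i < 2" unfolding i by (intro pos2 inP) simp
  note ctx = two step s i2 Z
  have posP: "pos (P ! j) = role i (e + j)" if "j \<le> 2 * e" for j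
  proof -
    have "pos (P ! j) = role (pos (P ! 0)) j"
      using that P by (intro hasse_alternates[OF pos(1) pos2]) auto
    moreover have "i = role (pos (P ! 0)) e"
      unfolding i using P by (intro hasse_alternates[OF pos(1) pos2]) auto
    ultimately show ?thesis using role_role[of "pos (P ! 0)" e j] pos2[OF inP[of 0]] by simp
  qed
  obtain w where w: "w e = S1" "\<And>l. l \<le> e \<Longrightarrow> w l \<in> sphere Z i l"
    "\<And>l. l < e \<Longrightarrow> w (Suc l) \<in> linked (role i l) (role i (Suc l)) (w l)"
    using sphere_walk[OF ctx S(1)] by blast
  obtain w' where w': "w' e = S2" "\<And>l. l \<le> e \<Longrightarrow> w' l \<in> sphere Z i l"
    "\<And>l. l < e \<Longrightarrow> w' (Suc l) \<in> linked (role i l) (role i (Suc l)) (w' l)"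
    using sphere_walk[OF ctx S(2)] by blast
  have "w 0 = w' 0" using w(2)[of 0] w'(2)[of 0] by simp
  hence "0 \<le> e \<and> w 0 = w' 0" by simp
  then obtain m where m: "m \<le> e" "w m = w' m" "\<And>l. l \<le> e \<Longrightarrow> w l = w' l \<Longrightarrow> l \<le> m"
    using ex_has_greatest_nat[of "\<lambda>l. l \<le> e \<and> w l = w' l" 0 "\<lambda>l. l" "Suc e"] by auto
  have me: "m < e" using m(1,2) w(1) w'(1) S(3) by (cases "m = e") auto
  define d where "d = e - m"
  have d: "d \<ge> 1" "e = m + d" "m = e - d" using me by (auto simp: d_def)
  define f where "f j = (if j \<le> d then w (e - j) else w' (m + (j - d)))" for j
  define idx where "idx j = (if j \<le> d then e - j else m + (j - d))" for j
  have idx: "idx j \<le> e" "f j \<in> sphere Z i (idx j)" "role i (idx j) = role i (e + j)" if "j \<le> 2 * d" for j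
  proof -
    show "idx j \<le> e" using that d by (auto simp: idx_def)
    show "f j \<in> sphere Z i (idx j)" using that d by (auto simp: f_def idx_def intro!: w(2) w'(2))
    show "role i (idx j) = role i (e + j)"
      by (rule role_cong) (use that d in \<open>auto simp: idx_def\<close>)
  qed
  have inj: "j = j'" if "j \<le> 2 * d" "j' \<le> 2 * d" "f j = f j'" "j \<le> j'" for j j'
  proof -
    have eq: "idx j = idx j'" using sphere_disjoint[OF ctx] idx(2)[OF that(1)] idx(2)[OF that(2)] that(3) by metis
    show ?thesis
    proof (cases "j \<le> d \<and> d < j'")
      case True
      hence "w (idx j) = w' (idx j)" using that(3) eq by (simp add: f_def idx_def)
      hence "idx j \<le> m" using m(3) idx(1)[OF that(1)] by blast
      moreover have "idx j' = m + (j' - d)" "j' - d > 0" using True by (auto simp: idx_def)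
      ultimately show ?thesis using eq by linarith
    next
      case False
      thus ?thesis using eq that(4) d that by (auto simp: idx_def split: if_splits)
    qed
  qed
  have link: "f (Suc j) \<in> linked (role i (e + j)) (role i (e + Suc j)) (f j)" if "Suc j \<le> 2 * d" for j
  proof (cases "Suc j \<le> d")
    case True
    hence "w (Suc (e - Suc j)) \<in> linked (role i (e - Suc j)) (role i (Suc (e - Suc j))) (w (e - Suc j))"
      using d by (intro w(3)) auto
    moreover have "Suc (e - Suc j) = e - j" using True d by simp
    moreover have "role i (e - Suc j) = role i (e + Suc j)" "role i (e - j) = role i (e + j)"
    proof -
      have "Suc j \<le> e" using True d by simp
      thus "role i (e - Suc j) = role i (e + Suc j)" "role i (e - j) = role i (e + j)"
        by (intro role_cong; presburger)+
    qed
    ultimately show ?thesis using True linked_sym by (simp add: f_def)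
  next
    case False
    have "f j = w' (m + (j - d))"
    proof (cases "j = d")
      case True
      thus ?thesis using m(2) by (simp add: f_def d(3)[symmetric])
    qed (use False in \<open>simp add: f_def\<close>)
    moreover have "f (Suc j) = w' (Suc (m + (j - d)))" using False by (simp add: f_def Suc_diff_le)
    moreover have "role i (m + (j - d)) = role i (e + j)" "role i (Suc (m + (j - d))) = role i (e + Suc j)"
    proof -
      have "d \<le> j" using False by simp
      thus "role i (m + (j - d)) = role i (e + j)" "role i (Suc (m + (j - d))) = role i (e + Suc j)"
        unfolding d(2) by (intro role_cong; presburger)+
    qed
    moreover have "w' (Suc (m + (j - d))) \<in> linked (role i (m + (j - d))) (role i (Suc (m + (j - d)))) (w' (m + (j - d)))"
      using False that d(2) by (intro w'(3)) auto
    ultimately show ?thesis by simp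
  qed
  define As where "As = map f [0..<2 * d + 1]"
  define qs where "qs = take (2 * d + 1) P"
  have qlen: "length qs = 2 * d + 1" using P(3) d(2) by (simp add: qs_def)
  have qn: "qs ! j = P ! j" "pos (qs ! j) = role i (e + j)" if "j < 2 * d + 1" for j
    using that d(2) posP[of j] by (auto simp: qs_def)
  have role_k: "role i t < k" for t using role_props(1)[OF i2] two by simp
  have "\<exists>\<G>. \<G> \<subseteq> members \<and> weak_copy T \<G> \<and> set As \<subseteq> \<G>"
  proof (rule embed_path[OF T big pos, where qs = qs])
    show "path_in (hasse T) qs" unfolding qs_def using P(1) by (intro path_in_take) auto
    show "set qs \<subseteq> Field T" using P(2) unfolding qs_def by (meson in_set_takeD subset_eq)
    show "length As = length qs" by (simp add: As_def qlen)
    have "inj_on f {0..<2 * d + 1}"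
    proof (rule linorder_inj_onI)
      fix x y assume xy: "x < y" "x \<in> {0..<2 * d + 1}" "y \<in> {0..<2 * d + 1}"
      show "f x \<noteq> f y" using inj[of x y] xy by auto
    qed auto
    thus "distinct As" by (simp add: As_def distinct_map del: upt_Suc)
    show "As ! j \<in> layer (pos (qs ! j))" if "j < length qs" for j
    proof -
      have "f j \<in> layer (role i (idx j))" using sphere_props[OF ctx idx(2)[of j]] that by (simp add: qlen)
      thus ?thesis using that qn[of j] idx(3)[of j] by (simp add: qlen As_def del: upt_Suc)
    qed
    have lk: "As ! Suc j \<in> linked (pos (qs ! j)) (pos (qs ! Suc j)) (As ! j)" if "Suc j < length qs" for j
      using link[of j] that qn[of j] qn[of "Suc j"] by (simp add: qlen As_def del: upt_Suc)
    show "As ! j \<subseteq> As ! Suc j" if "Suc j < length qs" "pos (qs ! j) < pos (qs ! Suc j)" for j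
      using linked_up[OF lk[OF that(1)] that(2)] role_k qn[of "Suc j"] that(1) by (auto simp: qlen)
    show "As ! Suc j \<subseteq> As ! j" if "Suc j < length qs" "pos (qs ! Suc j) < pos (qs ! j)" for j
      using linked_down[OF lk[OF that(1)] that(2)] role_k qn[of j] that(1) by (auto simp: qlen)
  qed
  moreover have "S1 \<in> set As"
  proof -
    have "f 0 \<in> set As" by (simp add: As_def del: upt_Suc)
    thus ?thesis using w(1) by (simp add: f_def)
  qed
  moreover have "S2 \<in> set As"
  proof -
    have "f (2 * d) \<in> set As" unfolding As_def set_map by (rule imageI) simp
    moreover have "f (2 * d) = S2" using w'(1) d(1,2) by (simp add: f_def)
    ultimately show ?thesis by simp
  qed
  ultimately show ?thesis by blast
qed

text \<open>
  If single steps are already long, two neighbours of one set \<open>A\<close> suffice, and these are joined by a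
  path with two steps.
\<close>

lemma linked_pair_in_copy:
  fixes T :: "('a \<times> 'a) set"
  assumes T: "tree_poset T" and big: "\<eta> * real n / 4 \<ge> real (card (Field T))"
    and pos: "\<And>u v. (u, v) \<in> T \<Longrightarrow> u \<noteq> v \<Longrightarrow> pos u < pos v" "\<And>v. v \<in> Field T \<Longrightarrow> pos v < k"
    and P: "path_in (hasse T) [p0, p1, p2]" "{p0, p1, p2} \<subseteq> Field T" "pos p2 = pos p0" "pos p0 \<noteq> pos p1"
    and A: "A \<in> layer (pos p1)" and B: "B \<in> linked (pos p1) (pos p0) A" "B' \<in> linked (pos p1) (pos p0) A" "B \<noteq> B'"
  shows "\<exists>\<G>. \<G> \<subseteq> members \<and> weak_copy T \<G> \<and> B \<in> \<G> \<and> B' \<in> \<G>"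
proof -
  have pk: "pos p0 < k" "pos p1 < k" using pos(2) P(2) by auto
  have up: "A \<subset> Y" if "pos p1 < pos p0" "Y \<in> linked (pos p1) (pos p0) A" for Y
    using linked_up[OF that(2,1)] pk by blast
  have down: "Y \<subset> A" if "pos p0 < pos p1" "Y \<in> linked (pos p1) (pos p0) A" for Y
    using linked_down[OF that(2,1)] pk by blast
  have ne: "A \<noteq> B" "A \<noteq> B'" using up down B P(4) by (metis linorder_neqE_nat psubset_eq)+
  have "\<exists>\<G>. \<G> \<subseteq> members \<and> weak_copy T \<G> \<and> set [B, A, B'] \<subseteq> \<G>"
  proof (rule embed_path[OF T big pos P(1)])
    show "set [p0, p1, p2] \<subseteq> Field T" using P(2) by simp
    show "distinct [B, A, B']" using ne B(3) by auto
    have "B \<in> layer (pos p0)" "B' \<in> layer (pos p0)" using B(1,2) subsetD[OF linked_subset] by blast+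
    thus "[B, A, B'] ! j \<in> layer (pos ([p0, p1, p2] ! j))" if "j < length [p0, p1, p2]" for j
      using that A P(3) by (auto simp: less_Suc_eq)
    have upB: "A \<subseteq> B" "A \<subseteq> B'" if "pos p1 < pos p0" using up[OF that] B(1,2) by blast+
    have downB: "B \<subseteq> A" "B' \<subseteq> A" if "pos p0 < pos p1" using down[OF that] B(1,2) by blast+
    have j01: "j = 0 \<or> j = 1" if "Suc j < length [p0, p1, p2]" for j using that by auto
    show "[B, A, B'] ! j \<subseteq> [B, A, B'] ! Suc j"
      if "Suc j < length [p0, p1, p2]" "pos ([p0, p1, p2] ! j) < pos ([p0, p1, p2] ! Suc j)" for j
      using j01[OF that(1)] that(2) upB downB P(3) by (elim disjE) simp_all
    show "[B, A, B'] ! Suc j \<subseteq> [B, A, B'] ! j"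
      if "Suc j < length [p0, p1, p2]" "pos ([p0, p1, p2] ! Suc j) < pos ([p0, p1, p2] ! j)" for j
      using j01[OF that(1)] that(2) upB downB P(3) by (elim disjE) simp_all
  qed auto
  then obtain \<G> where "\<G> \<subseteq> members" "weak_copy T \<G>" "set [B, A, B'] \<subseteq> \<G>" by (elim exE conjE)
  thus ?thesis by (intro exI[of _ \<G>]) simp
qed

end

lemma eventually_large:
  fixes a b :: real
  assumes "a > 0"
  shows "\<forall>\<^sub>F n in sequentially. a * real n \<ge> b"
proof -
  have "\<forall>\<^sub>F n in sequentially. n \<ge> nat \<lceil>b / a\<rceil>" by (rule eventually_ge_at_top)
  thus ?thesis
  proof eventually_elim
    case (elim n)
    hence "b / a \<le> real n" by linarith
    thus ?case using assms by (simp add: field_simps)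
  qed
qed

context tree
begin

text \<open>
  Chains are sorted by the size of their step, all sizes from \<open>e\<close> on forming one class. If the steps
  have at least \<open>e\<close> elements, one step from a fixed set reaches sufficiently many sets; otherwise all
  steps have the same size and the sphere of radius \<open>e\<close> is large.
\<close>

lemma clique_bound_two:
  assumes h: "height T = 2" and e: "e \<ge> 1"
    and P: "path_in (hasse T) P" "set P \<subseteq> Field T" "length P = 2 * e + 1"
  shows "clique_bound T 2 e"
proof -
  define g where "g c = min (card (c ! 1) - card (c ! 0)) e" for c :: "nat set list"
  \<comment> \<open>the two bounds come from one long step and from a walk with \<open>e\<close> short steps\<close>
  define \<delta> where "\<delta> \<eta> = min (\<eta> / (4 * real e) ^ e) ((\<eta> / (8 * 2 ^ (e * e))) ^ e)" for \<eta> :: real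
  have pos: "rank u < rank v" if "(u, v) \<in> T" "u \<noteq> v" for u v using rank_mono[OF that] .
  have pos2: "rank v < 2" if "v \<in> Field T" for v using rank_less_height[OF that] h by simp
  show ?thesis
  proof (rule clique_boundI)
    show "g c < Suc e" for c unfolding g_def by (simp add: less_Suc_eq_le)
    show "\<delta> \<eta> > 0" if "\<eta> > 0" for \<eta> using that e by (simp add: \<delta>_def)
  next
    fix \<eta> :: real assume \<eta>: "\<eta> > 0"
    define \<delta>1 where "\<delta>1 = \<eta> / (4 * real e) ^ e"
    define \<delta>2 where "\<delta>2 = (\<eta> / (8 * 2 ^ (e * e))) ^ e"
    have "\<forall>\<^sub>F n in sequentially. \<eta> / 4 * real n \<ge> real (card (Field T))"
      using \<eta> by (intro eventually_large) simp
    moreover have "\<forall>\<^sub>F n in sequentially. \<eta> * real n \<ge> 8 * real e ^ 3"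
      using \<eta> by (intro eventually_large) simp
    moreover have "\<forall>\<^sub>F n in sequentially. n \<ge> (1 :: nat)" by (rule eventually_ge_at_top)
    ultimately show "\<forall>\<^sub>F n in sequentially. \<forall>C \<sigma>. chain_system n 2 \<eta> C \<longrightarrow> (\<forall>c\<in>C. g c = \<sigma>) \<longrightarrow>
        (\<exists>S. copy_clique T (\<Union>i<2. chain_system.layer C i) S \<and> real (card S) \<ge> \<delta> \<eta> * real n ^ e)"
    proof (eventually_elim, intro allI impI)
      fix n C \<sigma>
      assume n: "real (card (Field T)) \<le> \<eta> / 4 * real n" "8 * real e ^ 3 \<le> \<eta> * real n" "1 \<le> n"
        and C: "chain_system n 2 \<eta> C" and g\<sigma>: "\<forall>c\<in>C. g c = \<sigma>"
      interpret chain_system n 2 \<eta> C by (rule C)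
      have gC: "g c = \<sigma>" if "c \<in> C" for c using g\<sigma> that by blast
      have big: "\<eta> * real n / 4 \<ge> real (card (Field T))" using n(1) by simp
      obtain c0 where c0: "c0 \<in> C" using chain_system.nonempty[OF C] by blast
      have lay_ne: "c0 ! i \<in> layer i" for i using c0 by (auto simp: layer_def)
      have card_lt: "card (c ! 0) < card (c ! 1)" if "c \<in> C" for c using card_nth_mono[OF that, of 0 1] by simp
      have \<sigma>: "1 \<le> \<sigma>" "\<sigma> \<le> e" using gC[OF c0] card_lt[OF c0] e by (auto simp: g_def)
      have inP: "P ! j \<in> Field T" if "j \<le> 2 * e" for j using P(2,3) that by (auto intro!: subsetD[OF P(2)] nth_mem)
      show "\<exists>S. copy_clique T members S \<and> real (card S) \<ge> \<delta> \<eta> * real n ^ e"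
      proof (cases "\<sigma> = e")
        case True
        define i where "i = rank (P ! 1)"
        define i' where "i' = rank (P ! 0)"
        have alt: "rank (P ! j) = role i' j" if "j \<le> 2 * e" for j
          unfolding i'_def using that P by (intro hasse_alternates[OF pos pos2]) auto
        have i2: "i < 2" "i' < 2" unfolding i_def i'_def using e by (auto intro!: pos2 inP)
        have r1: "rank (P ! 1) = role i' 1" "rank (P ! 2) = role i' 2" using alt e by auto
        hence ii: "i \<noteq> i'" "rank (P ! 2) = i'" using i2 by (auto simp: i_def role_def less_2_cases_iff)
        define A where "A = c0 ! i"
        have A: "A \<in> layer i" using lay_ne by (simp add: A_def)
        define S where "S = linked i i' A"
        have gap: "card (c ! 0) + e \<le> card (c ! 1)" if "c \<in> C" for c
          using gC[OF that] card_lt[OF that] True by (auto simp: g_def min_def split: if_splits)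
        have "real (card S) \<ge> \<eta> * (real n / (4 * real e)) ^ e"
          unfolding S_def
        proof (rule card_linked[OF A i2 ii(1) e n(3)])
          fix B assume "B \<in> linked i i' A"
          then obtain c where c: "c \<in> C" "c ! i = A" "c ! i' = B" by (auto simp: linked_def)
          have "i = 0 \<and> i' = 1 \<or> i = 1 \<and> i' = 0" using i2 ii by auto
          thus "card A + e \<le> card B \<or> card B + e \<le> card A" using gap[OF c(1)] c by auto
        qed
        also have "\<eta> * (real n / (4 * real e)) ^ e = \<delta>1 * real n ^ e" by (simp add: \<delta>1_def power_divide)
        finally have "real (card S) \<ge> \<delta> \<eta> * real n ^ e"
          using mult_right_mono[of "\<delta> \<eta>" \<delta>1 "real n ^ e"] by (simp add: \<delta>_def \<delta>1_def \<delta>2_def)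
        moreover have "copy_clique T members S"
          unfolding copy_clique_def
        proof (intro conjI ballI impI)
          show "S \<subseteq> members" using linked_subset[of i i' A] i2 unfolding S_def by blast
          fix B B' assume B: "B \<in> S" "B' \<in> S" "B \<noteq> B'"
          have tk: "take 3 P = [P ! 0, P ! 1, P ! 2]"
            using P(3) e by (intro nth_equalityI) (auto simp: less_Suc_eq numeral_3_eq_3 numeral_2_eq_2)
          show "\<exists>\<G>. \<G> \<subseteq> members \<and> weak_copy T \<G> \<and> B \<in> \<G> \<and> B' \<in> \<G>"
          proof (rule linked_pair_in_copy[OF tree big pos pos2])
            show "path_in (hasse T) [P ! 0, P ! 1, P ! 2]" unfolding tk[symmetric] using P(1) by (intro path_in_take) auto
            show "{P ! 0, P ! 1, P ! 2} \<subseteq> Field T" using inP e by auto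
            show "rank (P ! 2) = rank (P ! 0)" using ii by (simp add: i'_def)
            show "rank (P ! 0) \<noteq> rank (P ! 1)" using ii by (simp add: i_def i'_def)
            show "A \<in> layer (rank (P ! 1))" using A by (simp add: i_def)
            show "B \<in> linked (rank (P ! 1)) (rank (P ! 0)) A" "B' \<in> linked (rank (P ! 1)) (rank (P ! 0)) A"
              using B(1,2) by (simp_all add: S_def i_def i'_def)
          qed (use B in auto)
        qed
        ultimately show ?thesis by blast
      next
        case False
        have step: "card (c ! 1) = card (c ! 0) + \<sigma>" if "c \<in> C" for c
          using gC[OF that] card_lt[OF that] False by (auto simp: g_def min_def split: if_splits)
        define i where "i = rank (P ! e)"
        have i2: "i < 2" unfolding i_def by (intro pos2 inP) simp
        define Z where "Z = c0 ! i"
        have Z: "Z \<in> layer i" using lay_ne by (simp add: Z_def)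
        define S where "S = sphere Z i e"
        have "real (card S) \<ge> (\<eta> * real n / (8 * 2 ^ (e * e))) ^ e"
          unfolding S_def using \<sigma> n by (intro card_sphere[OF HOL.refl step \<sigma>(1) i2 Z]) auto
        also have "(\<eta> * real n / (8 * 2 ^ (e * e))) ^ e = \<delta>2 * real n ^ e"
          by (simp add: \<delta>2_def power_mult_distrib power_divide)
        finally have "real (card S) \<ge> \<delta> \<eta> * real n ^ e"
          using mult_right_mono[of "\<delta> \<eta>" \<delta>2 "real n ^ e"] by (simp add: \<delta>_def \<delta>1_def \<delta>2_def)
        moreover have "copy_clique T members S"
          unfolding copy_clique_def
        proof (intro conjI ballI impI)
          have "S \<subseteq> layer (role i e)" unfolding S_def using sphere_props[OF HOL.refl step \<sigma>(1) i2 Z] by blast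
          thus "S \<subseteq> members" using role_props(1)[OF i2] by blast
          fix B B' assume B: "B \<in> S" "B' \<in> S" "B \<noteq> B'"
          show "\<exists>\<G>. \<G> \<subseteq> members \<and> weak_copy T \<G> \<and> B \<in> \<G> \<and> B' \<in> \<G>"
            using sphere_pair_in_copy[where pos = rank, OF HOL.refl step \<sigma>(1) tree big pos pos2 P i_def Z B[unfolded S_def]] by blast
        qed
        ultimately show ?thesis by blast
      qed
    qed
  qed simp
qed

text \<open>
  The exponent is half the length of a longest path, rounded down: the ends of a subpath of even
  length have the same position, and equal-sized sets of a copy are joined by a path.
\<close>

theorem ar_m_lower_height_two:
  fixes \<epsilon> :: real
  assumes "height T = 2" "\<epsilon> > 0"
  shows "\<exists>\<delta>>0. \<forall>\<^sub>F n in sequentially.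
     real (ar_m n (nat \<lceil>(1 + \<epsilon>) * real (n choose (n div 2))\<rceil>) T) \<ge> \<delta> * real n ^ m_exponent T 2"
proof -
  define Q where "Q = {p. path_in (hasse T) p \<and> set p \<subseteq> Field T}"
  have "length ` Q \<subseteq> {..card (Field T)}"
    using card_mono[OF fin] unfolding Q_def path_in_def by (force simp: distinct_card[symmetric])
  hence finQ: "finite (length ` Q)" by (rule finite_subset) simp
  obtain x where "x \<in> Field T" using field_nonempty by blast
  hence Q1: "[x] \<in> Q" by (simp add: Q_def path_in_def)
  define M where "M = Max (length ` Q)"
  have "M \<in> length ` Q" unfolding M_def using finQ Q1 by (intro Max_in) auto
  then obtain p where p: "p \<in> Q" "length p = M" by auto
  have max: "length q \<le> M" if "q \<in> Q" for q unfolding M_def using finQ that by (intro Max_ge) auto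
  have "M \<ge> 1" using max[OF Q1] by simp
  define e where "e = (M - 1) div 2"
  have e: "2 * e + 1 \<le> M" "M \<le> 2 * e + 2" using \<open>M \<ge> 1\<close> by (auto simp: e_def)
  have near: "copies_near T 2 e"
    unfolding copies_near_def
  proof (intro allI impI)
    fix n \<G> A B
    assume that: "\<G> \<subseteq> middle_layers n 2" "weak_copy T \<G>" "A \<in> \<G>" "B \<in> \<G>" "A \<noteq> B" "card A = card B"
    show "card (A - B) \<le> e"
    proof (rule near_two_layers[OF _ that(1-4,6)])
      fix qs assume "path_in (hasse T) qs" "set qs \<subseteq> Field T"
      hence "length qs \<le> M" by (intro max) (simp add: Q_def)
      thus "length qs \<le> 2 * e + 2" using e(2) by simp
    qed
  qed
  have "clique_bound T 2 e"
  proof (cases "e = 0")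
    case True
    thus ?thesis using clique_bound_zero[of 2] by simp
  next
    case False
    show ?thesis
    proof (rule clique_bound_two[OF assms(1)])
      show "path_in (hasse T) (take (2 * e + 1) p)" using p(1) by (intro path_in_take) (auto simp: Q_def)
      show "set (take (2 * e + 1) p) \<subseteq> Field T" using p(1) unfolding Q_def by (auto dest: in_set_takeD)
    qed (use False p e in auto)
  qed
  from ar_m_lower[OF near this assms(2)] show ?thesis by simp
qed

end

section \<open>Depth and branching\<close>

lemma covers_converse [simp]: "covers (T\<inverse>) p q \<longleftrightarrow> covers T q p"
  by (auto simp: covers_def)

lemma hasse_converse [simp]: "hasse (T\<inverse>) = hasse T"
  by (auto simp: hasse_def)

lemma tree_poset_converse: "tree_poset T \<Longrightarrow> tree_poset (T\<inverse>)"
  by (auto simp: tree_poset_def partial_order_on_def preorder_on_def)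

lemma Chains_converse [simp]: "Chains (T\<inverse>) = Chains T"
  by (auto simp: Chains_def)

lemma height_converse [simp]: "height (T\<inverse>) = height T"
  by (simp add: height_def)

lemma comparable_to_all_converse [simp]: "comparable_to_all (T\<inverse>) = comparable_to_all T"
  by (auto simp: comparable_to_all_def)

lemma up_set_iff: "(u, v) \<in> up_set T a \<longleftrightarrow> (u, v) \<in> T \<and> (a, u) \<in> T \<and> (a, v) \<in> T"
  by (auto simp: up_set_def)

lemma up_set_converse: "up_set (T\<inverse>) a = (down_set T a)\<inverse>"
  by (auto simp: up_set_def down_set_def)

context tree
begin

lemma dual: "tree (T\<inverse>)"
  using tree by (intro tree.intro tree_poset_converse)

lemma upper_cover: "(v, x) \<in> T \<Longrightarrow> x \<noteq> v \<Longrightarrow> \<exists>u. covers T u v \<and> (u, x) \<in> T"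
  using tree.lower_cover[OF dual, of x v] by simp

lemma maximal_above:
  assumes "u \<in> Field T"
  shows "\<exists>x. maximal T x \<and> (u, x) \<in> T"
proof -
  obtain x where x: "(u, x) \<in> T" "\<And>y. (u, y) \<in> T \<Longrightarrow> below y \<le> below x"
    using ex_has_greatest_nat[of "\<lambda>y. (u, y) \<in> T" u below "Suc (card (Field T))"] refl[OF assms] below_le
    by (auto simp: less_Suc_eq_le)
  have "y = x" if "(x, y) \<in> T" for y
    using below_mono[OF that] x(2)[OF trans[OF x(1) that]] by fastforce
  thus ?thesis using x(1) field by (auto simp: maximal_def)
qed

lemma Field_up_set: "a \<in> Field T \<Longrightarrow> Field (up_set T a) = {v. (a, v) \<in> T}"
  using refl field by (fastforce simp: Field_def up_set_iff)

lemma Chains_up_set: "a \<in> Field T \<Longrightarrow> C \<in> Chains (up_set T a) \<longleftrightarrow> C \<in> Chains T \<and> (\<forall>v\<in>C. (a, v) \<in> T)"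
  using refl by (auto simp: Chains_def up_set_iff)

lemma card_chain_le_height_up_set:
  assumes "a \<in> Field T" "C \<in> Chains T" "\<And>v. v \<in> C \<Longrightarrow> (a, v) \<in> T"
  shows "card C \<le> height (up_set T a)"
proof -
  have "finite (Chains (up_set T a))"
    by (rule finite_subset[OF _ finite_Chains]) (use Chains_up_set[OF assms(1)] in blast)
  thus ?thesis unfolding height_def using assms Chains_up_set[OF assms(1)] by (intro Max_ge) auto
qed

lemma height_up_set_attained:
  assumes "a \<in> Field T"
  shows "\<exists>C\<in>Chains T. card C = height (up_set T a) \<and> (\<forall>v\<in>C. (a, v) \<in> T)"
proof -
  have fin: "finite (Chains (up_set T a))"
    by (rule finite_subset[OF _ finite_Chains]) (use Chains_up_set[OF assms] in blast)
  have "{} \<in> Chains (up_set T a)" by (simp add: Chains_def)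
  hence "Max (card ` Chains (up_set T a)) \<in> card ` Chains (up_set T a)" using fin by (intro Max_in) auto
  thus ?thesis unfolding height_def using Chains_up_set[OF assms] by auto
qed

definition depth :: "'a \<Rightarrow> 'a \<Rightarrow> nat" where
  "depth a v = card {u. (a, u) \<in> T \<and> (u, v) \<in> T \<and> u \<noteq> v}"

lemma finite_interval: "finite {u. (a, u) \<in> T \<and> (u, v) \<in> T \<and> u \<noteq> v}"
  by (rule finite_subset[OF _ fin]) (use field in blast)

lemma depth_mono:
  assumes "(a, u) \<in> T" "(u, v) \<in> T" "u \<noteq> v"
  shows "depth a u < depth a v"
  unfolding depth_def
proof (rule psubset_card_mono[OF finite_interval])
  have "u \<in> {w. (a, w) \<in> T \<and> (w, v) \<in> T \<and> w \<noteq> v}" using assms by blast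
  moreover have "{w. (a, w) \<in> T \<and> (w, u) \<in> T \<and> w \<noteq> u} \<subseteq> {w. (a, w) \<in> T \<and> (w, v) \<in> T \<and> w \<noteq> v}"
    using assms trans antisym by blast
  ultimately show "{w. (a, w) \<in> T \<and> (w, u) \<in> T \<and> w \<noteq> u} \<subset> {w. (a, w) \<in> T \<and> (w, v) \<in> T \<and> w \<noteq> v}" by blast
qed

lemma depth_self [simp]: "depth a a = 0"
proof -
  have "{u. (a, u) \<in> T \<and> (u, a) \<in> T \<and> u \<noteq> a} = {}" using antisym by blast
  thus ?thesis by (simp only: depth_def card.empty)
qed

text \<open>
  Everything strictly below \<open>v\<close> and above \<open>a\<close> is below the unique lower cover of \<open>v\<close> above \<open>a\<close>.
\<close>

lemma depth_cover:
  assumes "(a, u) \<in> T" "covers T v u"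
  shows "depth a v = Suc (depth a u)"
proof -
  note c = coversD[OF assms(2)]
  have "{w. (a, w) \<in> T \<and> (w, v) \<in> T \<and> w \<noteq> v} = insert u {w. (a, w) \<in> T \<and> (w, u) \<in> T \<and> w \<noteq> u}"
  proof (intro equalityI subsetI)
    fix w assume w: "w \<in> {w. (a, w) \<in> T \<and> (w, v) \<in> T \<and> w \<noteq> v}"
    then obtain u' where u': "covers T v u'" "(w, u') \<in> T" using lower_cover by blast
    have "u' = u" using unique_lower_cover[OF _ assms(1) u'(1) assms(2)] trans w u'(2) by blast
    thus "w \<in> insert u {w. (a, w) \<in> T \<and> (w, u) \<in> T \<and> w \<noteq> u}" using w u'(2) by blast
  next
    fix w assume "w \<in> insert u {w. (a, w) \<in> T \<and> (w, u) \<in> T \<and> w \<noteq> u}"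
    thus "w \<in> {w. (a, w) \<in> T \<and> (w, v) \<in> T \<and> w \<noteq> v}" using c assms(1) trans antisym by blast
  qed
  thus ?thesis unfolding depth_def using finite_interval by simp
qed

lemma interval_in_Chains: "{u. (a, u) \<in> T \<and> (u, v) \<in> T} \<in> Chains T"
  using interval_chain unfolding Chains_def by blast

lemma depth_less_height:
  assumes "(a, v) \<in> T"
  shows "depth a v < height (up_set T a)"
proof -
  have a: "a \<in> Field T" "v \<in> Field T" using field[OF assms] by auto
  have "{u. (a, u) \<in> T \<and> (u, v) \<in> T} = insert v {u. (a, u) \<in> T \<and> (u, v) \<in> T \<and> u \<noteq> v}"
    using assms refl a by blast
  hence "card {u. (a, u) \<in> T \<and> (u, v) \<in> T} = Suc (depth a v)"
    unfolding depth_def using finite_interval by simp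
  moreover have "card {u. (a, u) \<in> T \<and> (u, v) \<in> T} \<le> height (up_set T a)"
    by (intro card_chain_le_height_up_set a interval_in_Chains) blast
  ultimately show ?thesis by simp
qed

lemma covers_up_set: "covers (up_set T a) v u \<longleftrightarrow> covers T v u \<and> (a, u) \<in> T"
proof
  assume c: "covers (up_set T a) v u"
  hence uv: "(u, v) \<in> T" "(a, u) \<in> T" "u \<noteq> v" by (auto simp: covers_def up_set_iff)
  have "\<not> (\<exists>z. (u, z) \<in> T \<and> (z, v) \<in> T \<and> z \<noteq> u \<and> z \<noteq> v)"
    using c trans uv unfolding covers_def up_set_iff by blast
  thus "covers T v u \<and> (a, u) \<in> T" using uv by (simp add: covers_def)
next
  assume "covers T v u \<and> (a, u) \<in> T"
  thus "covers (up_set T a) v u" using trans unfolding covers_def up_set_iff by blast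
qed

lemma hasse_up_set: "(u, v) \<in> hasse (up_set T a) \<longleftrightarrow> (u, v) \<in> hasse T \<and> (a, u) \<in> T \<and> (a, v) \<in> T"
  using coversD trans by (auto simp: hasse_def covers_up_set)

lemma hasse_depth:
  assumes "(u, v) \<in> hasse (up_set T a)"
  shows "covers T v u \<and> depth a v = Suc (depth a u) \<or> covers T u v \<and> depth a u = Suc (depth a v)"
  using assms depth_cover unfolding hasse_up_set by (auto simp: hasse_def)

lemma depth_le_walk: "(a, v) \<in> hasse (up_set T a) ^^ m \<Longrightarrow> depth a v \<le> m"
proof (induction m arbitrary: v)
  case (Suc m)
  then obtain u where "(a, u) \<in> hasse (up_set T a) ^^ m" "(u, v) \<in> hasse (up_set T a)" by auto
  thus ?case using Suc.IH[of u] hasse_depth[of u v a] by linarith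
qed auto

lemma depth_walk: "(a, v) \<in> T \<Longrightarrow> (a, v) \<in> hasse (up_set T a) ^^ depth a v"
proof (induction "below v" arbitrary: v rule: less_induct)
  case less
  show ?case
  proof (cases "a = v")
    case False
    obtain u where u: "covers T v u" "(a, u) \<in> T" using lower_cover[OF less.prems False] by blast
    have "(a, u) \<in> hasse (up_set T a) ^^ depth a u"
      using less.hyps[OF below_mono[OF coversD[OF u(1)]] u(2)] .
    moreover have "(u, v) \<in> hasse (up_set T a)"
      unfolding hasse_up_set using u less.prems by (simp add: hasse_def)
    ultimately show ?thesis unfolding depth_cover[OF u(2,1)] by (rule relpow_Suc_I)
  qed simp
qed

lemma graph_dist_depth:
  assumes "(a, v) \<in> T"
  shows "graph_dist (hasse (up_set T a)) a v = depth a v"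
  unfolding graph_dist_def
  by (rule Least_equality) (use depth_walk[OF assms] depth_le_walk in auto)

text \<open>
  A path that has gone up once cannot turn: going down again would lead to the lower cover it came
  from.
\<close>

lemma ascending_from_minimum:
  assumes p: "path_in (hasse (up_set T a)) p" and m: "m < length p"
    and min: "\<And>l. l < length p \<Longrightarrow> depth a (p ! m) \<le> depth a (p ! l)"
    and l: "m \<le> l" "Suc l < length p"
  shows "covers T (p ! Suc l) (p ! l)"
  using l
proof (induction l rule: dec_induct)
  case base
  have "(p ! m, p ! Suc m) \<in> hasse (up_set T a)" using p base by (rule path_in_nth)
  thus ?case using hasse_depth min[of "Suc m"] base by fastforce
next
  case (step l)
  have 1: "(p ! l, p ! Suc l) \<in> hasse (up_set T a)" and 2: "(p ! Suc l, p ! Suc (Suc l)) \<in> hasse (up_set T a)"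
    using p step.prems by (auto intro: path_in_nth)
  have c: "covers T (p ! Suc l) (p ! l)" using step by simp
  show ?case
  proof (rule ccontr)
    assume "\<not> ?case"
    hence "covers T (p ! Suc l) (p ! Suc (Suc l))" using hasse_depth[OF 2] by blast
    hence "p ! l = p ! Suc (Suc l)"
      using unique_lower_cover[OF _ _ c] 1 2 unfolding hasse_up_set by blast
    thus False using p step.prems by (simp add: path_in_def nth_eq_iff_index_eq)
  qed
qed

lemma path_in_rev:
  assumes "path_in E p" "sym E"
  shows "path_in E (rev p)"
proof -
  have "successively (\<lambda>x y. (x, y) \<in> E) p" using assms(1) by (simp add: path_in_def)
  hence "successively (\<lambda>x y. (y, x) \<in> E) p"
    by (rule successively_mono) (rule symD[OF assms(2)])
  thus ?thesis using assms(1) by (simp add: path_in_def successively_rev)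
qed

text \<open>
  The vertex of minimal depth on a path between two leaves is a fork, from which the path ascends
  in both directions.
\<close>

lemma branching_fork:
  assumes a: "a \<in> Field T" and br: "branches_at (up_set T a) t"
  shows "\<exists>p m. path_in (hasse T) p \<and> set p \<subseteq> {v. (a, v) \<in> T} \<and> 0 < m \<and> Suc m < length p \<and>
     maximal T (hd p) \<and> maximal T (last p) \<and> depth a (p ! m) = t \<and>
     (\<forall>l. m \<le> l \<longrightarrow> Suc l < length p \<longrightarrow> covers T (p ! Suc l) (p ! l)) \<and>
     (\<forall>l<m. covers T (p ! l) (p ! Suc l))"
proof -
  let ?U = "up_set T a"
  obtain r x y p where sm: "smallest ?U r" and mx: "maximal ?U x" "maximal ?U y" "x \<noteq> y"
    and p: "path_between (hasse ?U) x y p" and mn: "Min ((\<lambda>z. graph_dist (hasse ?U) r z) ` set p) = t"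
    using br unfolding branches_at_def by blast
  have FU: "Field ?U = {v. (a, v) \<in> T}" using a by (rule Field_up_set)
  have "r = a"
    using sm refl[OF a] antisym unfolding smallest_def FU by (auto simp: up_set_iff)
  have pin: "path_in (hasse ?U) p" and hl: "hd p = x" "last p = y" using p by (auto simp: path_between_def)
  have pne: "p \<noteq> []" using pin by (simp add: path_in_def)
  have x: "x = p ! 0" "y = p ! (length p - 1)" using hl pne by (auto simp: hd_conv_nth last_conv_nth)
  have "length p \<noteq> 1" using mx(3) x by auto
  hence len: "length p \<ge> 2" using pne by (cases p) (auto simp: Suc_le_eq)
  have inU: "(a, p ! l) \<in> T" if "l < length p" for l
  proof (cases l)
    case 0
    have "(p ! 0, p ! Suc 0) \<in> hasse ?U" using len by (intro path_in_nth[OF pin]) simp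
    thus ?thesis using 0 by (simp add: hasse_up_set)
  next
    case (Suc l')
    have "(p ! l', p ! Suc l') \<in> hasse ?U" using that Suc by (intro path_in_nth[OF pin]) simp
    thus ?thesis using Suc by (simp add: hasse_up_set)
  qed
  have setU: "set p \<subseteq> {v. (a, v) \<in> T}" using inU by (auto simp: in_set_conv_nth)
  have "(\<lambda>z. graph_dist (hasse ?U) r z) ` set p = depth a ` set p"
    unfolding \<open>r = a\<close> using setU graph_dist_depth by (intro image_cong) auto
  hence mn': "Min (depth a ` set p) = t" using mn by simp
  hence "t \<in> depth a ` set p" using pne by (metis List.finite_set Min_in finite_imageI image_is_empty set_empty)
  then obtain m where m: "m < length p" "depth a (p ! m) = t" by (auto simp: in_set_conv_nth)
  have min: "depth a (p ! m) \<le> depth a (p ! l)" if "l < length p" for l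
  proof -
    have "Min (depth a ` set p) \<le> depth a (p ! l)" using that by (intro Min_le) auto
    thus ?thesis using m(2) mn' by simp
  qed
  have right: "covers T (p ! Suc l) (p ! l)" if "m \<le> l" "Suc l < length p" for l
    using ascending_from_minimum[OF pin m(1) min that] .
  have left: "covers T (p ! l) (p ! Suc l)" if "l < m" for l
  proof -
    define m' where "m' = length p - Suc m"
    define l' where "l' = length p - Suc (Suc l)"
    have "covers T (rev p ! Suc l') (rev p ! l')"
    proof (rule ascending_from_minimum[OF path_in_rev[OF pin sym_hasse], of m'])
      show "depth a (rev p ! m') \<le> depth a (rev p ! l)" if "l < length (rev p)" for l
        using that m(1) min[of "length p - Suc l"] by (simp add: m'_def rev_nth Suc_diff_Suc)
    qed (use m(1) that in \<open>auto simp: m'_def l'_def\<close>)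
    moreover have "rev p ! Suc l' = p ! l" "rev p ! l' = p ! Suc l"
      using that m(1) by (auto simp: l'_def rev_nth Suc_diff_Suc)
    ultimately show ?thesis by simp
  qed
  have mxT: "maximal T v" if "maximal ?U v" for v
    using that unfolding maximal_def FU up_set_iff using trans field by blast
  have "m \<noteq> 0"
  proof
    assume "m = 0"
    hence "covers T (p ! 1) x" using right[of 0] len x by simp
    thus False using mxT[OF mx(1)] coversD unfolding maximal_def by metis
  qed
  moreover have "Suc m \<noteq> length p"
  proof
    assume "Suc m = length p"
    hence "covers T (p ! (m - 1)) y" using left[of "m - 1"] \<open>m \<noteq> 0\<close> x by (auto simp: \<open>Suc m = length p\<close>[symmetric])
    thus False using mxT[OF mx(2)] coversD unfolding maximal_def by metis
  qed
  moreover have "path_in (hasse T) p"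
    using pin unfolding path_in_def by (auto elim!: successively_mono simp: hasse_up_set)
  ultimately show ?thesis
    using m mxT[OF mx(1)] mxT[OF mx(2)] hl setU left right
    by (intro exI[of _ p] exI[of _ m]) auto
qed

text \<open>
  An upper cover \<open>u1\<close> of \<open>a\<close> is not comparable to all elements, by the choice of \<open>a\<close>. An element
  incomparable to \<open>u1\<close> lies above a second upper cover \<open>u2\<close>. No element is above both covers, so
  ascending paths through them to two leaves form a path with lowest vertex \<open>a\<close>.
\<close>

lemma branches_at_root:
  assumes a: "a \<in> comparable_to_all T" "\<And>y. y \<in> comparable_to_all T \<Longrightarrow> (y, a) \<in> T"
    and h: "height (up_set T a) \<ge> 2"
  shows "branches_at (up_set T a) 0"
proof -
  let ?U = "up_set T a"
  have aF: "a \<in> Field T" using a(1) by (simp add: comparable_to_all_def)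
  have "\<exists>v. (a, v) \<in> T \<and> v \<noteq> a"
  proof (rule ccontr)
    assume no: "\<not> ?thesis"
    obtain K where K: "K \<in> Chains T" "card K = height ?U" "\<forall>v\<in>K. (a, v) \<in> T"
      using height_up_set_attained[OF aF] by blast
    hence "K \<subseteq> {a}" using no by blast
    hence "card K \<le> 1" using card_mono[of "{a}" K] by simp
    thus False using K(2) h by simp
  qed
  then obtain v where v: "(a, v) \<in> T" "v \<noteq> a" by blast
  obtain u1 where u1: "covers T u1 a" "(u1, v) \<in> T" using upper_cover[OF v] by blast
  note c1 = coversD[OF u1(1)]
  have "u1 \<notin> comparable_to_all T" using a(2) c1 antisym by blast
  then obtain w where w: "w \<in> Field T" "(u1, w) \<notin> T" "(w, u1) \<notin> T"
    using c1 field unfolding comparable_to_all_def by blast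
  have aw: "(a, w) \<in> T" "w \<noteq> a" using a(1) w c1 trans unfolding comparable_to_all_def by blast+
  obtain u2 where u2: "covers T u2 a" "(u2, w) \<in> T" using upper_cover[OF aw] by blast
  note c2 = coversD[OF u2(1)]
  have ne: "u1 \<noteq> u2" using w(2) u2(2) by blast
  have nocommon: False if "(u1, s) \<in> T" "(u2, s) \<in> T" for s
  proof -
    have "(u1, u2) \<in> T \<or> (u2, u1) \<in> T" using interval_chain[OF c1(1) c2(1) that] .
    thus False using u1(1) u2(1) c1 c2 ne unfolding covers_def by blast
  qed
  have abv: "(u, s) \<in> T" if "covers T u a" "(u, x) \<in> T" "(a, s) \<in> T" "(s, x) \<in> T" "s \<noteq> a" for u s x
  proof -
    have "(u, s) \<in> T \<or> (s, u) \<in> T" using interval_chain[of a u s x] coversD[OF that(1)] that by blast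
    thus ?thesis using that(1,3,5) refl field unfolding covers_def by blast
  qed
  obtain x where x: "maximal T x" "(u1, x) \<in> T" using maximal_above[of u1] field c1 by blast
  obtain y where y: "maximal T y" "(u2, y) \<in> T" using maximal_above[of u2] field c2 by blast
  have ax: "(a, x) \<in> T" "(a, y) \<in> T" using c1 c2 x(2) y(2) trans by blast+
  have xy: "x \<noteq> y" using nocommon x(2) y(2) by blast
  obtain q1 where q1: "set q1 \<subseteq> {s. (a, s) \<in> T \<and> (s, x) \<in> T}" "path_between (hasse T) a x q1"
    using path_of_rtrancl[OF interval_connected[OF ax(1)]] refl aF ax by blast
  obtain q2 where q2: "set q2 \<subseteq> {s. (a, s) \<in> T \<and> (s, y) \<in> T}" "path_between (hasse T) a y q2"
    using path_of_rtrancl[OF interval_connected[OF ax(2)]] refl aF ax by blast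
  have p1: "path_in (hasse T) q1" "hd q1 = a" "last q1 = x" "q1 \<noteq> []"
    and p2: "path_in (hasse T) q2" "hd q2 = a" "last q2 = y" "q2 \<noteq> []"
    using q1(2) q2(2) by (auto simp: path_between_def path_in_def)
  obtain r2 where r2: "q2 = a # r2" using p2 by (cases q2) auto
  have r2ne: "r2 \<noteq> []"
  proof
    assume "r2 = []"
    hence "y = a" using p2(3) r2 by simp
    thus False using y(2) c2 antisym by blast
  qed
  have disj: "set q1 \<inter> set r2 = {}"
  proof (rule ccontr)
    assume "set q1 \<inter> set r2 \<noteq> {}"
    then obtain s where s: "s \<in> set q1" "s \<in> set r2" by blast
    have "s \<noteq> a" using s(2) p2(1) unfolding r2 path_in_def by auto
    moreover have "(a, s) \<in> T" "(s, x) \<in> T" "(s, y) \<in> T" using s q1(1) q2(1) r2 by auto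
    ultimately have "(u1, s) \<in> T" "(u2, s) \<in> T"
      using abv[OF u1(1) x(2)] abv[OF u2(1) y(2)] by blast+
    thus False by (rule nocommon)
  qed
  define p where "p = rev q1 @ r2"
  have setp: "set p \<subseteq> {s. (a, s) \<in> T}" using q1(1) q2(1) r2 by (auto simp: p_def)
  have "path_in (hasse T) p"
  proof -
    have r1: "path_in (hasse T) (rev q1)" using p1(1) sym_hasse by (rule path_in_rev)
    have "last (rev q1) = a" using p1 by (simp add: last_rev)
    moreover have "(a, hd r2) \<in> hasse T" "successively (\<lambda>x y. (x, y) \<in> hasse T) r2" "distinct r2"
      using p2(1) r2ne unfolding r2 path_in_def by (auto simp: successively_Cons)
    ultimately show ?thesis
      using r1 disj r2ne unfolding p_def path_in_def by (auto simp: successively_append_iff)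
  qed
  hence "path_in (hasse ?U) p"
  proof -
    assume pp: "path_in (hasse T) p"
    have "successively (\<lambda>x y. (x, y) \<in> hasse ?U) p"
      using pp setp unfolding path_in_def by (auto elim!: successively_mono simp: hasse_up_set)
    thus ?thesis using pp by (simp add: path_in_def)
  qed
  moreover have "hd p = x" "last p = y"
    using p1 p2(3) r2ne r2 by (auto simp: p_def hd_rev hd_append)
  ultimately have pb: "path_between (hasse ?U) x y p" by (simp add: path_between_def)
  have FU: "Field ?U = {v. (a, v) \<in> T}" using aF by (rule Field_up_set)
  have "smallest ?U a" unfolding smallest_def FU using refl[OF aF] by (auto simp: up_set_iff)
  moreover have "maximal ?U x" "maximal ?U y"
    using x(1) y(1) ax unfolding maximal_def FU up_set_iff by auto
  moreover have "Min ((\<lambda>z. graph_dist (hasse ?U) a z) ` set p) = 0"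
  proof -
    have "a \<in> set p" using p1 by (auto simp: p_def intro: hd_in_set)
    hence "graph_dist (hasse ?U) a a \<in> (\<lambda>z. graph_dist (hasse ?U) a z) ` set p" by blast
    hence "Min ((\<lambda>z. graph_dist (hasse ?U) a z) ` set p) \<le> graph_dist (hasse ?U) a a" by (intro Min_le) auto
    thus ?thesis using graph_dist_depth[OF refl[OF aF]] by simp
  qed
  ultimately show ?thesis unfolding branches_at_def using pb xy by blast
qed

lemma branches_everywhere:
  assumes a: "a \<in> comparable_to_all T" "\<And>y. y \<in> comparable_to_all T \<Longrightarrow> (y, a) \<in> T"
    and h: "height (up_set T a) \<ge> 2" and br: "upward_branching (up_set T a)"
    and t: "t + 2 \<le> height (up_set T a)"
  shows "branches_at (up_set T a) t"
  using t
proof (induction t)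
  case 0
  show ?case using a h by (rule branches_at_root)
next
  case (Suc t)
  hence "branches_at (up_set T a) t" by simp
  moreover have "int t < int (height (up_set T a)) - 2" using Suc.prems by simp
  ultimately show ?case using br unfolding upward_branching_def by (metis Suc_eq_plus1)
qed

end

section \<open>Two leaves above a fork\<close>

context chain_system
begin

text \<open>
  Two chains \<open>\<alpha>\<close> and \<open>\<beta>\<close> of the system that agree in position \<open>j\<close> have a last common set, in position
  \<open>i\<close>. The tree has a fork \<open>z\<close> at depth \<open>t = min (i - j) (H - 2)\<close>, whose image is that common set. The
  choice of \<open>t\<close> leaves enough positions below \<open>z\<close>, because \<open>t \<le> i - j\<close>, and above \<open>z\<close>: either \<open>z\<close> has its
  natural position \<open>j + t\<close>, or \<open>z\<close> lies directly below the leaves of maximal depth. The two leaves are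
  moved up to the last position.
\<close>

lemma tops_pair_in_copy:
  fixes T :: "('a \<times> 'a) set"
  assumes T: "tree_poset T" and big: "\<eta> * real n / 4 \<ge> real (card (Field T))"
    and a: "a \<in> comparable_to_all T" "\<And>y. y \<in> comparable_to_all T \<Longrightarrow> (y, a) \<in> T"
    and h: "height (up_set T a) \<ge> 2" and br: "upward_branching (up_set T a)"
    and j: "j = tree.rank T a" and k: "j + height (up_set T a) \<le> k"
    and c: "\<alpha> \<in> C" "\<beta> \<in> C" "\<alpha> ! j = \<beta> ! j" "\<alpha> ! (k - 1) \<noteq> \<beta> ! (k - 1)"
  shows "\<exists>\<G>. \<G> \<subseteq> members \<and> weak_copy T \<G> \<and> \<alpha> ! (k - 1) \<in> \<G> \<and> \<beta> ! (k - 1) \<in> \<G>"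
proof -
  interpret tree T by unfold_locales (rule T)
  define H where "H = height (up_set T a)"
  have H: "H \<ge> 2" "j + H \<le> k" using h k by (simp_all add: H_def)
  have aF: "a \<in> Field T" using a(1) by (simp add: comparable_to_all_def)
  have acomp: "(a, v) \<in> T \<or> (v, a) \<in> T" if "v \<in> Field T" for v
    using a(1) that by (simp add: comparable_to_all_def)
  define M where "M l \<longleftrightarrow> l < k - 1 \<and> \<alpha> ! l = \<beta> ! l" for l
  have "M j" using H c(3) by (simp add: M_def)
  moreover have "\<forall>l. M l \<longrightarrow> l < k" by (auto simp: M_def)
  ultimately obtain i where iM: "M i" "\<And>l. M l \<Longrightarrow> l \<le> i" using ex_has_greatest_nat[of M j "\<lambda>l. l" k] by blast
  hence i: "i < k - 1" "\<alpha> ! i = \<beta> ! i" "\<And>l. l < k - 1 \<Longrightarrow> \<alpha> ! l = \<beta> ! l \<Longrightarrow> l \<le> i" and ji: "j \<le> i"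
    using \<open>M j\<close> by (auto simp: M_def)
  define t where "t = min (i - j) (H - 2)"
  have t: "t \<le> i - j" "t + 2 \<le> H" "t = i - j \<or> t = H - 2" using H by (auto simp: t_def)
  obtain p m where p: "path_in (hasse T) p" "set p \<subseteq> {v. (a, v) \<in> T}" "0 < m" "Suc m < length p"
    "maximal T (hd p)" "maximal T (last p)" "depth a (p ! m) = t"
    and right: "\<And>l. m \<le> l \<Longrightarrow> Suc l < length p \<Longrightarrow> covers T (p ! Suc l) (p ! l)"
    and left: "\<And>l. l < m \<Longrightarrow> covers T (p ! l) (p ! Suc l)"
    using branching_fork[OF aF branches_everywhere[OF a h br t(2)[unfolded H_def]]] by blast
  define L where "L = length p - 1"
  have L: "m < L" "length p = Suc L" using p(4) by (auto simp: L_def)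
  define x where "x = p ! 0"
  define y where "y = p ! L"
  define z where "z = p ! m"
  have dp: "distinct p" "p \<noteq> []" using p(1) by (auto simp: path_in_def)
  have mx: "maximal T x" "maximal T y" using p(5,6) dp by (auto simp: x_def y_def L_def hd_conv_nth last_conv_nth)
  have ap: "(a, p ! l) \<in> T" if "l \<le> L" for l
  proof -
    have "p ! l \<in> set p" using L that by simp
    thus ?thesis using p(2) by blast
  qed
  have az: "(a, z) \<in> T" using ap L by (simp add: z_def)
  have dz: "depth a z = t" using p(7) by (simp add: z_def)
  have pR: "(p ! l, p ! l') \<in> T" if "m \<le> l" "l \<le> l'" "l' \<le> L" for l l'
    using that(2,3)
  proof (induction l' rule: dec_induct)
    case base
    thus ?case using refl[of "p ! l"] field[OF ap[of l]] by simp
  next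
    case (step q)
    have "(p ! q, p ! Suc q) \<in> T" using coversD[OF right[of q]] step that(1) L by simp
    moreover have "(p ! l, p ! q) \<in> T" using step by simp
    ultimately show ?case using trans by blast
  qed
  have pL: "(p ! l', p ! l) \<in> T" if "l \<le> l'" "l' \<le> m" for l l'
    using that
  proof (induction l' rule: dec_induct)
    case base
    thus ?case using refl[of "p ! l"] field[OF ap[of l]] L by simp
  next
    case (step q)
    have "(p ! Suc q, p ! q) \<in> T" using coversD[OF left[of q]] step by simp
    moreover have "(p ! q, p ! l) \<in> T" using step by simp
    ultimately show ?case using trans by blast
  qed
  have pz: "(z, p ! l) \<in> T" if "l \<le> L" for l
    using pR[of m l] pL[of l m] that L unfolding z_def by (cases "l \<le> m") auto
  have pinj: "l = l'" if "p ! l = p ! l'" "l \<le> L" "l' \<le> L" for l l'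
    using that dp L by (simp add: nth_eq_iff_index_eq)
  have xz: "x \<noteq> z" "y \<noteq> z" using pinj[of 0 m] pinj[of L m] p(3) L unfolding x_def y_def z_def by auto
  have mxD: "v = u" if "maximal T u" "(u, v) \<in> T" for u v using that unfolding maximal_def by blast
  have dH: "depth a v < H" if "(a, v) \<in> T" for v using depth_less_height[OF that] by (simp add: H_def)
  have dH': "depth a v + 2 \<le> H" if "(a, v) \<in> T" "(v, w) \<in> T" "v \<noteq> w" for v w
    using depth_mono[OF that] dH[of w] trans[OF that(1,2)] by simp
  \<comment> \<open>below \<open>z\<close> every element has its natural position; the part above \<open>z\<close> is shifted so that \<open>z\<close> gets position \<open>i\<close>\<close>
  define pos where "pos v = (if v = x \<or> v = y then k - 1 else if (z, v) \<in> T then i + (depth a v - t)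
     else if (a, v) \<in> T then j + depth a v else rank v)" for v
  have zdep: "t \<le> depth a v" if "(z, v) \<in> T" for v
    using that depth_mono[OF az that] dz by (cases "z = v") auto
  have nonmax: "pos v < k - 1" if v: "v \<noteq> x" "v \<noteq> y" "(v, w) \<in> T" "v \<noteq> w" for v w
  proof -
    consider "(z, v) \<in> T" | "(z, v) \<notin> T" "(a, v) \<in> T" | "(z, v) \<notin> T" "(a, v) \<notin> T" by blast
    thus ?thesis
    proof cases
      case 1
      have "depth a v + 2 \<le> H" using dH'[OF trans[OF az 1] v(3,4)] .
      hence "i + (depth a v - t) < k - 1" using t H i(1) ji zdep[OF 1] by auto
      thus ?thesis using 1 v(1,2) by (simp add: pos_def)
    next
      case 2
      have "depth a v + 2 \<le> H" using dH'[OF 2(2) v(3,4)] .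
      thus ?thesis using 2 v(1,2) H by (simp add: pos_def)
    next
      case 3
      have "(v, a) \<in> T" "v \<noteq> a" using acomp[of v] field[OF v(3)] 3 refl[OF aF] by auto
      hence "rank v < j" unfolding j by (rule rank_mono)
      thus ?thesis using 3 v(1,2) H by (simp add: pos_def)
    qed
  qed
  have pos_mono: "pos u < pos v" if uv: "(u, v) \<in> T" "u \<noteq> v" for u v
  proof -
    have ux: "u \<noteq> x" "u \<noteq> y" using mxD mx uv by blast+
    show ?thesis
    proof (cases "v = x \<or> v = y")
      case True
      thus ?thesis using nonmax[OF ux uv] by (auto simp: pos_def)
    next
      case False
      hence v: "v \<noteq> x" "v \<noteq> y" by auto
      consider "(z, u) \<in> T" | "(z, u) \<notin> T" "(a, u) \<in> T" | "(z, u) \<notin> T" "(a, u) \<notin> T" by blast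
      thus ?thesis
      proof cases
        case 1
        have "depth a u < depth a v" using depth_mono[OF trans[OF az 1] uv] .
        moreover have "(z, v) \<in> T" using trans[OF 1 uv(1)] .
        ultimately show ?thesis using 1 ux v zdep[OF 1] by (simp add: pos_def)
      next
        case 2
        have d: "depth a u < depth a v" using depth_mono[OF 2(2) uv] .
        have av: "(a, v) \<in> T" using trans[OF 2(2) uv(1)] .
        show ?thesis
        proof (cases "(z, v) \<in> T")
          case True
          have "j + depth a u < i + (depth a v - t)" using d t(1) ji zdep[OF True] by linarith
          thus ?thesis using True 2 ux v by (simp add: pos_def)
        next
          case False
          thus ?thesis using 2 ux v d av by (simp add: pos_def)
        qed
      next
        case 3
        have ua: "(u, a) \<in> T" "u \<noteq> a" using acomp[of u] field[OF uv(1)] 3 refl[OF aF] by auto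
        hence "rank u < j" unfolding j by (intro rank_mono)
        moreover have "rank u < rank v" using uv by (rule rank_mono)
        ultimately show ?thesis using 3 ux v ji by (auto simp: pos_def)
      qed
    qed
  qed
  have pos_k: "pos v < k" if vF: "v \<in> Field T" for v
  proof -
    consider "v = x \<or> v = y" | "v \<noteq> x" "v \<noteq> y" "(z, v) \<in> T" | "v \<noteq> x" "v \<noteq> y" "(z, v) \<notin> T" "(a, v) \<in> T"
      | "v \<noteq> x" "v \<noteq> y" "(z, v) \<notin> T" "(a, v) \<notin> T" by blast
    thus ?thesis
    proof cases
      case 1
      thus ?thesis using H by (auto simp: pos_def)
    next
      case 2
      have "i + (depth a v - t) < k"
        using dH[OF trans[OF az 2(3)]] t H i(1) ji zdep[OF 2(3)] by auto
      thus ?thesis using 2 by (simp add: pos_def)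
    next
      case 3
      thus ?thesis using dH[OF 3(4)] H by (simp add: pos_def)
    next
      case 4
      have "(v, a) \<in> T" "v \<noteq> a" using acomp[OF vF] 4 refl[OF aF] by auto
      hence "rank v < j" unfolding j by (rule rank_mono)
      thus ?thesis using 4 H by (simp add: pos_def)
    qed
  qed
  have pos_z: "pos z = i" using xz dz refl field[OF az] by (auto simp: pos_def)
  have pF: "p ! l \<in> Field T" if "l \<le> L" for l using field[OF ap[OF that]] by simp
  have pos_gt: "i < pos (p ! l)" if "l \<le> L" "l \<noteq> m" for l
  proof -
    have "z \<noteq> p ! l" using pinj[of l m] that L unfolding z_def by auto
    thus ?thesis using pos_mono[OF pz[OF that(1)]] pos_z by simp
  qed
  have pos_inj: "l = l'" if "pos (p ! l) = pos (p ! l')" "l \<le> L" "l' \<le> L" "l \<le> m \<and> l' \<le> m \<or> m \<le> l \<and> m \<le> l'" for l l'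
  proof (rule ccontr)
    assume ne: "l \<noteq> l'"
    have ne': "p ! l \<noteq> p ! l'" using pinj that ne by blast
    have "(p ! l, p ! l') \<in> T \<or> (p ! l', p ! l) \<in> T"
      using that pL[of l l'] pL[of l' l] pR[of l l'] pR[of l' l] by (metis nat_le_linear)
    thus False using pos_mono[of "p ! l" "p ! l'"] pos_mono[of "p ! l'" "p ! l"] that(1) ne' by auto
  qed
  have apart: "\<alpha> ! q \<noteq> \<beta> ! q'" if "i < q" "q < k" "q' < k" for q q'
  proof
    assume eq: "\<alpha> ! q = \<beta> ! q'"
    have "q = q'" using roles[OF c(1,2) that(2,3) eq] .
    hence eq': "\<alpha> ! q = \<beta> ! q" using eq by simp
    show False
    proof (cases "q = k - 1")
      case True
      thus False using eq' c(4) by simp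
    next
      case False
      hence "q < k - 1" using that by linarith
      thus False using i(3)[OF _ eq'] that(1) by simp
    qed
  qed
  \<comment> \<open>descending along \<open>\<alpha>\<close> to the common set, then ascending along \<open>\<beta>\<close>\<close>
  define f where "f l = (if l \<le> m then \<alpha> ! pos (p ! l) else \<beta> ! pos (p ! l))" for l
  have fR: "f l = \<beta> ! pos (p ! l)" if "m \<le> l" for l
    using that i(2) pos_z by (cases "l = m") (auto simp: f_def z_def)
  have fL: "f l = \<alpha> ! pos (p ! l)" if "l \<le> m" for l using that by (simp add: f_def)
  have finj: "l = l'" if ll: "l \<le> L" "l' \<le> L" "f l = f l'" "l \<le> l'" for l l'
  proof -
    have pk: "pos (p ! l) < k" "pos (p ! l') < k" using pos_k pF ll(1,2) by auto
    consider "l' \<le> m" | "m \<le> l" | "l < m" "m < l'" using ll(4) by linarith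
    thus ?thesis
    proof cases
      case 1
      hence "\<alpha> ! pos (p ! l) = \<alpha> ! pos (p ! l')" using ll(3,4) fL[of l] fL[of l'] by simp
      hence "pos (p ! l) = pos (p ! l')" by (rule roles[OF c(1,1) pk])
      thus ?thesis using pos_inj[of l l'] ll 1 by simp
    next
      case 2
      hence "\<beta> ! pos (p ! l) = \<beta> ! pos (p ! l')" using ll(3,4) fR[of l] fR[of l'] by simp
      hence "pos (p ! l) = pos (p ! l')" by (rule roles[OF c(2,2) pk])
      thus ?thesis using pos_inj[of l l'] ll 2 by simp
    next
      case 3
      hence "\<alpha> ! pos (p ! l) = \<beta> ! pos (p ! l')" using ll(3) by (simp add: f_def)
      thus ?thesis using apart[of "pos (p ! l)" "pos (p ! l')"] pos_gt[of l] pk 3 ll(1) by simp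
    qed
  qed
  have flay: "f l \<in> layer (pos (p ! l))" for l
    using c(1,2) by (auto simp: f_def layer_def)
  have fstep: "(pos (p ! l) < pos (p ! Suc l) \<longrightarrow> f l \<subseteq> f (Suc l)) \<and> (pos (p ! Suc l) < pos (p ! l) \<longrightarrow> f (Suc l) \<subseteq> f l)"
    if "Suc l \<le> L" for l
  proof -
    have pk: "pos (p ! l) < k" "pos (p ! Suc l) < k" using pos_k pF that by auto
    show ?thesis
    proof (cases "Suc l \<le> m")
      case True
      hence "f l = \<alpha> ! pos (p ! l)" "f (Suc l) = \<alpha> ! pos (p ! Suc l)" using fL by simp_all
      thus ?thesis using nth_le[OF c(1)] pk by simp
    next
      case False
      hence "f l = \<beta> ! pos (p ! l)" "f (Suc l) = \<beta> ! pos (p ! Suc l)" using fR by simp_all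
      thus ?thesis using nth_le[OF c(2)] pk by simp
    qed
  qed
  define As where "As = map f [0..<Suc L]"
  have An: "As ! l = f l" if "l \<le> L" for l using that by (simp add: As_def del: upt_Suc)
  have "\<exists>\<G>. \<G> \<subseteq> members \<and> weak_copy T \<G> \<and> set As \<subseteq> \<G>"
  proof (rule embed_path[OF T big pos_mono pos_k p(1)])
    show "set p \<subseteq> Field T" using p(2) field by blast
    show "length As = length p" by (simp add: As_def L)
    have "inj_on f {0..<Suc L}"
    proof (rule linorder_inj_onI)
      fix l l' assume "l < l'" "l \<in> {0..<Suc L}" "l' \<in> {0..<Suc L}"
      thus "f l \<noteq> f l'" using finj[of l l'] by auto
    qed auto
    thus "distinct As" by (simp add: As_def distinct_map del: upt_Suc)
    show "As ! l \<in> layer (pos (p ! l))" if "l < length p" for l using flay An[of l] that L by simp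
    show "As ! l \<subseteq> As ! Suc l" if "Suc l < length p" "pos (p ! l) < pos (p ! Suc l)" for l
      using fstep[of l] that An[of l] An[of "Suc l"] L by simp
    show "As ! Suc l \<subseteq> As ! l" if "Suc l < length p" "pos (p ! Suc l) < pos (p ! l)" for l
      using fstep[of l] that An[of l] An[of "Suc l"] L by simp
  qed
  moreover have "f 0 = \<alpha> ! (k - 1)" using fL[of 0] by (simp add: pos_def x_def[symmetric])
  moreover have "f L = \<beta> ! (k - 1)" using fR[of L] L by (simp add: pos_def y_def[symmetric])
  moreover have "f 0 \<in> set As" "f L \<in> set As" unfolding As_def set_map by (auto simp del: upt_Suc)
  ultimately show ?thesis by auto
qed

end

context tree
begin

text \<open>
  Fix a set \<open>A\<close> in position \<open>j\<close>. The sets of the last position linked to \<open>A\<close> have at least \<open>k - 1 - j\<close>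
  more elements than \<open>A\<close>, so there are at least of the order of \<open>n ^ (k - 1 - j)\<close> of them.
\<close>

lemma clique_bound_upward:
  assumes a: "a \<in> comparable_to_all T" "\<And>y. y \<in> comparable_to_all T \<Longrightarrow> (y, a) \<in> T"
    and h: "height (up_set T a) \<ge> 2" and br: "upward_branching (up_set T a)"
    and k: "rank a + height (up_set T a) \<le> k"
  shows "clique_bound T k (k - 1 - rank a)"
proof -
  define j where "j = rank a"
  define e where "e = k - 1 - j"
  have e: "e \<ge> 1" "j < k" "k - 1 < k" "j < k - 1" using h k by (auto simp: e_def j_def)
  define \<delta> where "\<delta> \<eta> = \<eta> / (4 * real e) ^ e" for \<eta> :: real
  have "clique_bound T k e"
  proof (rule clique_boundI)
    show "k \<ge> 1" using e by simp
    show "(\<lambda>_ :: nat set list. 0 :: nat) c < 1" for c by simp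
    show "\<delta> \<eta> > 0" if "\<eta> > 0" for \<eta> using that e by (simp add: \<delta>_def)
  next
    fix \<eta> :: real assume \<eta>: "\<eta> > 0"
    have "\<forall>\<^sub>F n in sequentially. \<eta> / 4 * real n \<ge> real (card (Field T))"
      using \<eta> by (intro eventually_large) simp
    moreover have "\<forall>\<^sub>F n in sequentially. n \<ge> (1 :: nat)" by (rule eventually_ge_at_top)
    ultimately show "\<forall>\<^sub>F n in sequentially. \<forall>C \<sigma>. chain_system n k \<eta> C \<longrightarrow> (\<forall>c\<in>C. (0 :: nat) = \<sigma>) \<longrightarrow>
        (\<exists>S. copy_clique T (\<Union>i<k. chain_system.layer C i) S \<and> real (card S) \<ge> \<delta> \<eta> * real n ^ e)"
    proof (eventually_elim, intro allI impI)
      fix n C and \<sigma> :: nat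
      assume n: "real (card (Field T)) \<le> \<eta> / 4 * real n" "1 \<le> n" and C: "chain_system n k \<eta> C"
      interpret chain_system n k \<eta> C by (rule C)
      have big: "\<eta> * real n / 4 \<ge> real (card (Field T))" using n(1) by simp
      obtain c0 where c0: "c0 \<in> C" using chain_system.nonempty[OF C] by blast
      define A where "A = c0 ! j"
      have A: "A \<in> layer j" using c0 by (auto simp: A_def layer_def)
      define S where "S = linked j (k - 1) A"
      have "real (card S) \<ge> \<eta> * (real n / (4 * real e)) ^ e"
        unfolding S_def
      proof (rule card_linked[OF A e(2,3) _ e(1) n(2)])
        fix B assume "B \<in> linked j (k - 1) A"
        then obtain c where c: "c \<in> C" "c ! j = A" "c ! (k - 1) = B" by (auto simp: linked_def)
        show "card A + e \<le> card B \<or> card B + e \<le> card A"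
          using card_nth_mono[OF c(1), of j "k - 1"] c e unfolding e_def by simp
      qed (use e in simp)
      also have "\<eta> * (real n / (4 * real e)) ^ e = \<delta> \<eta> * real n ^ e" by (simp add: \<delta>_def power_divide)
      finally have "real (card S) \<ge> \<delta> \<eta> * real n ^ e" .
      moreover have "copy_clique T members S"
        unfolding copy_clique_def
      proof (intro conjI ballI impI)
        show "S \<subseteq> members" using linked_subset[of j "k - 1" A] e(3) unfolding S_def by blast
        fix B B' assume B: "B \<in> S" "B' \<in> S" "B \<noteq> B'"
        obtain \<alpha> \<beta> where ab: "\<alpha> \<in> C" "\<beta> \<in> C" "\<alpha> ! j = A" "\<beta> ! j = A" "B = \<alpha> ! (k - 1)" "B' = \<beta> ! (k - 1)"
          using B(1,2) unfolding S_def linked_def by blast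
        show "\<exists>\<G>. \<G> \<subseteq> members \<and> weak_copy T \<G> \<and> B \<in> \<G> \<and> B' \<in> \<G>"
          unfolding ab(5,6)
          by (rule tops_pair_in_copy[OF tree big a h br j_def]) (use k ab B(3) in \<open>simp_all add: j_def\<close>)
      qed
      ultimately show "\<exists>S. copy_clique T members S \<and> real (card S) \<ge> \<delta> \<eta> * real n ^ e" by blast
    qed
  qed
  thus ?thesis by (simp add: e_def j_def)
qed

end

section \<open>Two-way monotone trees\<close>

context tree
begin

lemma rank_dual_ge: "D \<in> Chains T \<Longrightarrow> (\<And>y. y \<in> D \<Longrightarrow> (v, y) \<in> T \<and> y \<noteq> v) \<Longrightarrow> card D \<le> tree.rank (T\<inverse>) v"
  using tree.rank_ge[OF dual, of D v] by simp

lemma rank_dual_attained: "\<exists>D\<in>Chains T. card D = tree.rank (T\<inverse>) v \<and> (\<forall>y\<in>D. (v, y) \<in> T \<and> y \<noteq> v)"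
  using tree.rank_attained[OF dual, of v] by simp

lemma card_chain_le_height_down_set:
  "a \<in> Field T \<Longrightarrow> D \<in> Chains T \<Longrightarrow> (\<And>v. v \<in> D \<Longrightarrow> (v, a) \<in> T) \<Longrightarrow> card D \<le> height (down_set T a)"
  using tree.card_chain_le_height_up_set[OF dual, of a D] by (simp add: up_set_converse)

lemma rank_plus_height:
  assumes "a \<in> Field T"
  shows "rank a + height (up_set T a) \<le> height T"
proof -
  obtain D where D: "D \<in> Chains T" "card D = rank a" "\<forall>y\<in>D. (y, a) \<in> T \<and> y \<noteq> a" using rank_attained by blast
  obtain K where K: "K \<in> Chains T" "card K = height (up_set T a)" "\<forall>v\<in>K. (a, v) \<in> T"
    using height_up_set_attained[OF assms] by blast
  have "D \<union> K \<in> Chains T" using D K trans unfolding Chains_def by blast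
  moreover have "D \<inter> K = {}" using D K antisym by blast
  hence "card (D \<union> K) = card D + card K" using D(1) K(1) finite_chain by (intro card_Un_disjoint)
  ultimately show ?thesis using card_chain_le_height D(2) K(2) by metis
qed

text \<open>
  A chain below \<open>x'\<close> consists of a chain below \<open>x\<close> and elements of the interval from \<open>x\<close> to \<open>x'\<close>.
\<close>

lemma rank_top_le:
  assumes x: "x \<in> comparable_to_all T" and xx': "(x, x') \<in> T"
  shows "rank x' + 2 \<le> height (down_set T x) + card {u. (x, u) \<in> T \<and> (u, x') \<in> T}"
proof -
  let ?I = "{u. (x, u) \<in> T \<and> (u, x') \<in> T}"
  have F: "x \<in> Field T" "x' \<in> Field T" using field[OF xx'] by auto
  have comp: "(x, v) \<in> T \<or> (v, x) \<in> T" if "v \<in> Field T" for v using x that by (simp add: comparable_to_all_def)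
  have finI: "finite ?I" by (rule finite_subset[OF _ fin]) (use field in blast)
  obtain D where D: "D \<in> Chains T" "card D = rank x'" "\<forall>y\<in>D. (y, x') \<in> T \<and> y \<noteq> x'" using rank_attained by blast
  have D1: "insert x' D \<in> Chains T" using D F by (intro insert_chain) auto
  have D2: "insert x (insert x' D) \<in> Chains T"
  proof (rule insert_chain[OF D1 F(1)])
    fix y assume "y \<in> insert x' D"
    with chain_subset[OF D1] have "y \<in> Field T" by (rule subsetD)
    thus "(y, x) \<in> T \<or> (x, y) \<in> T" using comp by blast
  qed
  \<comment> \<open>adding \<open>x\<close> and \<open>x'\<close> makes the count uniform in the case \<open>x = x'\<close>\<close>
  define E where "E = insert x (insert x' D)"
  have finE: "finite E" unfolding E_def by (rule finite_chain[OF D2])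
  have "card (insert x' D) = Suc (rank x')" using D finite_chain[OF D(1)] by auto
  moreover have "card (insert x' D) \<le> card E" using finE unfolding E_def by (intro card_mono) auto
  ultimately have 1: "Suc (rank x') \<le> card E" by simp
  have "card E \<le> card ({v \<in> E. (v, x) \<in> T} \<union> (?I - {x}))"
  proof (rule card_mono)
    show "E \<subseteq> {v \<in> E. (v, x) \<in> T} \<union> (?I - {x})"
    proof
      fix v assume v: "v \<in> E"
      with chain_subset[OF D2] have "v \<in> Field T" unfolding E_def by (rule subsetD)
      moreover have "(v, x') \<in> T" using v D(3) xx' refl F unfolding E_def by blast
      ultimately show "v \<in> {v \<in> E. (v, x) \<in> T} \<union> (?I - {x})" using comp[of v] v refl F by blast
    qed
  qed (use finE finI in auto)
  also have "\<dots> \<le> card {v \<in> E. (v, x) \<in> T} + card (?I - {x})" by (rule card_Un_le)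
  also have "card {v \<in> E. (v, x) \<in> T} \<le> height (down_set T x)"
  proof (rule card_chain_le_height_down_set[OF F(1)])
    show "{v \<in> E. (v, x) \<in> T} \<in> Chains T" using D2 unfolding E_def Chains_def by blast
  qed blast
  also have "card (?I - {x}) = card ?I - 1" using refl F(1) xx' finI by (subst card_Diff_singleton) auto
  finally have 2: "card E \<le> height (down_set T x) + (card ?I - 1)" by simp
  have "card ?I > 0" using refl F(1) xx' finI by (auto simp: card_gt_0_iff)
  thus ?thesis using 1 2 by simp
qed

text \<open>
  A longest chain above \<open>x'\<close> can be extended by the whole interval, which is a chain.
\<close>

lemma rank_bottom_ge:
  assumes "(x, x') \<in> T"
  shows "height (up_set T x') + card {u. (x, u) \<in> T \<and> (u, x') \<in> T} \<le> tree.rank (T\<inverse>) x + 2"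
proof -
  let ?I = "{u. (x, u) \<in> T \<and> (u, x') \<in> T}"
  have F: "x \<in> Field T" "x' \<in> Field T" using field[OF assms] by auto
  have finI: "finite ?I" by (rule finite_subset[OF _ fin]) (use field in blast)
  obtain K where K: "K \<in> Chains T" "card K = height (up_set T x')" "\<forall>v\<in>K. (x', v) \<in> T"
    using height_up_set_attained[OF F(2)] by blast
  define E where "E = K \<union> (?I - {x'})"
  have chainE: "E \<in> Chains T"
    using K(1,3) interval_in_Chains[of x x'] trans unfolding E_def Chains_def by blast
  have "K \<inter> (?I - {x'}) = {}" using K(3) antisym by blast
  hence "card E = card K + card (?I - {x'})"
    unfolding E_def using finite_chain[OF K(1)] finI by (intro card_Un_disjoint) auto
  also have "card (?I - {x'}) = card ?I - 1" using refl F(2) assms finI by (subst card_Diff_singleton) auto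
  finally have cE: "card E = card K + (card ?I - 1)" .
  have "card (E - {x}) \<le> tree.rank (T\<inverse>) x"
  proof (rule rank_dual_ge)
    show "E - {x} \<in> Chains T" using chainE unfolding Chains_def by blast
    show "(x, y) \<in> T \<and> y \<noteq> x" if "y \<in> E - {x}" for y
      using that K(3) trans[OF assms] unfolding E_def by blast
  qed
  moreover have "card E \<le> card (insert x (E - {x}))"
    using finite_chain[OF chainE] by (intro card_mono) auto
  moreover have "card (insert x (E - {x})) = Suc (card (E - {x}))"
    using finite_chain[OF chainE] by (intro card_insert_disjoint) auto
  ultimately show ?thesis using cE K(2) by simp
qed

text \<open>
  Two incomparable elements lie both above \<open>x'\<close> or both below \<open>x\<close>, since the interval from \<open>x\<close> to \<open>x'\<close> is
  a chain. In the first case the two sets share the image of \<open>x'\<close>, which is at least as many layers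
  above the lowest one as the rank of \<open>x'\<close> says; the second case is dual.
\<close>

lemma near_comparable:
  assumes x: "x \<in> comparable_to_all T" and x': "x' \<in> comparable_to_all T" and xx': "(x, x') \<in> T"
    and G: "\<G> \<subseteq> middle_layers n k" "weak_copy T \<G>" "A \<in> \<G>" "B \<in> \<G>" "A \<noteq> B" "card A = card B"
  shows "(\<exists>u\<in>Field T. \<exists>v\<in>Field T. (u, v) \<notin> T \<and> (v, u) \<notin> T) \<and>
         card (A - B) \<le> max (k - 1 - rank x') (k - 1 - tree.rank (T\<inverse>) x)"
proof -
  obtain \<iota> where \<iota>: "bij_betw \<iota> (Field T) \<G>" "\<And>p q. (p, q) \<in> T \<Longrightarrow> \<iota> p \<subseteq> \<iota> q"
    using G(2) by (auto simp: weak_copy_def)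
  define lo where "lo = (int n - int k) div 2 + 1"
  have mid: "finite A \<and> lo \<le> int (card A) \<and> int (card A) \<le> lo + int k - 1" if "A \<in> \<G>" for A
    using that G(1) finite_subset[of A "{1..n}"] unfolding middle_layers_def lo_def by auto
  have finG: "finite A" if "A \<in> \<G>" for A using mid[OF that] by blast
  have im: "\<iota> w \<in> \<G>" if "w \<in> Field T" for w using \<iota>(1) that by (auto simp: bij_betw_def)
  obtain u v where uv: "u \<in> Field T" "A = \<iota> u" "v \<in> Field T" "B = \<iota> v"
    using G(3,4) \<iota>(1) by (auto simp: bij_betw_def)
  have "u \<noteq> v" using uv G(5) by auto
  have inc: False if "(p, q) \<in> T" "p \<noteq> q" "card (\<iota> p) = card (\<iota> q)" for p q
  proof -
    have "card (\<iota> p) < card (\<iota> q)"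
      using copy_strict[OF \<iota> that(1,2)] finG[OF im[of q]] field[OF that(1)] by (intro psubset_card_mono) auto
    thus False using that(3) by simp
  qed
  have nuv: "(u, v) \<notin> T" "(v, u) \<notin> T" using inc[of u v] inc[of v u] \<open>u \<noteq> v\<close> uv G(6) by auto
  have F: "x \<in> Field T" "x' \<in> Field T" using field[OF xx'] by auto
  have comp: "(x, w) \<in> T \<or> (w, x) \<in> T" "(x', w) \<in> T \<or> (w, x') \<in> T" if "w \<in> Field T" for w
    using x x' that by (auto simp: comparable_to_all_def)
  have low: "lo + int (rank x') \<le> int (card (\<iota> x'))"
  proof -
    obtain D where D: "D \<in> Chains T" "card D = rank x'" "\<forall>y\<in>D. (y, x') \<in> T \<and> y \<noteq> x'" using rank_attained by blast
    have "insert x' D \<in> Chains T" using D F by (intro insert_chain) auto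
    from copy_chain_card[OF \<iota> finG this] obtain s t where st: "s \<in> insert x' D" "t \<in> insert x' D"
      "\<And>w. w \<in> insert x' D \<Longrightarrow> (s, w) \<in> T \<and> (w, t) \<in> T" "card (\<iota> s) + card (insert x' D) \<le> card (\<iota> t) + 1"
      by blast
    have "t = x'" using st(2) st(3)[of x'] D(3) antisym by blast
    moreover have "card (insert x' D) = Suc (rank x')" using D finite_chain[OF D(1)] by auto
    moreover have "lo \<le> int (card (\<iota> s))" using mid[OF im[of s]] field st(3)[of s] st(1) by blast
    ultimately show ?thesis using st(4) by simp
  qed
  have high: "int (card (\<iota> x)) \<le> lo + int k - 1 - int (tree.rank (T\<inverse>) x)"
  proof -
    obtain D where D: "D \<in> Chains T" "card D = tree.rank (T\<inverse>) x" "\<forall>y\<in>D. (x, y) \<in> T \<and> y \<noteq> x"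
      using rank_dual_attained by blast
    have "insert x D \<in> Chains T" using D F by (intro insert_chain) auto
    from copy_chain_card[OF \<iota> finG this] obtain s t where st: "s \<in> insert x D" "t \<in> insert x D"
      "\<And>w. w \<in> insert x D \<Longrightarrow> (s, w) \<in> T \<and> (w, t) \<in> T" "card (\<iota> s) + card (insert x D) \<le> card (\<iota> t) + 1"
      by blast
    have "s = x" using st(1) st(3)[of x] D(3) antisym by blast
    moreover have "card (insert x D) = Suc (card D)" using D finite_chain[OF D(1)] by auto
    moreover have "int (card (\<iota> t)) \<le> lo + int k - 1" using mid[OF im[of t]] field st(3)[of t] st(2) by blast
    ultimately show ?thesis using st(4) D(2) by simp
  qed
  have cardAB: "finite A" "finite B" "int (card A) \<le> lo + int k - 1" "lo \<le> int (card B)"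
    using mid G(3,4) by auto
  have "\<not> ((x, u) \<in> T \<and> (x, v) \<in> T \<and> (u, x') \<in> T \<and> (v, x') \<in> T)"
    using interval_chain[of x u v x'] nuv by blast
  moreover have "(x', u) \<in> T \<and> (x', v) \<in> T" if "(x', u) \<in> T \<or> (x', v) \<in> T"
    using that comp(2) uv(1,3) nuv trans by blast
  moreover have "(u, x) \<in> T \<and> (v, x) \<in> T" if "(u, x) \<in> T \<or> (v, x) \<in> T"
    using that comp(1) uv(1,3) nuv trans by blast
  ultimately consider "(x', u) \<in> T" "(x', v) \<in> T" | "(u, x) \<in> T" "(v, x) \<in> T"
    using comp uv(1,3) by blast
  hence "card (A - B) \<le> max (k - 1 - rank x') (k - 1 - tree.rank (T\<inverse>) x)"
  proof cases
    case 1
    have sub: "\<iota> x' \<subseteq> A" "\<iota> x' \<subseteq> B" using \<iota>(2) 1 uv by auto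
    have "card (A - B) \<le> card (A - \<iota> x')" using cardAB sub by (intro card_mono) auto
    also have "\<dots> = card A - card (\<iota> x')" using sub cardAB finG[OF im[OF F(2)]] by (simp add: card_Diff_subset)
    also have "\<dots> \<le> k - 1 - rank x'" using low cardAB(3) by linarith
    finally show ?thesis by simp
  next
    case 2
    have sub: "A \<subseteq> \<iota> x" "B \<subseteq> \<iota> x" using \<iota>(2) 2 uv by auto
    have "card (A - B) \<le> card (\<iota> x - B)" using cardAB sub finG[OF im[OF F(1)]] by (intro card_mono) auto
    also have "\<dots> = card (\<iota> x) - card B" using sub cardAB by (simp add: card_Diff_subset)
    also have "\<dots> \<le> k - 1 - tree.rank (T\<inverse>) x" using high cardAB(4) by linarith
    finally show ?thesis by simp
  qed
  thus ?thesis using nuv uv(1,3) by blast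
qed

text \<open>
  Since the upper part is at least as high as the lower one, \<open>x'\<close> has at most as many levels below it
  as \<open>x\<close> has above it, so the upper part determines the exponent. If the upper part has height 1, so
  has the lower one, and \<open>T\<close> is a chain.
\<close>

lemma upward_clique:
  assumes x: "x \<in> comparable_to_all T" and x': "x' \<in> comparable_to_all T" "\<And>y. y \<in> comparable_to_all T \<Longrightarrow> (y, x') \<in> T"
    and h: "height (down_set T x) \<le> height (up_set T x')" and br: "upward_branching (up_set T x')"
    and k: "height T \<le> k"
  shows "\<exists>e. clique_bound T k e \<and>
     ((\<forall>u\<in>Field T. \<forall>v\<in>Field T. (u, v) \<in> T \<or> (v, u) \<in> T) \<or> e = k - 1 - rank x' \<and> rank x' \<le> tree.rank (T\<inverse>) x)"
proof -
  have xx': "(x, x') \<in> T" using x'(2)[OF x] .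
  have F: "x \<in> Field T" "x' \<in> Field T" using field[OF xx'] by auto
  show ?thesis
  proof (cases "height (up_set T x') \<ge> 2")
    case True
    have "clique_bound T k (k - 1 - rank x')"
      using x' True br rank_plus_height[OF F(2)] k by (intro clique_bound_upward) auto
    moreover have "rank x' \<le> tree.rank (T\<inverse>) x"
      using rank_top_le[OF x xx'] rank_bottom_ge[OF xx'] h by linarith
    ultimately show ?thesis by blast
  next
    case False
    have top: "v = x'" if "(x', v) \<in> T" for v
    proof (rule ccontr)
      assume "v \<noteq> x'"
      moreover have "card {x', v} \<le> height (up_set T x')"
        using that refl field[OF that] by (intro card_chain_le_height_up_set F) (auto simp: Chains_def)
      ultimately show False using False by simp
    qed
    have bot: "v = x" if "(v, x) \<in> T" for v
    proof (rule ccontr)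
      assume "v \<noteq> x"
      moreover have "card {x, v} \<le> height (down_set T x)"
        using that refl field[OF that] by (intro card_chain_le_height_down_set F) (auto simp: Chains_def)
      ultimately show False using False h by simp
    qed
    have "(x, v) \<in> T \<and> (v, x') \<in> T" if "v \<in> Field T" for v
      using x x'(1) that top bot refl unfolding comparable_to_all_def by blast
    hence tot: "\<forall>u\<in>Field T. \<forall>v\<in>Field T. (u, v) \<in> T \<or> (v, u) \<in> T" using interval_chain by blast
    have "k \<ge> 1" using rank_less_height[OF F(1)] k by simp
    thus ?thesis using clique_bound_zero tot by blast
  qed
qed

text \<open>
  When the lower part is the higher one, or it is the branching one of two equally high parts, the
  argument is applied to the dual poset and to complements.
\<close>

theorem ar_m_lower_two_way:
  fixes \<epsilon> :: real
  assumes br: "two_way_branching T" and k: "height T \<le> k" and \<epsilon>: "\<epsilon> > 0"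
  shows "\<exists>\<delta>>0. \<forall>\<^sub>F n in sequentially.
     real (ar_m n (nat \<lceil>(real k - 1 + \<epsilon>) * real (n choose (n div 2))\<rceil>) T) \<ge> \<delta> * real n ^ m_exponent T k"
proof -
  let ?R = "comparable_to_all T"
  obtain x x' where sm: "smallest (Restr T ?R) x" "smallest ((Restr T ?R)\<inverse>) x'"
    and cases: "if height (down_set T x) > height (up_set T x') then downward_branching (down_set T x)
       else if height (up_set T x') > height (down_set T x) then upward_branching (up_set T x')
       else downward_branching (down_set T x) \<or> upward_branching (up_set T x')"
    using br unfolding two_way_branching_def Let_def by blast
  have RF: "Field (Restr T ?R) = ?R"
    using refl by (auto simp: Field_def comparable_to_all_def)
  have x: "x \<in> ?R" "\<And>y. y \<in> ?R \<Longrightarrow> (x, y) \<in> T" using sm(1) unfolding smallest_def RF by auto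
  have x': "x' \<in> ?R" "\<And>y. y \<in> ?R \<Longrightarrow> (y, x') \<in> T"
    using sm(2) RF unfolding smallest_def Field_converse by auto
  have xx': "(x, x') \<in> T" using x'(2)[OF x(1)] .
  have "\<exists>e. clique_bound T k e \<and> ((\<forall>u\<in>Field T. \<forall>v\<in>Field T. (u, v) \<in> T \<or> (v, u) \<in> T) \<or>
      e = max (k - 1 - rank x') (k - 1 - tree.rank (T\<inverse>) x))"
  proof (cases "height (down_set T x) \<le> height (up_set T x') \<and> upward_branching (up_set T x')")
    case True
    then obtain e where e: "clique_bound T k e"
     "(\<forall>u\<in>Field T. \<forall>v\<in>Field T. (u, v) \<in> T \<or> (v, u) \<in> T) \<or> e = k - 1 - rank x' \<and> rank x' \<le> tree.rank (T\<inverse>) x"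
      using upward_clique[OF x(1) x' _ _ k] by blast
    thus ?thesis by (intro exI[of _ e]) auto
  next
    case False
    hence d: "height (up_set T x') \<le> height (down_set T x)" "downward_branching (down_set T x)"
      using cases by (auto split: if_splits)
    have "\<exists>e. clique_bound (T\<inverse>) k e \<and>
     ((\<forall>u\<in>Field (T\<inverse>). \<forall>v\<in>Field (T\<inverse>). (u, v) \<in> T\<inverse> \<or> (v, u) \<in> T\<inverse>) \<or>
       e = k - 1 - tree.rank (T\<inverse>) x \<and> tree.rank (T\<inverse>) x \<le> tree.rank ((T\<inverse>)\<inverse>) x')"
    proof (rule tree.upward_clique[OF dual])
      show "height (down_set (T\<inverse>) x') \<le> height (up_set (T\<inverse>) x)"
        using d(1) up_set_converse[of "T\<inverse>" x'] height_converse[of "down_set (T\<inverse>) x'"]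
        by (simp add: up_set_converse)
      show "upward_branching (up_set (T\<inverse>) x)"
        using d(2) by (simp add: up_set_converse downward_branching_def)
    qed (use x x' k in simp_all)
    then obtain e where e: "clique_bound (T\<inverse>) k e"
      "(\<forall>u\<in>Field T. \<forall>v\<in>Field T. (u, v) \<in> T \<or> (v, u) \<in> T) \<or> e = k - 1 - tree.rank (T\<inverse>) x \<and> tree.rank (T\<inverse>) x \<le> rank x'"
      by auto
    thus ?thesis using clique_bound_dual[OF e(1)] by (intro exI[of _ e]) auto
  qed
  then obtain e where e: "clique_bound T k e"
    "(\<forall>u\<in>Field T. \<forall>v\<in>Field T. (u, v) \<in> T \<or> (v, u) \<in> T) \<or> e = max (k - 1 - rank x') (k - 1 - tree.rank (T\<inverse>) x)"
    by blast
  have "copies_near T k e"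
    unfolding copies_near_def
  proof (intro allI impI)
    fix n \<G> A B
    assume G: "\<G> \<subseteq> middle_layers n k" "weak_copy T \<G>" "A \<in> \<G>" "B \<in> \<G>" "A \<noteq> B" "card A = card B"
    show "card (A - B) \<le> e"
      using near_comparable[OF x(1) x'(1) xx' G] e(2) by blast
  qed
  thus ?thesis using e(1) \<epsilon> by (rule ar_m_lower)
qed

end

theorem theorem1p10:
  fixes T :: "('a \<times> 'a) set"
  assumes "tree_poset T"
  shows "(\<forall>(k::nat) (\<epsilon>::real).
            two_way_monotone T \<and> two_way_branching T \<and> k \<ge> height T \<and> \<epsilon> > 0 \<longrightarrow>
            (\<exists>\<delta>>0. \<forall>\<^sub>F n in sequentially.
               real (ar_m n (nat \<lceil>(real k - 1 + \<epsilon>) * real (n choose (n div 2))\<rceil>) T)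
                 \<ge> \<delta> * real n ^ m_exponent T k)) \<and>
         (\<forall>\<epsilon>::real. height T = 2 \<and> \<epsilon> > 0 \<longrightarrow>
            (\<exists>\<delta>>0. \<forall>\<^sub>F n in sequentially.
               real (ar_m n (nat \<lceil>(1 + \<epsilon>) * real (n choose (n div 2))\<rceil>) T)
                 \<ge> \<delta> * real n ^ m_exponent T 2))"
proof -
  interpret tree T by unfold_locales (rule assms)
  show ?thesis
    using ar_m_lower_two_way ar_m_lower_height_two by blast
qed

end
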